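(* Let $k \ge 2$ be a natural number. Over $\mathsf{RCA}_0$ the following are equivalent (that is, $\mathsf{RCA}_0$ proves the equivalence of): (1) $\mathsf{WKL}_0$ (weak K\"onig's lemma); (2) every locally $k$-chromatic graph is $(2k-1)$-chromatic.
   Context: Work in second-order arithmetic, whose number variables range over $\mathbb{N}$ and set variables over subsets of $\mathbb{N}$; finite sequences, pairs, functions, graphs, etc. are coded by natural numbers and sets in the standard way. $\mathsf{RCA}_0$ is the subsystem consisting of the basic axioms of Peano arithmetic, induction restricted to $\Sigma^0_1$ formulas, and recursive comprehension (any set definable by both a $\Sigma^0_1$ formula and a $\Pi^0_1$ formula, with set parameters, exists). $\mathsf{WKL}_0$ is $\mathsf{RCA}_0$ together with the axiom that every infinite tree of finite $0$--$1$ sequences has an infinite path. A graph $G=\langle V,E\rangle$ has vertex set $V\subseteq\mathbb{N}$ and edge set $E$ a set of unordered pairs of elements of $V$. For $k\in\mathbb{N}$, a $k$-coloring of $G$ is a function $\chi:V\to\{0,\dots,k-1\}$ with $\chi(x)\ne\chi(y)$ whenever $(x,y)\in E$; $G$ is $k$-chromatic if it has a $k$-coloring. $G$ is locally $k$-chromatic if every finite subgraph of $G$ is $k$-chromatic. *)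

theory Defs
  imports Main
begin

section \<open>The language of second-order arithmetic\<close>

text \<open>
  Two-sorted first-order syntax with de Bruijn indices, counted separately for number variables
  and for set variables. The only set terms are set variables, so a set term is just an index.
  Equality is primitive for numbers only; equality of sets is extensional.
\<close>

datatype trm = Var nat | Zero | One | Add trm trm | Mul trm trm

datatype fm =
    Bot
  | Eq trm trm
  | Less trm trm
  | Mem trm nat
  | Imp fm fm
  | AllN fm
  | AllS fm

definition Neg :: "fm \<Rightarrow> fm" where "Neg p = Imp p Bot"
definition And :: "fm \<Rightarrow> fm \<Rightarrow> fm" where "And p q = Neg (Imp p (Neg q))"
definition Or :: "fm \<Rightarrow> fm \<Rightarrow> fm" where "Or p q = Imp (Neg p) q"
definition Iff :: "fm \<Rightarrow> fm \<Rightarrow> fm" where "Iff p q = And (Imp p q) (Imp q p)"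
definition ExN :: "fm \<Rightarrow> fm" where "ExN p = Neg (AllN (Neg p))"
definition ExS :: "fm \<Rightarrow> fm" where "ExS p = Neg (AllS (Neg p))"

text \<open>Simultaneous capture-avoiding substitution of terms for number variables and of set
  variables for set variables.\<close>

primrec tsubst :: "(nat \<Rightarrow> trm) \<Rightarrow> trm \<Rightarrow> trm" where
  "tsubst \<sigma> (Var i) = \<sigma> i"
| "tsubst \<sigma> Zero = Zero"
| "tsubst \<sigma> One = One"
| "tsubst \<sigma> (Add s t) = Add (tsubst \<sigma> s) (tsubst \<sigma> t)"
| "tsubst \<sigma> (Mul s t) = Mul (tsubst \<sigma> s) (tsubst \<sigma> t)"

definition tlift :: "trm \<Rightarrow> trm" where
  "tlift = tsubst (\<lambda>i. Var (Suc i))"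

primrec subst :: "(nat \<Rightarrow> trm) \<Rightarrow> (nat \<Rightarrow> nat) \<Rightarrow> fm \<Rightarrow> fm" where
  "subst \<sigma> \<rho> Bot = Bot"
| "subst \<sigma> \<rho> (Eq s t) = Eq (tsubst \<sigma> s) (tsubst \<sigma> t)"
| "subst \<sigma> \<rho> (Less s t) = Less (tsubst \<sigma> s) (tsubst \<sigma> t)"
| "subst \<sigma> \<rho> (Mem t X) = Mem (tsubst \<sigma> t) (\<rho> X)"
| "subst \<sigma> \<rho> (Imp p q) = Imp (subst \<sigma> \<rho> p) (subst \<sigma> \<rho> q)"
| "subst \<sigma> \<rho> (AllN p) = AllN (subst (case_nat (Var 0) (\<lambda>i. tlift (\<sigma> i))) \<rho> p)"
| "subst \<sigma> \<rho> (AllS p) = AllS (subst \<sigma> (case_nat 0 (\<lambda>i. Suc (\<rho> i))) p)"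

definition liftN :: "fm \<Rightarrow> fm" where
  "liftN = subst (\<lambda>i. Var (Suc i)) (\<lambda>i. i)"

definition liftS :: "fm \<Rightarrow> fm" where
  "liftS = subst Var Suc"

definition instN :: "trm \<Rightarrow> fm \<Rightarrow> fm" where
  "instN t = subst (case_nat t Var) (\<lambda>i. i)"

definition instS :: "nat \<Rightarrow> fm \<Rightarrow> fm" where
  "instS X = subst Var (case_nat X (\<lambda>i. i))"


section \<open>Provability\<close>

text \<open>
  Classical natural deduction with equality; \<open>derives T \<Gamma> p\<close> means that \<open>p\<close> follows from the
  theory \<open>T\<close> and the undischarged hypotheses \<open>\<Gamma>\<close>. The eigenvariable conditions (the lifting in
  \<open>AllN_I\<close> and \<open>AllS_I\<close>) concern \<open>\<Gamma>\<close> only, so an axiom in \<open>T\<close> with free variables has the same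
  force as its universal closure.
\<close>

inductive derives :: "fm set \<Rightarrow> fm list \<Rightarrow> fm \<Rightarrow> bool" for T :: "fm set" where
  Axiom: "p \<in> T \<Longrightarrow> derives T \<Gamma> p"
| Hyp: "p \<in> set \<Gamma> \<Longrightarrow> derives T \<Gamma> p"
| Imp_I: "derives T (p # \<Gamma>) q \<Longrightarrow> derives T \<Gamma> (Imp p q)"
| Imp_E: "derives T \<Gamma> (Imp p q) \<Longrightarrow> derives T \<Gamma> p \<Longrightarrow> derives T \<Gamma> q"
| Contradiction: "derives T (Neg p # \<Gamma>) Bot \<Longrightarrow> derives T \<Gamma> p"
| AllN_I: "derives T (map liftN \<Gamma>) p \<Longrightarrow> derives T \<Gamma> (AllN p)"
| AllN_E: "derives T \<Gamma> (AllN p) \<Longrightarrow> derives T \<Gamma> (instN t p)"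
| AllS_I: "derives T (map liftS \<Gamma>) p \<Longrightarrow> derives T \<Gamma> (AllS p)"
| AllS_E: "derives T \<Gamma> (AllS p) \<Longrightarrow> derives T \<Gamma> (instS X p)"
| Eq_refl: "derives T \<Gamma> (Eq t t)"
| Eq_subst: "derives T \<Gamma> (Eq s t) \<Longrightarrow> derives T \<Gamma> (instN s p) \<Longrightarrow> derives T \<Gamma> (instN t p)"

definition proves :: "fm set \<Rightarrow> fm \<Rightarrow> bool" (infix "\<turnstile>" 50) where
  "T \<turnstile> p \<longleftrightarrow> derives T [] p"


section \<open>Binder notation for formulas\<close>

text \<open>
  To write concrete formulas with named bound variables, formulas are represented as functions of
  the numbers \<open>m\<close>, \<open>n\<close> of number and set quantifiers in whose scope they stand, and terms as
  functions of \<open>m\<close> (set variables: of \<open>n\<close>). A variable bound under \<open>m\<close> number quantifiers has, at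
  depth \<open>m'\<close>, the de Bruijn index \<open>m' - Suc m\<close>. A closed formula \<open>p\<close> denotes the
  \<^typ>\<open>fm\<close> \<open>sentence p\<close>.
\<close>

type_synonym ntrm = "nat \<Rightarrow> trm"
type_synonym svar = "nat \<Rightarrow> nat"
type_synonym form = "nat \<Rightarrow> nat \<Rightarrow> fm"

definition sentence :: "form \<Rightarrow> fm" where
  "sentence p = p 0 0"

definition bAllN :: "(ntrm \<Rightarrow> form) \<Rightarrow> form" (binder "\<^bold>\<forall>" 10) where
  "bAllN P = (\<lambda>m n. AllN (P (\<lambda>m'. Var (m' - Suc m)) (Suc m) n))"
definition bExN :: "(ntrm \<Rightarrow> form) \<Rightarrow> form" (binder "\<^bold>\<exists>" 10) where
  "bExN P = (\<lambda>m n. ExN (P (\<lambda>m'. Var (m' - Suc m)) (Suc m) n))"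
definition bAllS :: "(svar \<Rightarrow> form) \<Rightarrow> form" (binder "\<^bold>\<forall>\<^sub>S" 10) where
  "bAllS P = (\<lambda>m n. AllS (P (\<lambda>n'. n' - Suc n) m (Suc n)))"
definition bExS :: "(svar \<Rightarrow> form) \<Rightarrow> form" (binder "\<^bold>\<exists>\<^sub>S" 10) where
  "bExS P = (\<lambda>m n. ExS (P (\<lambda>n'. n' - Suc n) m (Suc n)))"

definition bTrue :: form ("\<^bold>\<top>") where
  "(\<^bold>\<top>) = (\<lambda>m n. Neg Bot)"
definition bNeg :: "form \<Rightarrow> form" ("\<^bold>\<not> _" [40] 40) where
  "(\<^bold>\<not> p) = (\<lambda>m n. Neg (p m n))"
definition bAnd :: "form \<Rightarrow> form \<Rightarrow> form" (infixr "\<^bold>\<and>" 35) where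
  "(p \<^bold>\<and> q) = (\<lambda>m n. And (p m n) (q m n))"
definition bOr :: "form \<Rightarrow> form \<Rightarrow> form" (infixr "\<^bold>\<or>" 30) where
  "(p \<^bold>\<or> q) = (\<lambda>m n. Or (p m n) (q m n))"
definition bImp :: "form \<Rightarrow> form \<Rightarrow> form" (infixr "\<^bold>\<longrightarrow>" 25) where
  "(p \<^bold>\<longrightarrow> q) = (\<lambda>m n. Imp (p m n) (q m n))"
definition bIff :: "form \<Rightarrow> form \<Rightarrow> form" (infixr "\<^bold>\<longleftrightarrow>" 25) where
  "(p \<^bold>\<longleftrightarrow> q) = (\<lambda>m n. Iff (p m n) (q m n))"

definition bEq :: "ntrm \<Rightarrow> ntrm \<Rightarrow> form" (infix "\<^bold>=" 50) where
  "(s \<^bold>= t) = (\<lambda>m n. Eq (s m) (t m))"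
definition bLess :: "ntrm \<Rightarrow> ntrm \<Rightarrow> form" (infix "\<^bold><" 50) where
  "(s \<^bold>< t) = (\<lambda>m n. Less (s m) (t m))"
definition bMem :: "ntrm \<Rightarrow> svar \<Rightarrow> form" (infix "\<^bold>\<in>" 50) where
  "(t \<^bold>\<in> X) = (\<lambda>m n. Mem (t m) (X n))"

definition bAdd :: "ntrm \<Rightarrow> ntrm \<Rightarrow> ntrm" (infixl "\<^bold>+" 65) where
  "(s \<^bold>+ t) = (\<lambda>m. Add (s m) (t m))"
definition bMul :: "ntrm \<Rightarrow> ntrm \<Rightarrow> ntrm" (infixl "\<^bold>*" 70) where
  "(s \<^bold>* t) = (\<lambda>m. Mul (s m) (t m))"

primrec numeral_trm :: "nat \<Rightarrow> trm" where
  "numeral_trm 0 = Zero"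
| "numeral_trm (Suc k) = Add (numeral_trm k) One"

definition numterm :: "nat \<Rightarrow> ntrm" where
  "numterm k = (\<lambda>m. numeral_trm k)"
definition bZero :: ntrm ("\<^bold>0") where
  "(\<^bold>0) = (\<lambda>m. Zero)"
definition bOne :: ntrm ("\<^bold>1") where
  "(\<^bold>1) = (\<lambda>m. One)"


section \<open>The axiom system $\mathsf{RCA}_0$\<close>

definition basic_axioms :: "form set" where
  "basic_axioms =
    { \<^bold>\<forall>x. \<^bold>\<not> x \<^bold>+ \<^bold>1 \<^bold>= \<^bold>0,
      \<^bold>\<forall>x. \<^bold>\<forall>y. x \<^bold>+ \<^bold>1 \<^bold>= y \<^bold>+ \<^bold>1 \<^bold>\<longrightarrow> x \<^bold>= y,
      \<^bold>\<forall>x. x \<^bold>+ \<^bold>0 \<^bold>= x,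
      \<^bold>\<forall>x. \<^bold>\<forall>y. x \<^bold>+ (y \<^bold>+ \<^bold>1) \<^bold>= (x \<^bold>+ y) \<^bold>+ \<^bold>1,
      \<^bold>\<forall>x. x \<^bold>* \<^bold>0 \<^bold>= \<^bold>0,
      \<^bold>\<forall>x. \<^bold>\<forall>y. x \<^bold>* (y \<^bold>+ \<^bold>1) \<^bold>= (x \<^bold>* y) \<^bold>+ x,
      \<^bold>\<forall>x. \<^bold>\<not> x \<^bold>< \<^bold>0,
      \<^bold>\<forall>x. \<^bold>\<forall>y. x \<^bold>< y \<^bold>+ \<^bold>1 \<^bold>\<longleftrightarrow> (x \<^bold>< y \<^bold>\<or> x \<^bold>= y) }"

text \<open>
  The bounded formulas ($\Sigma^0_0$): no set quantifiers, and number quantifiers only of the forms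
  $\forall x < t$ and $\exists x < t$ with \<open>x\<close> not occurring in \<open>t\<close>, whence the \<^const>\<open>tlift\<close>.
  Closure under negation, conjunction and disjunction follows from that under \<^const>\<open>Imp\<close>.
\<close>

inductive bounded_fm :: "fm \<Rightarrow> bool" where
  "bounded_fm Bot"
| "bounded_fm (Eq s t)"
| "bounded_fm (Less s t)"
| "bounded_fm (Mem t X)"
| "bounded_fm p \<Longrightarrow> bounded_fm q \<Longrightarrow> bounded_fm (Imp p q)"
| "bounded_fm p \<Longrightarrow> bounded_fm (AllN (Imp (Less (Var 0) (tlift t)) p))"
| "bounded_fm p \<Longrightarrow> bounded_fm (ExN (And (Less (Var 0) (tlift t)) p))"

definition Sigma01 :: "fm \<Rightarrow> bool" where
  "Sigma01 p \<longleftrightarrow> (\<exists>q. bounded_fm q \<and> p = ExN q)"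

definition Pi01 :: "fm \<Rightarrow> bool" where
  "Pi01 p \<longleftrightarrow> (\<exists>q. bounded_fm q \<and> p = AllN q)"

text \<open>In the two schemes number variable 0 of \<open>p\<close> and \<open>q\<close> is the induction (comprehension)
  variable; all other free variables are parameters.\<close>

definition induction_axiom :: "fm \<Rightarrow> fm" where
  "induction_axiom p =
    Imp (And (instN Zero p)
             (AllN (Imp p (subst (case_nat (Add (Var 0) One) (\<lambda>i. Var (Suc i))) (\<lambda>i. i) p))))
        (AllN p)"

definition comprehension_axiom :: "fm \<Rightarrow> fm \<Rightarrow> fm" where
  "comprehension_axiom p q =
    Imp (AllN (Iff p q)) (ExS (AllN (Iff (Mem (Var 0) 0) (liftS p))))"

definition RCA0 :: "fm set" where
  "RCA0 = sentence ` basic_axioms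
        \<union> {induction_axiom p | p. Sigma01 p}
        \<union> {comprehension_axiom p q | p q. Sigma01 p \<and> Pi01 q}"


section \<open>Coding of pairs, functions, finite sets and finite sequences\<close>

definition pair :: "ntrm \<Rightarrow> ntrm \<Rightarrow> ntrm" where
  "pair x y = (x \<^bold>+ y) \<^bold>* (x \<^bold>+ y) \<^bold>+ x"

definition finite_set :: "svar \<Rightarrow> form" where
  "finite_set X = (\<^bold>\<exists>b. \<^bold>\<forall>x. x \<^bold>\<in> X \<^bold>\<longrightarrow> x \<^bold>< b)"

text \<open>\<open>F\<close> is a function from \<open>{x. D x}\<close> to \<open>{0, \<dots>, k - 1}\<close>.\<close>

definition function_on :: "(ntrm \<Rightarrow> form) \<Rightarrow> ntrm \<Rightarrow> svar \<Rightarrow> form" where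
  "function_on D k F =
    ((\<^bold>\<forall>p. p \<^bold>\<in> F \<^bold>\<longrightarrow> (\<^bold>\<exists>x. \<^bold>\<exists>c. p \<^bold>= pair x c \<^bold>\<and> D x \<^bold>\<and> c \<^bold>< k)) \<^bold>\<and>
     (\<^bold>\<forall>x. D x \<^bold>\<longrightarrow> (\<^bold>\<exists>c. pair x c \<^bold>\<in> F \<^bold>\<and> (\<^bold>\<forall>d. pair x d \<^bold>\<in> F \<^bold>\<longrightarrow> d \<^bold>= c))))"

definition divides :: "ntrm \<Rightarrow> ntrm \<Rightarrow> form" where
  "divides s t = (\<^bold>\<exists>q. t \<^bold>= s \<^bold>* q)"

text \<open>
  Finite sets are coded as in Simpson's book: a triple $(k,(m,n))$ represents
  $\{i < k : m(i+1)+1 \mathrel{\mathrm{divides}} n\}$, and the code of a finite set is the least triple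
  representing it.
\<close>

definition is_triple :: "ntrm \<Rightarrow> form" where
  "is_triple c = (\<^bold>\<exists>k. \<^bold>\<exists>m. \<^bold>\<exists>n. c \<^bold>= pair k (pair m n))"

definition elem :: "ntrm \<Rightarrow> ntrm \<Rightarrow> form" where
  "elem i c = (\<^bold>\<exists>k. \<^bold>\<exists>m. \<^bold>\<exists>n. c \<^bold>= pair k (pair m n) \<^bold>\<and> i \<^bold>< k \<^bold>\<and>
                 divides (m \<^bold>* (i \<^bold>+ \<^bold>1) \<^bold>+ \<^bold>1) n)"

definition set_code :: "ntrm \<Rightarrow> form" where
  "set_code c = (is_triple c \<^bold>\<and>
     (\<^bold>\<forall>d. d \<^bold>< c \<^bold>\<and> is_triple d \<^bold>\<longrightarrow> \<^bold>\<not> (\<^bold>\<forall>i. elem i d \<^bold>\<longleftrightarrow> elem i c)))"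

text \<open>A finite sequence is a finite function, as a set of pairs, whose domain is $\{i : i < l\}$
  for some \<open>l\<close>, its length.\<close>

definition has_length :: "ntrm \<Rightarrow> ntrm \<Rightarrow> form" where
  "has_length s l = (\<^bold>\<forall>i. i \<^bold>< l \<^bold>\<longleftrightarrow> (\<^bold>\<exists>j. elem (pair i j) s))"

definition seq :: "ntrm \<Rightarrow> form" where
  "seq s = (set_code s \<^bold>\<and>
     (\<^bold>\<forall>p. elem p s \<^bold>\<longrightarrow> (\<^bold>\<exists>i. \<^bold>\<exists>j. p \<^bold>= pair i j)) \<^bold>\<and>
     (\<^bold>\<forall>i. \<^bold>\<forall>j. \<^bold>\<forall>j'. elem (pair i j) s \<^bold>\<and> elem (pair i j') s \<^bold>\<longrightarrow> j \<^bold>= j') \<^bold>\<and>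
     (\<^bold>\<exists>l. has_length s l))"

definition binary_seq :: "ntrm \<Rightarrow> form" where
  "binary_seq s = (seq s \<^bold>\<and> (\<^bold>\<forall>i. \<^bold>\<forall>j. elem (pair i j) s \<^bold>\<longrightarrow> j \<^bold>= \<^bold>0 \<^bold>\<or> j \<^bold>= \<^bold>1))"

text \<open>For sequences, being an initial segment is inclusion of their graphs.\<close>

definition initial_segment :: "ntrm \<Rightarrow> ntrm \<Rightarrow> form" where
  "initial_segment t s = (\<^bold>\<forall>i. \<^bold>\<forall>j. elem (pair i j) t \<^bold>\<longrightarrow> elem (pair i j) s)"


section \<open>Weak Koenig's lemma\<close>

definition binary_tree :: "svar \<Rightarrow> form" where
  "binary_tree T = (\<^bold>\<forall>s. s \<^bold>\<in> T \<^bold>\<longrightarrow>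
     binary_seq s \<^bold>\<and> (\<^bold>\<forall>t. seq t \<^bold>\<and> initial_segment t s \<^bold>\<longrightarrow> t \<^bold>\<in> T))"

definition is_path :: "svar \<Rightarrow> svar \<Rightarrow> form" where
  "is_path T F = (function_on (\<lambda>x. \<^bold>\<top>) (numterm 2) F \<^bold>\<and>
     (\<^bold>\<forall>l. \<^bold>\<exists>s. s \<^bold>\<in> T \<^bold>\<and> has_length s l \<^bold>\<and>
        (\<^bold>\<forall>i. \<^bold>\<forall>j. elem (pair i j) s \<^bold>\<longrightarrow> pair i j \<^bold>\<in> F)))"

definition WKL :: form where
  "WKL = (\<^bold>\<forall>\<^sub>ST. binary_tree T \<^bold>\<and> \<^bold>\<not> finite_set T \<^bold>\<longrightarrow> (\<^bold>\<exists>\<^sub>SF. is_path T F))"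


section \<open>Graphs and colorings\<close>

text \<open>The unordered pair $\{x,y\}$ of distinct vertices is coded by \<open>pair (min x y) (max x y)\<close>.\<close>

definition is_graph :: "svar \<Rightarrow> svar \<Rightarrow> form" where
  "is_graph V E = (\<^bold>\<forall>p. p \<^bold>\<in> E \<^bold>\<longrightarrow>
     (\<^bold>\<exists>x. \<^bold>\<exists>y. p \<^bold>= pair x y \<^bold>\<and> x \<^bold>\<in> V \<^bold>\<and> y \<^bold>\<in> V \<^bold>\<and> x \<^bold>< y))"

definition adjacent :: "svar \<Rightarrow> ntrm \<Rightarrow> ntrm \<Rightarrow> form" where
  "adjacent E x y = (x \<^bold>< y \<^bold>\<and> pair x y \<^bold>\<in> E \<^bold>\<or> y \<^bold>< x \<^bold>\<and> pair y x \<^bold>\<in> E)"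

definition coloring :: "svar \<Rightarrow> svar \<Rightarrow> ntrm \<Rightarrow> svar \<Rightarrow> form" where
  "coloring V E k C = (function_on (\<lambda>x. x \<^bold>\<in> V) k C \<^bold>\<and>
     (\<^bold>\<forall>x. \<^bold>\<forall>y. adjacent E x y \<^bold>\<longrightarrow>
        (\<^bold>\<forall>c. \<^bold>\<forall>d. pair x c \<^bold>\<in> C \<^bold>\<and> pair y d \<^bold>\<in> C \<^bold>\<longrightarrow> \<^bold>\<not> c \<^bold>= d)))"

definition chromatic :: "svar \<Rightarrow> svar \<Rightarrow> ntrm \<Rightarrow> form" where
  "chromatic V E k = (\<^bold>\<exists>\<^sub>SC. coloring V E k C)"

definition subgraph :: "svar \<Rightarrow> svar \<Rightarrow> svar \<Rightarrow> svar \<Rightarrow> form" where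
  "subgraph V' E' V E = (is_graph V' E' \<^bold>\<and>
     (\<^bold>\<forall>x. x \<^bold>\<in> V' \<^bold>\<longrightarrow> x \<^bold>\<in> V) \<^bold>\<and> (\<^bold>\<forall>p. p \<^bold>\<in> E' \<^bold>\<longrightarrow> p \<^bold>\<in> E))"

definition locally_chromatic :: "svar \<Rightarrow> svar \<Rightarrow> ntrm \<Rightarrow> form" where
  "locally_chromatic V E k = (\<^bold>\<forall>\<^sub>SV'. \<^bold>\<forall>\<^sub>SE'.
     subgraph V' E' V E \<^bold>\<and> finite_set V' \<^bold>\<longrightarrow> chromatic V' E' k)"

end

theory Submission
  imports Defs "HOL-Library.Countable_Set"
begin

text \<open>
  By completeness it suffices to argue in a countable model of $\mathsf{RCA}_0$.

  If weak Koenig's lemma holds, the colorings of a locally \<open>k\<close>-chromatic graph are the paths of a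
  binary tree of approximations to their graphs, which is infinite since finite subgraphs can be
  colored.

  Conversely, $(2k-1)$-colorability separates two disjoint $\Sigma^0_1$ sets. Take a complete
  \<open>k\<close>-partite graph with infinite classes, and a complete graph on \<open>k\<close> vertices for each \<open>n\<close>. When
  \<open>n\<close> is found to lie in the first set, the \<open>j\<close>-th vertex of the \<open>n\<close>-th complete graph is matched
  with class \<open>j\<close> by joining it to all later vertices of the other classes; when \<open>n\<close> is found to lie
  in the second set, it is matched with class \<open>j + 1\<close> modulo \<open>k\<close> instead. In a $(2k-1)$-coloring some
  color \<open>c\<^sub>i\<close> recurs cofinally on class \<open>i\<close>, these are \<open>k\<close> different colors, and so every complete
  graph contains one of them. Its vertex \<open>j\<close> can have color \<open>c\<^sub>i\<close> only if it is not matched with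
  a class other than \<open>i\<close>. Hence the set of \<open>n\<close> such that some vertex \<open>j\<close> has color \<open>c\<^sub>j\<close> separates.
  Finally, a path through an infinite tree is found by separating the nodes whose left subtree dies
  first from those whose right subtree dies first.
\<close>

section \<open>Substitution\<close>

text \<open>Passing to models turns the coded notions into HOL predicates, but a model may be
  nonstandard, so induction and set formation of HOL say nothing about its elements. Only induction
  and comprehension for predicates of proved complexity are available, which is why every coded
  notion receives an equivalent with explicit bounds and a rule for \<open>D0\<close>. Countability
  lets a single environment list all elements, so that arbitrary parameters can be used. The number
  \<open>k\<close>, in contrast, is standard. Counting colors therefore takes place outside the
  model: the recurring colors are just chosen, and enter the separating set as \<open>k\<close>
  parameters. The \<open>k\<close> recurring colors and the \<open>k\<close> colors of a complete
  graph cannot all differ when only \<open>2 k - 1\<close> are available, which is where this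
  constant comes from. An edge appears only after a witness has been seen, so the edge set is
  decidable although the two sets are merely enumerable. A finite subgraph sees only witnesses below
  a bound, and since the sets are disjoint, each of its complete graphs is matched in at most one
  way; hence \<open>k\<close> colors suffice locally.\<close>

instance trm :: countable by countable_datatype
instance fm :: countable by countable_datatype

lemmas fm_defs = Neg_def And_def Or_def Iff_def ExN_def ExS_def

abbreviation liftv :: "(nat \<Rightarrow> trm) \<Rightarrow> nat \<Rightarrow> trm" where
  "liftv \<sigma> \<equiv> case_nat (Var 0) (\<lambda>i. tlift (\<sigma> i))"

abbreviation lifts :: "(nat \<Rightarrow> nat) \<Rightarrow> nat \<Rightarrow> nat" where
  "lifts \<rho> \<equiv> case_nat 0 (\<lambda>i. Suc (\<rho> i))"

lemma tsubst_tsubst: "tsubst \<tau> (tsubst \<sigma> t) = tsubst (\<lambda>i. tsubst \<tau> (\<sigma> i)) t"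
  by (induction t) auto

lemma tsubst_Var [simp]: "tsubst Var t = t"
  by (induction t) auto

lemma tsubst_tlift: "tsubst \<tau> (tlift t) = tsubst (\<lambda>i. \<tau> (Suc i)) t"
  by (simp add: tlift_def tsubst_tsubst)

lemma tlift_tsubst: "tlift (tsubst \<sigma> t) = tsubst (\<lambda>i. tlift (\<sigma> i)) t"
  by (simp add: tlift_def tsubst_tsubst)

lemma tlift_simps [simp]:
  "tlift (Var i) = Var (Suc i)" "tlift Zero = Zero" "tlift One = One"
  "tlift (Add s t) = Add (tlift s) (tlift t)" "tlift (Mul s t) = Mul (tlift s) (tlift t)"
  by (simp_all add: tlift_def)

lemma tsubst_liftv_tlift: "tsubst (liftv \<sigma>) (tlift t) = tlift (tsubst \<sigma> t)"
  by (simp add: tsubst_tlift tlift_tsubst)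

lemma subst_subst:
  "subst \<tau> \<pi> (subst \<sigma> \<rho> p) = subst (\<lambda>i. tsubst \<tau> (\<sigma> i)) (\<lambda>i. \<pi> (\<rho> i)) p"
proof (induction p arbitrary: \<sigma> \<rho> \<tau> \<pi>)
  case (AllN p)
  have "(\<lambda>i. tsubst (liftv \<tau>) (liftv \<sigma> i)) = liftv (\<lambda>i. tsubst \<tau> (\<sigma> i))"
    by (auto simp: fun_eq_iff tsubst_liftv_tlift split: nat.split)
  then show ?case by (simp add: AllN)
next
  case (AllS p)
  have "(\<lambda>i. lifts \<pi> (lifts \<rho> i)) = lifts (\<lambda>i. \<pi> (\<rho> i))"
    by (auto simp: fun_eq_iff split: nat.split)
  then show ?case by (simp add: AllS)
qed (auto simp: tsubst_tsubst)

lemma case_nat_Var_Suc: "case_nat (Var 0) (\<lambda>i. Var (Suc i)) = Var"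
  by (auto simp: fun_eq_iff split: nat.split)

lemma case_nat_0_Suc: "case_nat 0 Suc = (\<lambda>i. i)"
  by (auto simp: fun_eq_iff split: nat.split)

lemma subst_ident: "subst Var (\<lambda>i. i) p = p"
  by (induction p) (auto simp: case_nat_Var_Suc case_nat_0_Suc)

lemma subst_simps [simp]:
  "subst \<sigma> \<rho> (Neg p) = Neg (subst \<sigma> \<rho> p)"
  "subst \<sigma> \<rho> (And p q) = And (subst \<sigma> \<rho> p) (subst \<sigma> \<rho> q)"
  "subst \<sigma> \<rho> (Or p q) = Or (subst \<sigma> \<rho> p) (subst \<sigma> \<rho> q)"
  "subst \<sigma> \<rho> (Iff p q) = Iff (subst \<sigma> \<rho> p) (subst \<sigma> \<rho> q)"
  "subst \<sigma> \<rho> (ExN p) = ExN (subst (liftv \<sigma>) \<rho> p)"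
  "subst \<sigma> \<rho> (ExS p) = ExS (subst \<sigma> (lifts \<rho>) p)"
  by (simp_all add: fm_defs)

lemma subst_instN: "subst \<sigma> \<rho> (instN t p) = instN (tsubst \<sigma> t) (subst (liftv \<sigma>) \<rho> p)"
proof -
  have "(\<lambda>i. tsubst \<sigma> (case_nat t Var i))
      = (\<lambda>i. tsubst (case_nat (tsubst \<sigma> t) Var) (liftv \<sigma> i))"
    by (auto simp: fun_eq_iff tsubst_tlift split: nat.split)
  then show ?thesis by (simp add: instN_def subst_subst)
qed

lemma subst_instS: "subst \<sigma> \<rho> (instS X p) = instS (\<rho> X) (subst \<sigma> (lifts \<rho>) p)"
proof -
  have "(\<lambda>i. \<rho> (case_nat X (\<lambda>i. i) i)) = (\<lambda>i. case_nat (\<rho> X) (\<lambda>i. i) (lifts \<rho> i))"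
    by (auto simp: fun_eq_iff split: nat.split)
  then show ?thesis by (simp add: instS_def subst_subst)
qed

lemma subst_liftN: "subst (liftv \<sigma>) \<rho> (liftN p) = liftN (subst \<sigma> \<rho> p)"
  by (simp add: liftN_def subst_subst flip: tlift_def)

lemma subst_liftS: "subst \<sigma> (lifts \<rho>) (liftS p) = liftS (subst \<sigma> \<rho> p)"
  by (simp add: liftS_def subst_subst)

lemma instN_subst_liftv: "instN t (subst (liftv \<sigma>) \<rho> p) = subst (case_nat t \<sigma>) \<rho> p"
proof -
  have "(\<lambda>i. tsubst (case_nat t Var) (liftv \<sigma> i)) = case_nat t \<sigma>"
    by (auto simp: fun_eq_iff tsubst_tlift split: nat.split)
  then show ?thesis by (simp add: instN_def subst_subst)
qed

lemma instS_subst_lifts: "instS X (subst \<sigma> (lifts \<rho>) p) = subst \<sigma> (case_nat X \<rho>) p"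
proof -
  have "(\<lambda>i. case_nat X (\<lambda>i. i) (lifts \<rho> i)) = case_nat X \<rho>"
    by (auto simp: fun_eq_iff split: nat.split)
  then show ?thesis by (simp add: instS_def subst_subst)
qed

section \<open>Finite support of terms and formulas\<close>

lemma tsubst_cong_finite: "\<exists>N. \<forall>\<sigma> \<tau>. (\<forall>i<N. \<sigma> i = \<tau> i) \<longrightarrow> tsubst \<sigma> t = tsubst \<tau> t"
proof (induction t)
  case (Var x)
  then show ?case by (intro exI[of _ "Suc x"]) auto
next
  case (Add s t)
  then obtain M N where "\<forall>\<sigma> \<tau>. (\<forall>i<M. \<sigma> i = \<tau> i) \<longrightarrow> tsubst \<sigma> s = tsubst \<tau> s"
    "\<forall>\<sigma> \<tau>. (\<forall>i<N. \<sigma> i = \<tau> i) \<longrightarrow> tsubst \<sigma> t = tsubst \<tau> t" by blast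
  then show ?case by (intro exI[of _ "max M N"]) (auto simp: less_max_iff_disj)
next
  case (Mul s t)
  then obtain M N where "\<forall>\<sigma> \<tau>. (\<forall>i<M. \<sigma> i = \<tau> i) \<longrightarrow> tsubst \<sigma> s = tsubst \<tau> s"
    "\<forall>\<sigma> \<tau>. (\<forall>i<N. \<sigma> i = \<tau> i) \<longrightarrow> tsubst \<sigma> t = tsubst \<tau> t" by blast
  then show ?case by (intro exI[of _ "max M N"]) (auto simp: less_max_iff_disj)
qed auto

text \<open>A stand-in for "all free indices of both sorts are below \<open>N\<close>" that needs no
  free-variable function. Every index from \<open>N\<close> on is then usable as a fresh
  eigenvariable.\<close>

definition supported :: "nat \<Rightarrow> fm \<Rightarrow> bool" where
  "supported N p \<longleftrightarrow> (\<forall>\<sigma> \<tau> \<rho> \<pi>. (\<forall>i<N. \<sigma> i = \<tau> i \<and> \<rho> i = \<pi> i) \<longrightarrow> subst \<sigma> \<rho> p = subst \<tau> \<pi> p)"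

lemma supported_mono: "supported M p \<Longrightarrow> M \<le> N \<Longrightarrow> supported N p"
  unfolding supported_def by (meson order_less_le_trans)

lemma supported_pair: "\<exists>N. supported N p \<Longrightarrow> \<exists>N. supported N q \<Longrightarrow> \<exists>N. supported N p \<and> supported N q"
  by (meson supported_mono nat_le_linear)

lemma tsubst_cong_finite2:
  "\<exists>N. \<forall>\<sigma> \<tau>. (\<forall>i<N. \<sigma> i = \<tau> i) \<longrightarrow> tsubst \<sigma> s = tsubst \<tau> s \<and> tsubst \<sigma> t = tsubst \<tau> t"
  using tsubst_cong_finite[of "Add s t"] by simp

lemma supported_ex: "\<exists>N. supported N p"
proof (induction p)
  case (Eq s t)
  then show ?case
    using tsubst_cong_finite2[of s t] unfolding supported_def by simp blast
next
  case (Less s t)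
  then show ?case
    using tsubst_cong_finite2[of s t] unfolding supported_def by simp blast
next
  case (Mem t X)
  obtain N where N: "\<forall>\<sigma> \<tau>. (\<forall>i<N. \<sigma> i = \<tau> i) \<longrightarrow> tsubst \<sigma> t = tsubst \<tau> t"
    using tsubst_cong_finite by blast
  show ?case
    unfolding supported_def
  proof (intro exI[of _ "max N (Suc X)"] allI impI)
    fix \<sigma> \<tau> :: "nat \<Rightarrow> trm" and \<rho> \<pi> :: "nat \<Rightarrow> nat"
    assume "\<forall>i<max N (Suc X). \<sigma> i = \<tau> i \<and> \<rho> i = \<pi> i"
    moreover have "X < max N (Suc X)" by simp
    ultimately show "subst \<sigma> \<rho> (Mem t X) = subst \<tau> \<pi> (Mem t X)"
      using N by auto
  qed
next
  case (Imp p q)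
  then obtain N where "supported N p \<and> supported N q" using supported_pair by blast
  then show ?case unfolding supported_def by (intro exI[of _ N]) (metis subst.simps(5))
next
  case (AllN p)
  then obtain N where N: "supported N p" by blast
  have "supported N (AllN p)"
    unfolding supported_def
  proof (intro allI impI)
    fix \<sigma> \<tau> :: "nat \<Rightarrow> trm" and \<rho> \<pi> :: "nat \<Rightarrow> nat"
    assume "\<forall>i<N. \<sigma> i = \<tau> i \<and> \<rho> i = \<pi> i"
    then have "\<forall>i<N. liftv \<sigma> i = liftv \<tau> i \<and> \<rho> i = \<pi> i"
      by (auto split: nat.split)
    then have "subst (liftv \<sigma>) \<rho> p = subst (liftv \<tau>) \<pi> p"
      using N unfolding supported_def by blast
    then show "subst \<sigma> \<rho> (AllN p) = subst \<tau> \<pi> (AllN p)" by simp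
  qed
  then show ?case by blast
next
  case (AllS p)
  then obtain N where N: "supported N p" by blast
  have "supported N (AllS p)"
    unfolding supported_def
  proof (intro allI impI)
    fix \<sigma> \<tau> :: "nat \<Rightarrow> trm" and \<rho> \<pi> :: "nat \<Rightarrow> nat"
    assume "\<forall>i<N. \<sigma> i = \<tau> i \<and> \<rho> i = \<pi> i"
    then have "\<forall>i<N. \<sigma> i = \<tau> i \<and> lifts \<rho> i = lifts \<pi> i"
      by (auto split: nat.split)
    then have "subst \<sigma> (lifts \<rho>) p = subst \<tau> (lifts \<pi>) p"
      using N unfolding supported_def by blast
    then show "subst \<sigma> \<rho> (AllS p) = subst \<tau> \<pi> (AllS p)" by simp
  qed
  then show ?case by blast
qed (auto simp: supported_def)

lemma supported_list: "\<exists>N. \<forall>p\<in>set \<Gamma>. supported N p"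
proof (induction \<Gamma>)
  case (Cons p \<Gamma>)
  then obtain M N where "supported M p" "\<forall>p\<in>set \<Gamma>. supported N p"
    using supported_ex by blast
  then show ?case
    by (intro exI[of _ "max M N"]) (auto intro: supported_mono)
qed simp

section \<open>Derivations\<close>

lemma derives_weaken: "derives T \<Gamma> p \<Longrightarrow> set \<Gamma> \<subseteq> set \<Delta> \<Longrightarrow> derives T \<Delta> p"
proof (induction arbitrary: \<Delta> rule: derives.induct)
  case (Imp_I p \<Gamma> q)
  then have "derives T (p # \<Delta>) q" by (intro Imp_I.IH) auto
  then show ?case by (rule derives.Imp_I)
next
  case (Contradiction p \<Gamma>)
  then have "derives T (Neg p # \<Delta>) Bot" by (intro Contradiction.IH) auto
  then show ?case by (rule derives.Contradiction)
next
  case (AllN_I \<Gamma> p)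
  then have "derives T (map liftN \<Delta>) p" by (intro AllN_I.IH) auto
  then show ?case by (rule derives.AllN_I)
next
  case (AllS_I \<Gamma> p)
  then have "derives T (map liftS \<Delta>) p" by (intro AllS_I.IH) auto
  then show ?case by (rule derives.AllS_I)
next
  case (Eq_subst \<Gamma> s t p)
  then show ?case by (blast intro: derives.Eq_subst)
qed (auto intro: derives.intros)

lemma derives_cut: "derives T (p # \<Gamma>) q \<Longrightarrow> derives T \<Gamma> p \<Longrightarrow> derives T \<Gamma> q"
  by (blast intro: Imp_I Imp_E)

text \<open>Axioms may have free variables, and substituting in a derivation changes its axioms too;
  this closure is what the \<open>Axiom\<close> case of \<open>derives_subst\<close>
  requires.\<close>

definition subst_closed :: "fm set \<Rightarrow> bool" where
  "subst_closed T \<longleftrightarrow> (\<forall>p\<in>T. \<forall>\<sigma> \<rho>. subst \<sigma> \<rho> p \<in> T)"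

lemma derives_subst:
  assumes "subst_closed T"
  shows "derives T \<Gamma> p \<Longrightarrow> derives T (map (subst \<sigma> \<rho>) \<Gamma>) (subst \<sigma> \<rho> p)"
proof (induction arbitrary: \<sigma> \<rho> rule: derives.induct)
  case (Axiom p \<Gamma>)
  then show ?case using assms by (auto simp: subst_closed_def intro: derives.Axiom)
next
  case (Contradiction p \<Gamma>)
  then show ?case by (auto intro: derives.Contradiction)
next
  case (AllN_I \<Gamma> p)
  have "derives T (map liftN (map (subst \<sigma> \<rho>) \<Gamma>)) (subst (liftv \<sigma>) \<rho> p)"
    using AllN_I.IH[of "liftv \<sigma>" \<rho>] by (simp add: subst_liftN comp_def)
  then show ?case by (simp add: derives.AllN_I)
next
  case (AllS_I \<Gamma> p)
  have "derives T (map liftS (map (subst \<sigma> \<rho>) \<Gamma>)) (subst \<sigma> (lifts \<rho>) p)"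
    using AllS_I.IH[of \<sigma> "lifts \<rho>"] by (simp add: subst_liftS comp_def)
  then show ?case by (simp add: derives.AllS_I)
next
  case (AllN_E \<Gamma> p t)
  then show ?case by (simp add: subst_instN derives.AllN_E)
next
  case (AllS_E \<Gamma> p X)
  then show ?case by (simp add: subst_instS derives.AllS_E)
next
  case (Eq_subst \<Gamma> s t p)
  then show ?case unfolding subst_instN
    by (metis derives.Eq_subst subst.simps(2))
next
  case (Imp_E \<Gamma> p q)
  then show ?case by (metis derives.Imp_E subst.simps(5))
qed (auto intro: derives.intros)

text \<open>The rule \<open>AllN_I\<close> has no named eigenvariable. Renaming the fresh index
  \<open>i\<close> to 0 and shifting all others lifts the hypotheses and turns the instance back
  into \<open>p\<close>, which gives the premise of that rule.\<close>

lemma derives_generalizeN: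
  assumes "subst_closed T" "derives T \<Gamma> (instN (Var i) p)"
    and "\<forall>q\<in>set \<Gamma>. supported i q" "supported i p"
  shows "derives T \<Gamma> (AllN p)"
proof -
  define \<sigma> where "\<sigma> = (\<lambda>j. if j = i then Var 0 else Var (Suc j))"
  have "subst \<sigma> (\<lambda>i. i) q = liftN q" if "q \<in> set \<Gamma>" for q
    using that assms(3) unfolding liftN_def supported_def \<sigma>_def by auto
  then have 1: "map (subst \<sigma> (\<lambda>i. i)) \<Gamma> = map liftN \<Gamma>" by simp
  have "subst \<sigma> (\<lambda>i. i) (instN (Var i) p) = subst (\<lambda>j. tsubst \<sigma> (case_nat (Var i) Var j)) (\<lambda>i. i) p"
    by (simp add: instN_def subst_subst)
  also have "\<dots> = subst Var (\<lambda>i. i) p"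
    using assms(4) unfolding supported_def
    by (elim allE[of _ "\<lambda>i. i"] allE[of _ Var] allE[of _ "\<lambda>j. tsubst \<sigma> (case_nat (Var i) Var j)"] mp)
      (auto simp: \<sigma>_def split: nat.split)
  finally have "subst \<sigma> (\<lambda>i. i) (instN (Var i) p) = p" by (simp add: subst_ident)
  with 1 show ?thesis
    using derives_subst[OF assms(1,2), of \<sigma> "\<lambda>i. i"] by (metis AllN_I)
qed

lemma derives_generalizeS:
  assumes "subst_closed T" "derives T \<Gamma> (instS i p)"
    and "\<forall>q\<in>set \<Gamma>. supported i q" "supported i p"
  shows "derives T \<Gamma> (AllS p)"
proof -
  define \<rho> where "\<rho> = (\<lambda>j. if j = i then 0 else Suc j)"
  have "subst Var \<rho> q = liftS q" if "q \<in> set \<Gamma>" for q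
    using that assms(3) unfolding liftS_def supported_def \<rho>_def by auto
  then have 1: "map (subst Var \<rho>) \<Gamma> = map liftS \<Gamma>" by simp
  have "subst Var \<rho> (instS i p) = subst Var (\<lambda>j. \<rho> (case_nat i (\<lambda>i. i) j)) p"
    by (simp add: instS_def subst_subst)
  also have "\<dots> = subst Var (\<lambda>i. i) p"
    using assms(4) unfolding supported_def
    by (elim allE[of _ "\<lambda>i. i"] allE[of _ Var] allE[of _ "\<lambda>j. \<rho> (case_nat i (\<lambda>i. i) j)"] mp)
      (auto simp: \<rho>_def split: nat.split)
  finally have "subst Var \<rho> (instS i p) = p" by (simp add: subst_ident)
  with 1 show ?thesis
    using derives_subst[OF assms(1,2), of Var \<rho>] by (metis AllS_I)
qed

section \<open>Completeness\<close>

abbreviation consistent :: "fm set \<Rightarrow> fm list \<Rightarrow> bool" where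
  "consistent T \<Gamma> \<equiv> \<not> derives T \<Gamma> Bot"

lemma derives_NegI: "derives T (p # \<Gamma>) Bot \<Longrightarrow> derives T \<Gamma> (Neg p)"
  unfolding Neg_def by (rule Imp_I)

lemma derives_NegE: "derives T \<Gamma> (Neg p) \<Longrightarrow> derives T \<Gamma> p \<Longrightarrow> derives T \<Gamma> q"
proof -
  assume "derives T \<Gamma> (Neg p)" "derives T \<Gamma> p"
  then have "derives T \<Gamma> Bot" unfolding Neg_def by (rule Imp_E)
  then have "derives T (Neg q # \<Gamma>) Bot" by (rule derives_weaken) auto
  then show ?thesis by (rule Contradiction)
qed

text \<open>Free variables serve as Henkin constants, so the language is never extended: a finite
  list of hypotheses always leaves a fresh index, and refuting the instance at that index would
  derive the universal formula.\<close>

lemma consistent_witness: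
  assumes T: "subst_closed T" and con: "consistent T \<Gamma>" and q: "Neg q \<in> set \<Gamma>"
  obtains \<Delta> where "consistent T \<Delta>" "set \<Gamma> \<subseteq> set \<Delta>"
    "\<forall>p. q = AllN p \<longrightarrow> (\<exists>i. Neg (instN (Var i) p) \<in> set \<Delta>)"
    "\<forall>p. q = AllS p \<longrightarrow> (\<exists>i. Neg (instS i p) \<in> set \<Delta>)"
proof (cases "\<exists>p. q = AllN p \<or> q = AllS p")
  case True
  then obtain p where p: "q = AllN p \<or> q = AllS p" by blast
  obtain i where i: "\<forall>r\<in>set (p # \<Gamma>). supported i r" using supported_list by blast
  from p show ?thesis
  proof
    assume q': "q = AllN p"
    have "consistent T (Neg (instN (Var i) p) # \<Gamma>)"
    proof
      assume "derives T (Neg (instN (Var i) p) # \<Gamma>) Bot"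
      then have "derives T \<Gamma> (instN (Var i) p)" by (rule Contradiction)
      then have "derives T \<Gamma> (AllN p)" using derives_generalizeN[OF T] i by simp
      then show False using con q q' by (meson Hyp derives_NegE)
    qed
    then show ?thesis by (rule that) (use q' in auto)
  next
    assume q': "q = AllS p"
    have "consistent T (Neg (instS i p) # \<Gamma>)"
    proof
      assume "derives T (Neg (instS i p) # \<Gamma>) Bot"
      then have "derives T \<Gamma> (instS i p)" by (rule Contradiction)
      then have "derives T \<Gamma> (AllS p)" using derives_generalizeS[OF T] i by simp
      then show False using con q q' by (meson Hyp derives_NegE)
    qed
    then show ?thesis by (rule that) (use q' in auto)
  qed
qed (use that con in blast)

lemma consistent_decide:
  assumes T: "subst_closed T" and con: "consistent T \<Gamma>"
  shows "\<exists>\<Delta>. consistent T \<Delta> \<and> set \<Gamma> \<subseteq> set \<Delta> \<and> (q \<in> set \<Delta> \<or> Neg q \<in> set \<Delta> \<and>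
    (\<forall>p. q = AllN p \<longrightarrow> (\<exists>i. Neg (instN (Var i) p) \<in> set \<Delta>)) \<and>
    (\<forall>p. q = AllS p \<longrightarrow> (\<exists>i. Neg (instS i p) \<in> set \<Delta>)))"
proof (cases "consistent T (q # \<Gamma>)")
  case True
  then show ?thesis by (intro exI[of _ "q # \<Gamma>"]) auto
next
  case False
  then have "derives T \<Gamma> (Neg q)" by (simp add: derives_NegI)
  then have "consistent T (Neg q # \<Gamma>)" using con derives_cut by blast
  then obtain \<Delta> where "consistent T \<Delta>" "set (Neg q # \<Gamma>) \<subseteq> set \<Delta>"
    "\<forall>p. q = AllN p \<longrightarrow> (\<exists>i. Neg (instN (Var i) p) \<in> set \<Delta>)"
    "\<forall>p. q = AllS p \<longrightarrow> (\<exists>i. Neg (instS i p) \<in> set \<Delta>)"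
    using consistent_witness[OF T] by (metis list.set_intros(1))
  then show ?thesis by (intro exI[of _ \<Delta>]) auto
qed

locale henkin =
  fixes T H :: "fm set"
  assumes closed: "derives T \<Gamma> p \<Longrightarrow> set \<Gamma> \<subseteq> H \<Longrightarrow> p \<in> H"
    and Bot_notin: "Bot \<notin> H"
    and complete: "p \<in> H \<or> Neg p \<in> H"
    and witnessN: "AllN p \<notin> H \<Longrightarrow> \<exists>i. instN (Var i) p \<notin> H"
    and witnessS: "AllS p \<notin> H \<Longrightarrow> \<exists>i. instS i p \<notin> H"

lemma henkin_extension:
  assumes T: "subst_closed T" and con: "consistent T \<Gamma>"
  obtains H where "henkin T H" "set \<Gamma> \<subseteq> H"
proof -
  define P where "P q \<Delta> \<longleftrightarrow> (q \<in> set \<Delta> \<or> Neg q \<in> set \<Delta> \<and>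
    (\<forall>p. q = AllN p \<longrightarrow> (\<exists>i. Neg (instN (Var i) p) \<in> set \<Delta>)) \<and>
    (\<forall>p. q = AllS p \<longrightarrow> (\<exists>i. Neg (instS i p) \<in> set \<Delta>)))" for q \<Delta>
  \<comment> \<open>Stage \<open>Suc n\<close> decides the formula with code \<open>n\<close> and
    adds its witness. All stages are finite lists, so fresh variables never run out.\<close>
  have "\<exists>G. \<forall>n. (consistent T (G n) \<and> (n = 0 \<longrightarrow> G n = \<Gamma>)) \<and>
      (set (G n) \<subseteq> set (G (Suc n)) \<and> P (from_nat n) (G (Suc n)))"
  proof (rule dependent_nat_choice, goal_cases)
    case (2 \<Delta> n)
    then show ?case using consistent_decide[OF T, of \<Delta> "from_nat n"] unfolding P_def by auto
  qed (use con in auto)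
  then obtain G where G: "consistent T (G n)" "set (G n) \<subseteq> set (G (Suc n))"
    "P (from_nat n) (G (Suc n))" "G 0 = \<Gamma>" for n
    by blast
  define H where "H = (\<Union>n. set (G n))"
  have mono: "set (G m) \<subseteq> set (G n)" if "m \<le> n" for m n
    using that G(2) by (rule lift_Suc_mono_le[of "\<lambda>n. set (G n)", rotated])
  have fin: "\<exists>n. set \<Delta> \<subseteq> set (G n)" if "set \<Delta> \<subseteq> H" for \<Delta>
    using that
  proof (induction \<Delta>)
    case (Cons q \<Delta>)
    then obtain m n where "set \<Delta> \<subseteq> set (G n)" "q \<in> set (G m)" by (auto simp: H_def)
    then show ?case using mono[of m "max m n"] mono[of n "max m n"]
      by (intro exI[of _ "max m n"]) auto
  qed simp
  have dec: "P q (G (Suc (to_nat q)))" for q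
    using G(3)[of "to_nat q"] by simp
  have H: "p \<in> H" if "p \<in> set (G n)" for p n using that by (auto simp: H_def)
  have con: "\<not> derives T \<Delta> Bot" if "set \<Delta> \<subseteq> H" for \<Delta>
    using fin[OF that] G(1) derives_weaken by blast
  have neg: "Neg p \<in> H \<longleftrightarrow> p \<notin> H" for p
  proof
    show "p \<notin> H" if "Neg p \<in> H"
    proof
      assume "p \<in> H"
      then show False using con[of "[p, Neg p]"] that
        by (simp add: derives_NegE[of T _ p] Hyp)
    qed
  next
    show "Neg p \<in> H" if "p \<notin> H" using that dec[of p] H by (auto simp: P_def)
  qed
  have "henkin T H"
  proof
    fix \<Delta> p assume *: "derives T \<Delta> p" "set \<Delta> \<subseteq> H"
    show "p \<in> H"
    proof (rule ccontr)
      assume "p \<notin> H"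
      then have "set (Neg p # \<Delta>) \<subseteq> H" using * neg by simp
      moreover have "derives T (Neg p # \<Delta>) p" using *(1) by (rule derives_weaken) auto
      then have "derives T (Neg p # \<Delta>) Bot" by (rule derives_NegE[rotated]) (simp add: Hyp)
      ultimately show False using con by blast
    qed
  next
    show "Bot \<notin> H" using con[of "[Bot]"] Hyp[of Bot "[Bot]"] by auto
    show "p \<in> H \<or> Neg p \<in> H" for p using neg by blast
    show "\<exists>i. instN (Var i) p \<notin> H" if "AllN p \<notin> H" for p
      using that dec[of "AllN p"] H neg unfolding P_def by blast
    show "\<exists>i. instS i p \<notin> H" if "AllS p \<notin> H" for p
      using that dec[of "AllS p"] H neg unfolding P_def by blast
  qed
  moreover have "set \<Gamma> \<subseteq> H" using G(4) H by auto
  ultimately show ?thesis using that by blast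
qed

section \<open>Satisfaction and the term model\<close>

locale model =
  fixes zero one :: 'a and add mul :: "'a \<Rightarrow> 'a \<Rightarrow> 'a" and less :: "'a \<Rightarrow> 'a \<Rightarrow> bool"
    and Sets :: "'a set set"
begin

primrec tval :: "(nat \<Rightarrow> 'a) \<Rightarrow> trm \<Rightarrow> 'a" where
  "tval e (Var i) = e i"
| "tval e Zero = zero"
| "tval e One = one"
| "tval e (Add s t) = add (tval e s) (tval e t)"
| "tval e (Mul s t) = mul (tval e s) (tval e t)"

primrec sat :: "(nat \<Rightarrow> 'a) \<Rightarrow> (nat \<Rightarrow> 'a set) \<Rightarrow> fm \<Rightarrow> bool" where
  "sat e S Bot \<longleftrightarrow> False"
| "sat e S (Eq s t) \<longleftrightarrow> tval e s = tval e t"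
| "sat e S (Less s t) \<longleftrightarrow> less (tval e s) (tval e t)"
| "sat e S (Mem t X) \<longleftrightarrow> tval e t \<in> S X"
| "sat e S (Imp p q) \<longleftrightarrow> (sat e S p \<longrightarrow> sat e S q)"
| "sat e S (AllN p) \<longleftrightarrow> (\<forall>x. sat (case_nat x e) S p)"
| "sat e S (AllS p) \<longleftrightarrow> (\<forall>X\<in>Sets. sat e (case_nat X S) p)"

lemma sat_simps [simp]:
  "sat e S (Neg p) \<longleftrightarrow> \<not> sat e S p"
  "sat e S (And p q) \<longleftrightarrow> sat e S p \<and> sat e S q"
  "sat e S (Or p q) \<longleftrightarrow> sat e S p \<or> sat e S q"
  "sat e S (Iff p q) \<longleftrightarrow> (sat e S p \<longleftrightarrow> sat e S q)"
  "sat e S (ExN p) \<longleftrightarrow> (\<exists>x. sat (case_nat x e) S p)"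
  "sat e S (ExS p) \<longleftrightarrow> (\<exists>X\<in>Sets. sat e (case_nat X S) p)"
  by (auto simp: fm_defs)

lemma tval_tsubst: "tval e (tsubst \<sigma> t) = tval (\<lambda>i. tval e (\<sigma> i)) t"
  by (induction t) auto

lemma tval_tlift [simp]: "tval (case_nat x e) (tlift t) = tval e t"
  by (simp add: tlift_def tval_tsubst)

lemma sat_subst: "sat e S (subst \<sigma> \<rho> p) \<longleftrightarrow> sat (\<lambda>i. tval e (\<sigma> i)) (\<lambda>i. S (\<rho> i)) p"
proof (induction p arbitrary: \<sigma> \<rho> e S)
  case (AllN p)
  have "(\<lambda>i. tval (case_nat x e) (liftv \<sigma> i)) = case_nat x (\<lambda>i. tval e (\<sigma> i))" for x
    by (auto simp: fun_eq_iff split: nat.split)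
  then show ?case by (simp add: AllN)
next
  case (AllS p)
  have "(\<lambda>i. case_nat X S (lifts \<rho> i)) = case_nat X (\<lambda>i. S (\<rho> i))" for X
    by (auto simp: fun_eq_iff split: nat.split)
  then show ?case by (simp add: AllS)
qed (auto simp: tval_tsubst)

end

context henkin
begin

lemma closed2: "derives T [p, q] r \<Longrightarrow> p \<in> H \<Longrightarrow> q \<in> H \<Longrightarrow> r \<in> H"
  using closed[of "[p, q]" r] by simp

lemma closed1: "derives T [p] r \<Longrightarrow> p \<in> H \<Longrightarrow> r \<in> H"
  using closed[of "[p]" r] by simp

lemma Neg_iff: "Neg p \<in> H \<longleftrightarrow> p \<notin> H"
proof -
  have "derives T [p, Neg p] Bot" by (rule derives_NegE[of _ _ p]) (simp_all add: Hyp)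
  then show ?thesis using complete Bot_notin closed2 by blast
qed

lemma Imp_iff: "Imp p q \<in> H \<longleftrightarrow> (p \<in> H \<longrightarrow> q \<in> H)"
proof -
  have "derives T [Imp p q, p] q" by (rule Imp_E[of _ _ p]) (simp_all add: Hyp)
  moreover have "derives T [q] (Imp p q)" by (rule Imp_I) (simp add: Hyp)
  moreover have "derives T [Neg p] (Imp p q)"
    by (rule Imp_I, rule derives_NegE[of _ _ p]) (simp_all add: Hyp)
  ultimately show ?thesis using closed1 closed2 Neg_iff by blast
qed

lemma AllN_iff: "AllN p \<in> H \<longleftrightarrow> (\<forall>t. instN t p \<in> H)"
proof -
  have "derives T [AllN p] (instN t p)" for t by (rule AllN_E) (simp add: Hyp)
  then show ?thesis using witnessN[of p] closed1 by blast
qed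

lemma AllS_iff: "AllS p \<in> H \<longleftrightarrow> (\<forall>X. instS X p \<in> H)"
proof -
  have "derives T [AllS p] (instS X p)" for X by (rule AllS_E) (simp add: Hyp)
  then show ?thesis using witnessS[of p] closed1 by blast
qed

lemma Eq_refl: "Eq t t \<in> H"
  using closed[of "[]"] by (simp add: derives.Eq_refl)

lemma Eq_subst: "Eq s t \<in> H \<Longrightarrow> instN s p \<in> H \<Longrightarrow> instN t p \<in> H"
proof -
  have "derives T [Eq s t, instN s p] (instN t p)"
    by (rule derives.Eq_subst[of _ _ s]) (simp_all add: Hyp)
  then show "Eq s t \<in> H \<Longrightarrow> instN s p \<in> H \<Longrightarrow> instN t p \<in> H" by (rule closed2)
qed

lemma instN_simps [simp]:
  "instN u (Eq s t) = Eq (tsubst (case_nat u Var) s) (tsubst (case_nat u Var) t)"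
  "instN u (Less s t) = Less (tsubst (case_nat u Var) s) (tsubst (case_nat u Var) t)"
  "instN u (Mem t X) = Mem (tsubst (case_nat u Var) t) X"
  by (simp_all add: instN_def)

lemma tsubst_case_nat_tlift [simp]: "tsubst (case_nat u Var) (tlift t) = t"
  by (simp add: tsubst_tlift)

lemma Eq_sym: "Eq s t \<in> H \<Longrightarrow> Eq t s \<in> H"
  using Eq_subst[of s t "Eq (Var 0) (tlift s)"] Eq_refl by simp

lemma Eq_trans: "Eq s t \<in> H \<Longrightarrow> Eq t u \<in> H \<Longrightarrow> Eq s u \<in> H"
  using Eq_subst[of t u "Eq (tlift s) (Var 0)"] by simp

lemma Eq_Add: "Eq s s' \<in> H \<Longrightarrow> Eq t t' \<in> H \<Longrightarrow> Eq (Add s t) (Add s' t') \<in> H"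
  using Eq_subst[of s s' "Eq (tlift (Add s t)) (Add (Var 0) (tlift t))"]
    Eq_subst[of t t' "Eq (tlift (Add s t)) (Add (tlift s') (Var 0))"] Eq_refl by simp

lemma Eq_Mul: "Eq s s' \<in> H \<Longrightarrow> Eq t t' \<in> H \<Longrightarrow> Eq (Mul s t) (Mul s' t') \<in> H"
  using Eq_subst[of s s' "Eq (tlift (Mul s t)) (Mul (Var 0) (tlift t))"]
    Eq_subst[of t t' "Eq (tlift (Mul s t)) (Mul (tlift s') (Var 0))"] Eq_refl by simp

lemma Less_cong: "Eq s s' \<in> H \<Longrightarrow> Eq t t' \<in> H \<Longrightarrow> Less s t \<in> H \<Longrightarrow> Less s' t' \<in> H"
  using Eq_subst[of s s' "Less (Var 0) (tlift t)"]
    Eq_subst[of t t' "Less (tlift s') (Var 0)"] by simp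

lemma Mem_cong: "Eq s s' \<in> H \<Longrightarrow> Mem s X \<in> H \<Longrightarrow> Mem s' X \<in> H"
  using Eq_subst[of s s' "Mem (Var 0) X"] by simp

text \<open>The carrier is any labelling of terms up to provable equality, which leaves its type
  open. Set variables need no quotient, as equal extensions give equal \<open>Y\<close>. General
  \<open>\<sigma>\<close> and \<open>\<rho>\<close> are needed for the induction: a quantifier over
  the model becomes one over instances.\<close>

lemma truth:
  fixes val :: "trm \<Rightarrow> 'a"
  assumes surj: "surj val" and val: "\<And>s t. val s = val t \<longleftrightarrow> Eq s t \<in> H"
  obtains zero one add mul less and Y :: "nat \<Rightarrow> 'a set"
  where "\<And>\<sigma> \<rho> p. model.sat zero one add mul less (range Y) (\<lambda>i. val (\<sigma> i)) (\<lambda>i. Y (\<rho> i)) p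
    \<longleftrightarrow> subst \<sigma> \<rho> p \<in> H"
proof -
  define rep where "rep = inv val"
  have rep: "Eq (rep (val t)) t \<in> H" for t
    using val[of "rep (val t)" t] surj by (simp add: rep_def surj_f_inv_f)
  define add where "add a b = val (Add (rep a) (rep b))" for a b
  define mul where "mul a b = val (Mul (rep a) (rep b))" for a b
  define less where "less a b \<longleftrightarrow> Less (rep a) (rep b) \<in> H" for a b
  define Y where "Y X = {a. Mem (rep a) X \<in> H}" for X
  have add: "add (val s) (val t) = val (Add s t)" for s t
    unfolding add_def val by (intro Eq_Add rep)
  have mul: "mul (val s) (val t) = val (Mul s t)" for s t
    unfolding mul_def val by (intro Eq_Mul rep)
  have less: "less (val s) (val t) \<longleftrightarrow> Less s t \<in> H" for s t
    unfolding less_def using Less_cong rep Eq_sym by blast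
  have mem: "val t \<in> Y X \<longleftrightarrow> Mem t X \<in> H" for t X
    unfolding Y_def mem_Collect_eq using Mem_cong rep Eq_sym by blast
  interpret model "val Zero" "val One" add mul less "range Y" .
  have tv: "tval (\<lambda>i. val (\<sigma> i)) t = val (tsubst \<sigma> t)" for \<sigma> :: "nat \<Rightarrow> trm" and t
    by (induction t) (auto simp: add mul)
  have "sat (\<lambda>i. val (\<sigma> i)) (\<lambda>i. Y (\<rho> i)) p \<longleftrightarrow> subst \<sigma> \<rho> p \<in> H" for \<sigma> :: "nat \<Rightarrow> trm" and \<rho> p
  proof (induction p arbitrary: \<sigma> \<rho>)
    case (AllN p)
    have "case_nat (val t) (\<lambda>i. val (\<sigma> i)) = (\<lambda>i. val (case_nat t \<sigma> i))" for t
      by (auto simp: fun_eq_iff split: nat.split)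
    then have "sat (case_nat (val t) (\<lambda>i. val (\<sigma> i))) (\<lambda>i. Y (\<rho> i)) p
        \<longleftrightarrow> instN t (subst (liftv \<sigma>) \<rho> p) \<in> H" for t
      using AllN[of "case_nat t \<sigma>" \<rho>] by (simp add: instN_subst_liftv)
    then have "(\<forall>t. sat (case_nat (val t) (\<lambda>i. val (\<sigma> i))) (\<lambda>i. Y (\<rho> i)) p)
        \<longleftrightarrow> subst \<sigma> \<rho> (AllN p) \<in> H"
      by (simp add: AllN_iff)
    then show ?case using surj unfolding sat.simps by (metis surj_def)
  next
    case (AllS p)
    have "case_nat (Y X) (\<lambda>i. Y (\<rho> i)) = (\<lambda>i. Y (case_nat X \<rho> i))" for X
      by (auto simp: fun_eq_iff split: nat.split)
    then have "sat (\<lambda>i. val (\<sigma> i)) (case_nat (Y X) (\<lambda>i. Y (\<rho> i))) p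
        \<longleftrightarrow> instS X (subst \<sigma> (lifts \<rho>) p) \<in> H" for X
      using AllS[of \<sigma> "case_nat X \<rho>"] by (simp add: instS_subst_lifts)
    then show ?case by (simp add: AllS_iff)
  qed (auto simp: Imp_iff Bot_notin tv less mem val)
  then show ?thesis by (rule that)
qed

end

lemmas form_defs = bAllN_def bExN_def bAllS_def bExS_def bTrue_def bNeg_def bAnd_def bOr_def
  bImp_def bIff_def bEq_def bLess_def bMem_def bAdd_def bMul_def numterm_def bZero_def bOne_def

text \<open>The successor axioms make the term model infinite, so that it can be carried by \<^typ>\<open>nat\<close>.\<close>

theorem completeness:
  assumes T: "subst_closed T"
    and S0: "sentence (\<^bold>\<forall>x. \<^bold>\<not> x \<^bold>+ \<^bold>1 \<^bold>= \<^bold>0) \<in> T"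
    and S1: "sentence (\<^bold>\<forall>x. \<^bold>\<forall>y. x \<^bold>+ \<^bold>1 \<^bold>= y \<^bold>+ \<^bold>1 \<^bold>\<longrightarrow> x \<^bold>= y) \<in> T"
    and no: "\<not> T \<turnstile> \<phi>"
  obtains zero one :: nat and add mul less and Y :: "nat \<Rightarrow> nat set" and e S
  where "\<And>p e S. p \<in> T \<Longrightarrow> range S \<subseteq> range Y \<Longrightarrow> model.sat zero one add mul less (range Y) e S p"
    "range S \<subseteq> range Y" "\<not> model.sat zero one add mul less (range Y) e S \<phi>"
proof -
  have "consistent T [Neg \<phi>]" using no Contradiction unfolding proves_def by blast
  then obtain H where "henkin T H" and H: "Neg \<phi> \<in> H" using henkin_extension[OF T] by force
  interpret henkin T H by fact
  have TH: "p \<in> H" if "p \<in> T" for p using closed[of "[]" p] that by (auto intro: Axiom)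
  define cls where "cls t = {s. Eq s t \<in> H}" for t
  have cls: "cls s = cls t \<longleftrightarrow> Eq s t \<in> H" for s t
    unfolding cls_def using Eq_sym Eq_trans Eq_refl by blast
  have succ_inj: "Eq (Add s One) (Add t One) \<in> H \<Longrightarrow> Eq s t \<in> H" for s t
  proof -
    have "instN t (subst (liftv (case_nat s Var)) (\<lambda>i. i)
        (Imp (Eq (Add (Var 1) One) (Add (Var 0) One)) (Eq (Var 1) (Var 0)))) \<in> H"
      using TH[OF S1] unfolding sentence_def form_defs AllN_iff
      by (simp add: AllN_iff instN_def)
    then show "Eq (Add s One) (Add t One) \<in> H \<Longrightarrow> Eq s t \<in> H"
      by (simp add: instN_def Imp_iff)
  qed
  have succ_0: "Eq (Add t One) Zero \<notin> H" for t
    using TH[OF S0] unfolding sentence_def form_defs AllN_iff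
    by (simp add: instN_def Neg_iff)
  have "infinite (range cls)"
  proof
    assume fin: "finite (range cls)"
    \<comment> \<open>Successor on the classes is injective but misses the class of
      \<open>Zero\<close>, which is impossible on a finite set.\<close>
    define f where "f c = cls (Add (SOME t. cls t = c) One)" for c
    have f: "f (cls t) = cls (Add t One)" for t
    proof -
      have "cls (SOME s. cls s = cls t) = cls t" by (rule someI) simp
      then show ?thesis unfolding f_def cls by (intro Eq_Add Eq_refl)
    qed
    have "inj_on f (range cls)" by (auto simp: inj_on_def f cls intro: succ_inj)
    moreover have "f ` range cls \<subseteq> range cls" by (auto simp: f)
    ultimately have "f ` range cls = range cls" by (intro endo_inj_surj fin)
    then have "cls Zero \<in> f ` range cls" by simp
    then obtain t where "cls Zero = cls (Add t One)" by (auto simp: f)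
    then show False using succ_0 cls Eq_sym by blast
  qed
  then have bij: "bij_betw (to_nat_on (range cls)) (range cls) UNIV"
    by (intro to_nat_on_infinite) auto
  define val where "val t = to_nat_on (range cls) (cls t)" for t
  have val: "val s = val t \<longleftrightarrow> Eq s t \<in> H" for s t
    unfolding val_def cls[symmetric] using bij by (auto simp: bij_betw_def inj_on_def)
  have surj: "surj val"
    using bij unfolding val_def bij_betw_def image_image by simp
  obtain zero one add mul less and Y :: "nat \<Rightarrow> nat set" where
    sat: "\<And>\<sigma> \<rho> p. model.sat zero one add mul less (range Y) (\<lambda>i. val (\<sigma> i)) (\<lambda>i. Y (\<rho> i)) p
      \<longleftrightarrow> subst \<sigma> \<rho> p \<in> H"
    by (rule truth[OF surj val]) blast+
  show ?thesis
  proof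
    fix p and e :: "nat \<Rightarrow> nat" and S :: "nat \<Rightarrow> nat set"
    assume p: "p \<in> T" and S: "range S \<subseteq> range Y"
    \<comment> \<open>Every assignment comes from a substitution, so truth of \<open>p\<close> under
      it is membership in \<open>H\<close> of a substitution instance of \<open>p\<close>, again an
      axiom by \<open>subst_closed\<close>.\<close>
    have "\<forall>i. \<exists>X. S i = Y X" using S by blast
    then obtain \<rho> where \<rho>: "\<And>i. S i = Y (\<rho> i)" by metis
    have "\<forall>i. \<exists>t. e i = val t" using surj by (metis surj_def)
    then obtain \<sigma> where \<sigma>: "\<And>i. e i = val (\<sigma> i)" by metis
    have "subst \<sigma> \<rho> p \<in> H" using T p TH by (auto simp: subst_closed_def)
    then show "model.sat zero one add mul less (range Y) e S p"
      using sat[of \<sigma> \<rho> p] by (simp flip: \<sigma> \<rho>)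
  next
    show "range (\<lambda>i. Y i) \<subseteq> range Y" by simp
    show "\<not> model.sat zero one add mul less (range Y) (\<lambda>i. val (Var i)) (\<lambda>i. Y i) \<phi>"
      using sat[of Var "\<lambda>i. i" \<phi>] H by (simp add: subst_ident Neg_iff)
  qed
qed

section \<open>Models of $\mathsf{RCA}_0$\<close>

lemma bounded_fm_subst: "bounded_fm p \<Longrightarrow> bounded_fm (subst \<sigma> \<rho> p)"
  by (induction arbitrary: \<sigma> \<rho> rule: bounded_fm.induct)
    (auto simp: tsubst_liftv_tlift intro: bounded_fm.intros)

text \<open>The basic axioms are closed, and both schemes admit arbitrary parameters. The induction
  or comprehension variable is bound, so a substitution reaches the scheme formula only through
  \<open>liftv\<close>, which fixes index 0.\<close>

lemma subst_closed_RCA0: "subst_closed RCA0"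
  unfolding subst_closed_def
proof (intro ballI allI)
  fix p \<sigma> \<rho>
  assume "p \<in> RCA0"
  then consider "p \<in> sentence ` basic_axioms"
    | q where "p = induction_axiom q" "Sigma01 q"
    | q r where "p = comprehension_axiom q r" "Sigma01 q" "Pi01 r"
    unfolding RCA0_def by blast
  then show "subst \<sigma> \<rho> p \<in> RCA0"
  proof cases
    case 1
    then have "subst \<sigma> \<rho> p = p"
      by (auto simp: basic_axioms_def sentence_def form_defs)
    with 1 show ?thesis by (auto simp: RCA0_def)
  next
    case 2
    have "Sigma01 (subst (liftv \<sigma>) \<rho> q)"
      using 2(2) by (auto simp: Sigma01_def intro: bounded_fm_subst)
    moreover have "subst \<sigma> \<rho> p = induction_axiom (subst (liftv \<sigma>) \<rho> q)"
    proof -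
      have "(\<lambda>i. tsubst (liftv \<sigma>) (case_nat (Add (Var 0) One) (\<lambda>i. Var (Suc i)) i))
          = (\<lambda>i. tsubst (case_nat (Add (Var 0) One) (\<lambda>i. Var (Suc i))) (liftv \<sigma> i))"
        by (auto simp: fun_eq_iff tsubst_tlift simp flip: tlift_def split: nat.split)
      then show ?thesis
        by (simp add: 2(1) induction_axiom_def subst_instN subst_subst)
    qed
    ultimately show ?thesis by (auto simp: RCA0_def)
  next
    case 3
    have "Sigma01 (subst (liftv \<sigma>) \<rho> q)" "Pi01 (subst (liftv \<sigma>) \<rho> r)"
      using 3(2,3) by (auto simp: Sigma01_def Pi01_def intro: bounded_fm_subst)
    moreover have "subst \<sigma> \<rho> p = comprehension_axiom (subst (liftv \<sigma>) \<rho> q) (subst (liftv \<sigma>) \<rho> r)"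
      by (simp add: 3(1) comprehension_axiom_def subst_liftS)
    ultimately show ?thesis by (auto simp: RCA0_def)
  qed
qed

text \<open>The enumerations \<open>en\<close> and \<open>Y\<close> allow one environment to mention
  every element and every set, so that the axiom schemes apply to HOL predicates with arbitrary
  parameters.\<close>

locale rca = model zero one add mul less Sets
  for zero :: 'a ("\<zero>") and one ("\<one>") and add (infixl "\<oplus>" 65) and mul (infixl "\<otimes>" 70)
    and less (infix "\<prec>" 50) and Sets +
  fixes en :: "nat \<Rightarrow> 'a" and Y :: "nat \<Rightarrow> 'a set"
  assumes surj_en: "surj en" and Sets_eq: "Sets = range Y"
    and RCA0: "p \<in> RCA0 \<Longrightarrow> range S \<subseteq> Sets \<Longrightarrow> sat e S p"
begin

subsection \<open>Bounded definability with parameters\<close>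

inductive Tm :: "((nat \<Rightarrow> 'a) \<Rightarrow> 'a) \<Rightarrow> bool" where
  Tm_var: "Tm (\<lambda>e. e i)"
| Tm_const: "Tm (\<lambda>e. c)"
| Tm_add: "Tm f \<Longrightarrow> Tm g \<Longrightarrow> Tm (\<lambda>e. f e \<oplus> g e)"
| Tm_mul: "Tm f \<Longrightarrow> Tm g \<Longrightarrow> Tm (\<lambda>e. f e \<otimes> g e)"

text \<open>The semantic counterpart of \<open>bounded_fm\<close>, with elements and sets of the
  model as constants. Its rules apply directly to HOL statements, so that no concrete formula has to
  be written down.\<close>

inductive D0 :: "((nat \<Rightarrow> 'a) \<Rightarrow> bool) \<Rightarrow> bool" where
  D0_False: "D0 (\<lambda>e. False)"
| D0_eq: "Tm f \<Longrightarrow> Tm g \<Longrightarrow> D0 (\<lambda>e. f e = g e)"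
| D0_less: "Tm f \<Longrightarrow> Tm g \<Longrightarrow> D0 (\<lambda>e. f e \<prec> g e)"
| D0_mem: "Tm f \<Longrightarrow> X \<in> Sets \<Longrightarrow> D0 (\<lambda>e. f e \<in> X)"
| D0_imp: "D0 P \<Longrightarrow> D0 Q \<Longrightarrow> D0 (\<lambda>e. P e \<longrightarrow> Q e)"
| D0_all': "Tm t \<Longrightarrow> D0 P \<Longrightarrow> D0 (\<lambda>e. \<forall>x. x \<prec> t e \<longrightarrow> P (case_nat x e))"

text \<open>A version of \<open>D0_all'\<close> whose conclusion matches a bounded quantifier as it
  is written in HOL, without \<open>case_nat\<close>.\<close>

lemma D0_all:
  assumes "Tm t" "D0 (\<lambda>e. P (e 0) (\<lambda>i. e (Suc i)))"
  shows "D0 (\<lambda>e. \<forall>x. x \<prec> t e \<longrightarrow> P x e)"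
  using D0_all'[OF assms] by simp

lemma D0_not: "D0 P \<Longrightarrow> D0 (\<lambda>e. \<not> P e)"
  using D0_imp[OF _ D0_False] by simp

lemma D0_True: "D0 (\<lambda>e. True)"
  using D0_not[OF D0_False] by simp

lemma D0_const: "D0 (\<lambda>e. b)"
  using D0_True D0_False by (cases b) auto

lemma D0_disj: "D0 P \<Longrightarrow> D0 Q \<Longrightarrow> D0 (\<lambda>e. P e \<or> Q e)"
  using D0_imp[OF D0_not, of P Q] by (simp add: imp_conv_disj)

lemma D0_conj: "D0 P \<Longrightarrow> D0 Q \<Longrightarrow> D0 (\<lambda>e. P e \<and> Q e)"
  using D0_not[OF D0_disj[OF D0_not D0_not], of P Q] by simp

lemma D0_iff: "D0 P \<Longrightarrow> D0 Q \<Longrightarrow> D0 (\<lambda>e. P e \<longleftrightarrow> Q e)"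
  using D0_conj[OF D0_imp D0_imp, of P Q Q P] by (simp add: iff_conv_conj_imp)

lemma D0_ex:
  assumes "Tm t" "D0 (\<lambda>e. P (e 0) (\<lambda>i. e (Suc i)))"
  shows "D0 (\<lambda>e. \<exists>x. x \<prec> t e \<and> P x e)"
  using D0_not[OF D0_all[OF assms(1) D0_not[OF assms(2)]]] by simp

text \<open>For finiteness in the sense of HOL. The predicates \<open>P j\<close> may depend on
  \<open>j\<close> in a way that the model cannot express.\<close>

lemma D0_finite_disj: "finite J \<Longrightarrow> (\<And>j. D0 (P j)) \<Longrightarrow> D0 (\<lambda>e. \<exists>j\<in>J. P j e)"
  by (induction rule: finite_induct) (auto intro: D0_False D0_disj)

lemma Tm_subst: "Tm f \<Longrightarrow> (\<And>i. Tm (\<sigma> i)) \<Longrightarrow> Tm (\<lambda>e. f (\<lambda>i. \<sigma> i e))"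
  by (induction rule: Tm.induct) (auto intro: Tm.intros)

lemma D0_subst: "D0 P \<Longrightarrow> (\<And>i. Tm (\<sigma> i)) \<Longrightarrow> D0 (\<lambda>e. P (\<lambda>i. \<sigma> i e))"
proof (induction arbitrary: \<sigma> rule: D0.induct)
  case (D0_all' t P)
  let ?\<tau> = "case_nat (\<lambda>e. e 0) (\<lambda>i e. \<sigma> i (\<lambda>j. e (Suc j)))"
  have shift: "Tm (\<lambda>e. f (\<lambda>j. e (Suc j)))" if "Tm f" for f
    by (rule Tm_subst[OF that]) (rule Tm_var)
  have "Tm (?\<tau> i)" for i
    by (cases i) (auto intro: Tm_var shift D0_all'.prems)
  then have "D0 (\<lambda>e. P (\<lambda>i. ?\<tau> i e))" by (rule D0_all'.IH)
  with Tm_subst[OF D0_all'.hyps(1) D0_all'.prems]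
  have "D0 (\<lambda>e. \<forall>x. x \<prec> t (\<lambda>i. \<sigma> i e) \<longrightarrow> P (\<lambda>i. ?\<tau> i (case_nat x e)))"
    by (rule D0.D0_all')
  moreover have "case_nat x (\<lambda>i. \<sigma> i e) = (\<lambda>i. ?\<tau> i (case_nat x e))" for x e
    by (auto simp: fun_eq_iff split: nat.split)
  ultimately show ?case by (simp only:)
next
  case (D0_eq f g)
  from D0.D0_eq[OF Tm_subst[OF D0_eq.hyps(1) D0_eq.prems] Tm_subst[OF D0_eq.hyps(2) D0_eq.prems]]
  show ?case .
next
  case (D0_less f g)
  from D0.D0_less[OF Tm_subst[OF D0_less.hyps(1) D0_less.prems] Tm_subst[OF D0_less.hyps(2) D0_less.prems]]
  show ?case .
next
  case (D0_mem f X)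
  from D0.D0_mem[OF Tm_subst[OF D0_mem.hyps(1) D0_mem.prems] D0_mem.hyps(2)]
  show ?case .
qed (simp_all add: D0_False D0_imp)

lemma D0_subst1: "D0 (\<lambda>e. Q (e 0)) \<Longrightarrow> Tm f \<Longrightarrow> D0 (\<lambda>e. Q (f e))"
  using D0_subst[of "\<lambda>e. Q (e 0)" "\<lambda>i. f"] by simp

lemma D0_subst2:
  assumes "D0 (\<lambda>e. Q (e 0) (e (Suc 0)))" "Tm f" "Tm g"
  shows "D0 (\<lambda>e. Q (f e) (g e))"
proof -
  have "Tm (case_nat f (\<lambda>_. g) i)" for i by (cases i) (use assms in auto)
  from D0_subst[of _ "case_nat f (\<lambda>_. g)", OF assms(1) this] show ?thesis by simp
qed

text \<open>In an environment \<open>env n e\<close> the variables from \<open>n\<close> on run through the whole model, so that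
  every parameter is named by a variable.\<close>

definition env :: "nat \<Rightarrow> (nat \<Rightarrow> 'a) \<Rightarrow> nat \<Rightarrow> 'a" where
  "env n e i = (if i < n then e i else en (i - n))"

lemma env_Suc: "env (Suc n) (case_nat x e) = case_nat x (env n e)"
  by (auto simp: fun_eq_iff env_def split: nat.split)

lemma Tm_formula: "Tm f \<Longrightarrow> \<exists>N. \<forall>n\<ge>N. \<exists>t. \<forall>e. tval (env n e) t = f e"
proof (induction rule: Tm.induct)
  case (Tm_var i)
  show ?case by (intro exI[of _ "Suc i"] allI impI exI[of _ "Var i"]) (simp add: env_def)
next
  case (Tm_const c)
  obtain j where "c = en j" using surj_en by (metis surj_def)
  then show ?case
    by (intro exI[of _ 0] allI impI) (rule_tac x = "Var (n + j)" in exI, simp add: env_def)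
next
  case (Tm_add f g)
  then obtain M N where "\<forall>n\<ge>M. \<exists>t. \<forall>e. tval (env n e) t = f e" "\<forall>n\<ge>N. \<exists>t. \<forall>e. tval (env n e) t = g e"
    by blast
  then show ?case by (intro exI[of _ "max M N"]) (metis tval.simps(4) max.bounded_iff)
next
  case (Tm_mul f g)
  then obtain M N where "\<forall>n\<ge>M. \<exists>t. \<forall>e. tval (env n e) t = f e" "\<forall>n\<ge>N. \<exists>t. \<forall>e. tval (env n e) t = g e"
    by blast
  then show ?case by (intro exI[of _ "max M N"]) (metis tval.simps(5) max.bounded_iff)
qed

lemma Tm_formula2:
  assumes "Tm f" "Tm g"
  obtains N where "\<And>n. n \<ge> N \<Longrightarrow> \<exists>s t. \<forall>e. tval (env n e) s = f e \<and> tval (env n e) t = g e"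
proof -
  obtain M N where M: "\<forall>n\<ge>M. \<exists>t. \<forall>e. tval (env n e) t = f e"
    and N: "\<forall>n\<ge>N. \<exists>t. \<forall>e. tval (env n e) t = g e"
    using Tm_formula[OF assms(1)] Tm_formula[OF assms(2)] by blast
  show ?thesis
  proof (rule that[of "max M N"])
    fix n assume "max M N \<le> n"
    then have "M \<le> n" "N \<le> n" by auto
    then show "\<exists>s t. \<forall>e. tval (env n e) s = f e \<and> tval (env n e) t = g e"
      using M N by blast
  qed
qed

text \<open>All large \<open>n\<close> are allowed because the two sides of an implication need a
  common \<open>n\<close>, and the body of a quantifier is used at \<open>Suc n\<close>.\<close>

lemma D0_formula: "D0 P \<Longrightarrow> \<exists>N. \<forall>n\<ge>N. \<exists>p. bounded_fm p \<and> (\<forall>e. sat (env n e) Y p \<longleftrightarrow> P e)"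
proof (induction rule: D0.induct)
  case D0_False
  show ?case by (intro exI[of _ 0] allI impI exI[of _ Bot]) (simp add: bounded_fm.intros)
next
  case (D0_eq f g)
  then obtain N where N: "\<And>n. n \<ge> N \<Longrightarrow> \<exists>s t. \<forall>e. tval (env n e) s = f e \<and> tval (env n e) t = g e"
    using Tm_formula2 by blast
  show ?case
    by (intro exI[of _ N]) (metis N bounded_fm.intros(2) sat.simps(2))
next
  case (D0_less f g)
  then obtain N where N: "\<And>n. n \<ge> N \<Longrightarrow> \<exists>s t. \<forall>e. tval (env n e) s = f e \<and> tval (env n e) t = g e"
    using Tm_formula2 by blast
  show ?case
    by (intro exI[of _ N]) (metis N bounded_fm.intros(3) sat.simps(3))
next
  case (D0_mem f X)
  then obtain j where "X = Y j" using Sets_eq by auto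
  obtain N where "\<forall>n\<ge>N. \<exists>t. \<forall>e. tval (env n e) t = f e" using Tm_formula D0_mem by blast
  with \<open>X = Y j\<close> show ?case
    by (intro exI[of _ N]) (metis bounded_fm.intros(4) sat.simps(4))
next
  case (D0_imp P Q)
  then obtain M N where "\<forall>n\<ge>M. \<exists>p. bounded_fm p \<and> (\<forall>e. sat (env n e) Y p \<longleftrightarrow> P e)"
     "\<forall>n\<ge>N. \<exists>p. bounded_fm p \<and> (\<forall>e. sat (env n e) Y p \<longleftrightarrow> Q e)" by blast
  then show ?case
    by (intro exI[of _ "max M N"]) (metis bounded_fm.intros(5) sat.simps(5) max.bounded_iff)
next
  case (D0_all' t P)
  then obtain M N where M: "\<forall>n\<ge>M. \<exists>p. bounded_fm p \<and> (\<forall>e. sat (env n e) Y p \<longleftrightarrow> P e)"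
     and N: "\<forall>n\<ge>N. \<exists>u. \<forall>e. tval (env n e) u = t e" using Tm_formula by blast
  show ?case
  proof (intro exI[of _ "max M N"] allI impI)
    fix n assume n: "n \<ge> max M N"
    then have "Suc n \<ge> M" "n \<ge> N" by auto
    then obtain p u where pu: "bounded_fm p" "\<forall>e. sat (env (Suc n) e) Y p \<longleftrightarrow> P e"
       "\<forall>e. tval (env n e) u = t e"
      using M N by blast
    from pu(2) have "sat (case_nat x (env n e)) Y p \<longleftrightarrow> P (case_nat x e)" for x e
      by (simp flip: env_Suc)
    with pu show "\<exists>p. bounded_fm p \<and> (\<forall>e. sat (env n e) Y p \<longleftrightarrow> (\<forall>x. x \<prec> t e \<longrightarrow> P (case_nat x e)))"
      by (intro exI[of _ "AllN (Imp (Less (Var 0) (tlift u)) p)"])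
        (auto intro: bounded_fm.intros)
  qed
qed

lemma D0_formula2:
  assumes "D0 (\<lambda>e. P (e 0) (e (Suc 0)))"
  obtains N where "\<And>n. n \<ge> N \<Longrightarrow> \<exists>p. bounded_fm p \<and>
    (\<forall>x y e. sat (case_nat y (case_nat x (env n e))) Y p \<longleftrightarrow> P x y)"
proof -
  \<comment> \<open>The arguments are swapped since the unbounded quantifier over \<open>y\<close>,
    being innermost, binds index 0.\<close>
  have "D0 (\<lambda>e. P (e (Suc 0)) (e 0))" by (rule D0_subst2[OF assms]) (rule Tm_var)+
  from D0_formula[OF this] obtain N where N:
     "\<forall>n\<ge>N. \<exists>p. bounded_fm p \<and> (\<forall>e. sat (env n e) Y p \<longleftrightarrow> P (e (Suc 0)) (e 0))" by blast
  show ?thesis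
  proof (rule that[of N])
    fix n assume "N \<le> n"
    then have "N \<le> Suc (Suc n)" by simp
    then obtain p where "bounded_fm p" and p: "\<forall>e. sat (env (Suc (Suc n)) e) Y p \<longleftrightarrow> P (e (Suc 0)) (e 0)"
      using N by blast
    then show "\<exists>p. bounded_fm p \<and> (\<forall>x y e. sat (case_nat y (case_nat x (env n e))) Y p \<longleftrightarrow> P x y)"
      by (intro exI[of _ p]) (simp flip: env_Suc)
  qed
qed

section \<open>Induction and comprehension for semantic predicates\<close>

lemma S1_induct:
  assumes D: "D0 (\<lambda>e. P (e 0) (e (Suc 0)))" and 0: "\<exists>y. P \<zero> y"
    and step: "\<And>x y. P x y \<Longrightarrow> \<exists>y. P (x \<oplus> \<one>) y"
  shows "\<exists>y. P x y"
proof -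
  obtain n p where "bounded_fm p"
    and p: "\<And>x y e. sat (case_nat y (case_nat x (env n e))) Y p \<longleftrightarrow> P x y"
    using D0_formula2[OF D] by (metis order_refl)
  then have "induction_axiom (ExN p) \<in> RCA0" by (auto simp: RCA0_def Sigma01_def)
  then have sat: "sat (env n en) Y (induction_axiom (ExN p))" using RCA0 Sets_eq by simp
  have 1: "(\<lambda>i. tval e (case_nat Zero Var i)) = case_nat \<zero> e" for e
    by (auto simp: fun_eq_iff split: nat.split)
  have 2: "(\<lambda>i. tval (case_nat x e) (case_nat (Add (Var 0) One) (\<lambda>i. Var (Suc i)) i))
      = case_nat (x \<oplus> \<one>) e" for e x
    by (auto simp: fun_eq_iff split: nat.split)
  have "(\<exists>y. P \<zero> y) \<Longrightarrow> (\<forall>x. (\<exists>y. P x y) \<longrightarrow> (\<exists>y. P (x \<oplus> \<one>) y)) \<Longrightarrow> (\<forall>x. \<exists>y. P x y)"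
    using sat by (simp add: induction_axiom_def instN_def sat_subst 1 2 p del: subst_simps)
  then show ?thesis using 0 step by blast
qed

lemma D0_induct [case_names D0 zero suc]:
  assumes "D0 (\<lambda>e. P (e 0))" "P \<zero>" "\<And>x. P x \<Longrightarrow> P (x \<oplus> \<one>)"
  shows "P x"
  using S1_induct[of "\<lambda>x y. P x" x] assms by simp

lemma D1_comprehension:
  assumes P: "D0 (\<lambda>e. P (e 0) (e (Suc 0)))" and Q: "D0 (\<lambda>e. Q (e 0) (e (Suc 0)))"
    and eq: "\<And>x. (\<exists>y. P x y) \<longleftrightarrow> (\<forall>y. Q x y)"
  shows "{x. \<exists>y. P x y} \<in> Sets"
proof -
  obtain M where M: "\<And>n. n \<ge> M \<Longrightarrow> \<exists>p. bounded_fm p \<and>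
      (\<forall>x y e. sat (case_nat y (case_nat x (env n e))) Y p \<longleftrightarrow> P x y)"
    by (rule D0_formula2[OF P]) blast
  obtain N where N: "\<And>n. n \<ge> N \<Longrightarrow> \<exists>p. bounded_fm p \<and>
      (\<forall>x y e. sat (case_nat y (case_nat x (env n e))) Y p \<longleftrightarrow> Q x y)"
    by (rule D0_formula2[OF Q]) blast
  define n where "n = max M N"
  have "M \<le> n" "N \<le> n" by (auto simp: n_def)
  with M N obtain p q where b: "bounded_fm p" "bounded_fm q"
    and p: "\<And>x y e. sat (case_nat y (case_nat x (env n e))) Y p \<longleftrightarrow> P x y"
    and q: "\<And>x y e. sat (case_nat y (case_nat x (env n e))) Y q \<longleftrightarrow> Q x y"
    by metis
  from b have "Sigma01 (ExN p)" "Pi01 (AllN q)" by (auto simp: Sigma01_def Pi01_def)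
  then have "comprehension_axiom (ExN p) (AllN q) \<in> RCA0" by (auto simp: RCA0_def)
  then have sat: "sat (env n en) Y (comprehension_axiom (ExN p) (AllN q))" using RCA0 Sets_eq by simp
  have "\<exists>X\<in>Sets. \<forall>x. x \<in> X \<longleftrightarrow> (\<exists>y. P x y)"
    using sat by (simp add: comprehension_axiom_def liftS_def sat_subst p q eq del: subst_simps)
  then obtain X where X: "X \<in> Sets" "\<And>x. x \<in> X \<longleftrightarrow> (\<exists>y. P x y)" by blast
  have "{x. \<exists>y. P x y} = X" using X(2) by blast
  then show ?thesis using X(1) by (simp only:)
qed

lemma D0_comprehension: "D0 (\<lambda>e. P (e 0)) \<Longrightarrow> {x. P x} \<in> Sets"
  using D1_comprehension[of "\<lambda>x y. P x" "\<lambda>x y. P x"] by simp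

lemmas D0_intros = D0_const D0_all D0_ex D0_imp D0_conj D0_disj D0_not D0_iff D0_eq D0_less D0_mem Tm.intros

subsection \<open>Arithmetic\<close>

lemma basic: "\<forall>p\<in>basic_axioms. sat e Y (sentence p)"
proof
  fix p assume "p \<in> basic_axioms"
  then have "sentence p \<in> RCA0" by (simp add: RCA0_def)
  then show "sat e Y (sentence p)" by (rule RCA0) (simp add: Sets_eq)
qed

lemma suc_neq_zero [simp]: "x \<oplus> \<one> \<noteq> \<zero>"
  and suc_inject [simp]: "x \<oplus> \<one> = y \<oplus> \<one> \<longleftrightarrow> x = y"
  and add_zero [simp]: "x \<oplus> \<zero> = x"
  and add_suc: "x \<oplus> (y \<oplus> \<one>) = (x \<oplus> y) \<oplus> \<one>"
  and mul_zero [simp]: "x \<otimes> \<zero> = \<zero>"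
  and mul_suc: "x \<otimes> (y \<oplus> \<one>) = x \<otimes> y \<oplus> x"
  and not_less_zero [simp]: "\<not> x \<prec> \<zero>"
  and less_suc: "x \<prec> y \<oplus> \<one> \<longleftrightarrow> x \<prec> y \<or> x = y"
proof -
  note [simp] = basic[of en, unfolded basic_axioms_def sentence_def form_defs, simplified]
  show "x \<oplus> \<one> \<noteq> \<zero>" "x \<oplus> \<one> = y \<oplus> \<one> \<longleftrightarrow> x = y" "x \<oplus> \<zero> = x"
    "x \<oplus> (y \<oplus> \<one>) = (x \<oplus> y) \<oplus> \<one>" "x \<otimes> \<zero> = \<zero>" "x \<otimes> (y \<oplus> \<one>) = x \<otimes> y \<oplus> x"
    "\<not> x \<prec> \<zero>" "x \<prec> y \<oplus> \<one> \<longleftrightarrow> x \<prec> y \<or> x = y"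
    by auto
qed

lemma add_assoc: "x \<oplus> y \<oplus> z = x \<oplus> (y \<oplus> z)"
  by (induction z rule: D0_induct) (intro D0_intros, auto simp: add_suc)

lemma zero_add [simp]: "\<zero> \<oplus> x = x"
  by (induction x rule: D0_induct) (intro D0_intros, auto simp flip: add_assoc)

lemma suc_add: "x \<oplus> \<one> \<oplus> y = x \<oplus> y \<oplus> \<one>"
  by (induction y rule: D0_induct) (intro D0_intros, auto simp flip: add_assoc)

lemma add_commute: "x \<oplus> y = y \<oplus> x"
  by (induction y rule: D0_induct) (intro D0_intros, auto simp: suc_add add_suc)

lemma add_mul_distrib: "(x \<oplus> y) \<otimes> z = x \<otimes> z \<oplus> y \<otimes> z"
proof (induction z rule: D0_induct)
  case (suc z)
  then show ?case by (metis add_assoc add_commute mul_suc)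
qed (intro D0_intros, simp)

lemma zero_mul [simp]: "\<zero> \<otimes> x = \<zero>"
  by (induction x rule: D0_induct) (intro D0_intros, auto simp: mul_suc)

lemma one_mul [simp]: "\<one> \<otimes> x = x"
  by (induction x rule: D0_induct) (intro D0_intros, auto simp: mul_suc)

lemma mul_commute: "x \<otimes> y = y \<otimes> x"
  by (induction y rule: D0_induct) (intro D0_intros, auto simp: mul_suc add_mul_distrib)

lemma mul_assoc: "x \<otimes> y \<otimes> z = x \<otimes> (y \<otimes> z)"
proof (induction z rule: D0_induct)
  case (suc z)
  then show ?case by (metis mul_suc mul_commute add_mul_distrib)
qed (intro D0_intros, simp)

lemma zero_neq_one: "\<zero> \<noteq> \<one>"
  using suc_neq_zero[of \<zero>] by simp

sublocale semiring: comm_semiring_1 where one = one and times = mul and plus = add and zero = zero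
  by unfold_locales
    (simp_all add: add_assoc mul_assoc add_mul_distrib zero_neq_one, simp_all add: add_commute mul_commute)

lemmas ring_simps = semiring.distrib_left semiring.distrib_right semiring.add_ac semiring.mult_ac

lemma add_cancel_right [simp]: "x \<oplus> z = y \<oplus> z \<longleftrightarrow> x = y"
  by (induction z rule: D0_induct) (intro D0_intros, auto simp: add_suc)

lemma add_cancel_left [simp]: "z \<oplus> x = z \<oplus> y \<longleftrightarrow> x = y"
  by (metis add_cancel_right add_commute)

text \<open>The bound \<open>y \<prec> x\<close> makes the statement bounded, so that
  \<open>D0_induct\<close> applies to it.\<close>

lemma zero_or_suc: "x = \<zero> \<or> (\<exists>y. y \<prec> x \<and> x = y \<oplus> \<one>)"
  by (induction x rule: D0_induct) (intro D0_intros, auto simp: less_suc)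

lemma add_eq_zero [simp]: "x \<oplus> y = \<zero> \<longleftrightarrow> x = \<zero> \<and> y = \<zero>"
  by (metis add_suc add_zero suc_neq_zero zero_or_suc)

lemma zero_eq_add [simp]: "\<zero> = x \<oplus> y \<longleftrightarrow> x = \<zero> \<and> y = \<zero>"
  using add_eq_zero by metis

lemma one_neq_zero [simp]: "\<one> \<noteq> \<zero>"
  using zero_neq_one by simp

lemma add_eq_self [simp]: "x \<oplus> y = x \<longleftrightarrow> y = \<zero>" "x = x \<oplus> y \<longleftrightarrow> y = \<zero>"
  using add_cancel_left[of x y \<zero>] add_cancel_left[of x \<zero> y] by auto

definition le (infix "\<preceq>" 50) where "x \<preceq> y \<longleftrightarrow> x \<prec> y \<or> x = y"

lemma less_suc_le: "x \<prec> y \<oplus> \<one> \<longleftrightarrow> x \<preceq> y"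
  by (simp add: less_suc le_def)

lemma D0_le: "Tm f \<Longrightarrow> Tm g \<Longrightarrow> D0 (\<lambda>e. f e \<preceq> g e)"
  unfolding le_def by (intro D0_intros)

lemma less_imp_ex: "x \<prec> y \<Longrightarrow> \<exists>d. y = x \<oplus> d \<oplus> \<one>"
proof -
  \<comment> \<open>The implication is moved under the existential quantifier to obtain the form
    required by \<open>S1_induct\<close>.\<close>
  have "\<exists>d. x \<prec> y \<longrightarrow> y = x \<oplus> d \<oplus> \<one>"
  proof (rule S1_induct[where P = "\<lambda>y d. x \<prec> y \<longrightarrow> y = x \<oplus> d \<oplus> \<one>"])
    fix y d assume "x \<prec> y \<longrightarrow> y = x \<oplus> d \<oplus> \<one>"
    then show "\<exists>d. x \<prec> y \<oplus> \<one> \<longrightarrow> y \<oplus> \<one> = x \<oplus> d \<oplus> \<one>"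
      unfolding less_suc by (metis add_suc add_zero)
  qed (intro D0_intros, simp)
  then show "x \<prec> y \<Longrightarrow> \<exists>d. y = x \<oplus> d \<oplus> \<one>" by blast
qed

lemma less_add_suc: "x \<prec> x \<oplus> d \<oplus> \<one>"
  by (induction d rule: D0_induct) (intro D0_intros, auto simp: less_suc simp flip: add_assoc)

lemma less_iff: "x \<prec> y \<longleftrightarrow> (\<exists>d. y = x \<oplus> d \<oplus> \<one>)"
  using less_imp_ex less_add_suc by blast

lemma le_iff: "x \<preceq> y \<longleftrightarrow> (\<exists>d. y = x \<oplus> d)"
  unfolding le_def less_iff by (metis add_suc add_zero zero_or_suc add_assoc)

lemma less_linear: "x \<prec> y \<or> x = y \<or> y \<prec> x"
proof (induction x rule: D0_induct)
  case zero
  show ?case using zero_or_suc[of y] less_iff[of \<zero> y] by auto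
next
  case (suc x)
  then show ?case unfolding less_iff by (metis add_suc add_zero zero_or_suc add_assoc add_commute)
qed (intro D0_intros)

sublocale order: linorder le less
proof
  show "x \<prec> y \<longleftrightarrow> x \<preceq> y \<and> \<not> y \<preceq> x" for x y
    unfolding le_iff less_iff
    by (metis add_assoc add_cancel_left add_eq_zero add_zero suc_neq_zero le_def le_iff less_iff)
  show "x \<preceq> z" if "x \<preceq> y" "y \<preceq> z" for x y z
    using that unfolding le_iff by (metis add_assoc)
  show "x = y" if "x \<preceq> y" "y \<preceq> x" for x y
    using that unfolding le_iff by (metis add_assoc add_cancel_left add_eq_zero add_zero)
  show "x \<preceq> y \<or> y \<preceq> x" for x y
    using less_linear le_def by blast
qed (simp add: le_def)

lemma zero_le [simp]: "\<zero> \<preceq> x"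
  by (simp add: le_iff)

lemma le_add1 [simp]: "x \<preceq> x \<oplus> y"
  by (auto simp: le_iff)

lemma le_add2 [simp]: "x \<preceq> y \<oplus> x"
  by (metis le_add1 add_commute)

lemma add_mono: "x \<preceq> x' \<Longrightarrow> y \<preceq> y' \<Longrightarrow> x \<oplus> y \<preceq> x' \<oplus> y'"
proof -
  assume "x \<preceq> x'" "y \<preceq> y'"
  then obtain a b where "x' = x \<oplus> a" "y' = y \<oplus> b" by (auto simp: le_iff)
  then have "x' \<oplus> y' = x \<oplus> y \<oplus> (a \<oplus> b)" by (simp add: ring_simps)
  then show ?thesis by (auto simp: le_iff)
qed

lemma mul_mono: "x \<preceq> x' \<Longrightarrow> y \<preceq> y' \<Longrightarrow> x \<otimes> y \<preceq> x' \<otimes> y'"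
proof -
  assume "x \<preceq> x'" "y \<preceq> y'"
  then obtain a b where "x' = x \<oplus> a" "y' = y \<oplus> b" by (auto simp: le_iff)
  then have "x' \<otimes> y' = x \<otimes> y \<oplus> (x \<otimes> b \<oplus> a \<otimes> y \<oplus> a \<otimes> b)" by (simp add: ring_simps)
  then show ?thesis by (auto simp: le_iff)
qed

lemma add_less_cancel [simp]: "x \<oplus> z \<prec> y \<oplus> z \<longleftrightarrow> x \<prec> y"
proof -
  have "y \<oplus> z = x \<oplus> z \<oplus> d \<oplus> \<one> \<longleftrightarrow> y \<oplus> z = x \<oplus> d \<oplus> \<one> \<oplus> z" for d
    by (simp only: ring_simps)
  then show ?thesis unfolding less_iff by simp
qed

lemma add_less_cancel' [simp]: "z \<oplus> x \<prec> z \<oplus> y \<longleftrightarrow> x \<prec> y"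
  by (metis add_less_cancel add_commute)

lemma less_suc_self [simp]: "x \<prec> x \<oplus> \<one>"
  by (simp add: less_suc)

lemma zero_less_suc [simp]: "\<zero> \<prec> x \<oplus> \<one>"
  by (simp add: less_suc_le)

lemma zero_less_one [simp]: "\<zero> \<prec> \<one>"
  using zero_less_suc[of \<zero>] by simp

lemma suc_le_iff: "x \<oplus> \<one> \<preceq> y \<longleftrightarrow> x \<prec> y"
  by (metis order.not_less less_suc_le)

lemma mul_eq_zero [simp]: "x \<otimes> y = \<zero> \<longleftrightarrow> x = \<zero> \<or> y = \<zero>"
  using zero_or_suc[of x] zero_or_suc[of y] by (auto simp: mul_suc)

lemma le_mul: "y \<noteq> \<zero> \<Longrightarrow> x \<preceq> x \<otimes> y"
  using zero_or_suc[of y] by (auto simp: mul_suc)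

lemma le_square: "x \<preceq> x \<otimes> x"
  by (cases "x = \<zero>") (simp_all add: le_mul)

lemma D0_less_induct:
  assumes D: "D0 (\<lambda>e. P (e 0))" and step: "\<And>x. (\<And>y. y \<prec> x \<Longrightarrow> P y) \<Longrightarrow> P x"
  shows "P x"
proof -
  have "\<forall>y. y \<prec> z \<longrightarrow> P y" for z
  proof (induction z rule: D0_induct)
    case D0
    show ?case by (intro D0_intros D0_subst1[OF D])
  qed (auto simp: less_suc intro: step)
  then show ?thesis using step by blast
qed

lemma D0_least:
  assumes D: "D0 (\<lambda>e. P (e 0))" and P: "P x"
  obtains y where "P y" "y \<preceq> x" "\<And>z. z \<prec> y \<Longrightarrow> \<not> P z"
proof (rule ccontr)
  assume no: "\<not> thesis"
  have "\<not> P z" for z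
  proof (induction z rule: D0_less_induct)
    case 1
    show ?case by (rule D0_not) (rule D)
  next
    case (2 z)
    show ?case
    proof
      assume z: "P z"
      have "z \<preceq> x" using 2[of x] P order.not_less by blast
      then show False using that[of z] z 2 no by blast
    qed
  qed
  then show False using P by blast
qed

subsection \<open>Pairs\<close>

definition pr :: "'a \<Rightarrow> 'a \<Rightarrow> 'a" where "pr x y = (x \<oplus> y) \<otimes> (x \<oplus> y) \<oplus> x"

lemma Tm_pr: "Tm f \<Longrightarrow> Tm g \<Longrightarrow> Tm (\<lambda>e. pr (f e) (g e))"
  unfolding pr_def by (intro Tm.intros)

lemma le_pr1 [simp]: "x \<preceq> pr x y"
  unfolding pr_def by simp

lemma le_pr2 [simp]: "y \<preceq> pr x y"
  unfolding pr_def by (meson le_add1 le_add2 le_square order.order_trans)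

lemma pr_mono: "x \<preceq> x' \<Longrightarrow> y \<preceq> y' \<Longrightarrow> pr x y \<preceq> pr x' y'"
  unfolding pr_def by (intro add_mono mul_mono)

text \<open>With \<open>s\<close> the sum of its components, a pair is at least the square of
  \<open>s\<close> and below the next square, because \<open>x \<preceq> s\<close>. So the sum
  determines the order, and injectivity follows.\<close>

lemma pr_less_aux: "x \<oplus> y \<prec> x' \<oplus> y' \<Longrightarrow> pr x y \<prec> pr x' y'"
proof -
  let ?s = "x \<oplus> y" and ?t = "x' \<oplus> y'"
  assume "?s \<prec> ?t"
  then have "(?s \<oplus> \<one>) \<otimes> (?s \<oplus> \<one>) \<preceq> ?t \<otimes> ?t"
    by (intro mul_mono) (simp_all add: suc_le_iff)
  moreover have "pr x y \<prec> (?s \<oplus> \<one>) \<otimes> (?s \<oplus> \<one>)"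
  proof -
    have "(?s \<oplus> \<one>) \<otimes> (?s \<oplus> \<one>) = pr x y \<oplus> (x \<oplus> y \<oplus> y) \<oplus> \<one>"
      unfolding pr_def
      by (simp add: ring_simps)
    then show ?thesis using less_iff by blast
  qed
  moreover have "?t \<otimes> ?t \<preceq> pr x' y'" unfolding pr_def by simp
  ultimately show "pr x y \<prec> pr x' y'" by (meson order.less_le_trans)
qed

lemma pr_inject [simp]: "pr x y = pr x' y' \<longleftrightarrow> x = x' \<and> y = y'"
proof
  assume eq: "pr x y = pr x' y'"
  then have s: "x \<oplus> y = x' \<oplus> y'"
    using pr_less_aux less_linear order.less_irrefl by metis
  then have "x = x'" using eq unfolding pr_def by simp
  then show "x = x' \<and> y = y'" using s by simp
qed simp

lemma pr_bound: "pr x y \<prec> b \<Longrightarrow> x \<prec> b \<and> y \<prec> b"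
  by (meson le_pr1 le_pr2 order.le_less_trans)

subsection \<open>Divisibility\<close>

definition dv :: "'a \<Rightarrow> 'a \<Rightarrow> bool" where "dv a b \<longleftrightarrow> (\<exists>q. b = a \<otimes> q)"

lemma dv_bounded: "dv a b \<longleftrightarrow> (\<exists>q. q \<prec> b \<oplus> \<one> \<and> b = a \<otimes> q)"
proof
  assume "dv a b"
  then obtain q where q: "b = a \<otimes> q" unfolding dv_def by blast
  show "\<exists>q. q \<prec> b \<oplus> \<one> \<and> b = a \<otimes> q"
  proof (cases "a = \<zero>")
    case True
    then show ?thesis using q by (intro exI[of _ \<zero>]) (auto simp: less_suc)
  next
    case False
    then have "q \<preceq> b" using le_mul[of a q] q by (simp add: mul_commute)
    then show ?thesis using q less_suc_le by blast
  qed
qed (auto simp: dv_def)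

lemma D0_dv: "Tm f \<Longrightarrow> Tm g \<Longrightarrow> D0 (\<lambda>e. dv (f e) (g e))"
proof (rule D0_subst2[where Q = dv])
  show "D0 (\<lambda>e. dv (e 0) (e (Suc 0)))"
    unfolding dv_bounded by (intro D0_intros)
qed

lemma dv_mul1 [simp]: "dv a (a \<otimes> b)"
  by (auto simp: dv_def)

lemma dv_mul2: "dv a b \<Longrightarrow> dv a (c \<otimes> b)"
  unfolding dv_def by (metis mul_assoc mul_commute)

text \<open>In the absence of subtraction the quotients are compared: either they differ by a
  quotient for \<open>c\<close>, or \<open>c\<close> is zero.\<close>

lemma dv_add_cancel: "dv a (b \<oplus> c) \<Longrightarrow> dv a b \<Longrightarrow> dv a c"
proof -
  assume "dv a (b \<oplus> c)" "dv a b"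
  then obtain p q where pq: "b \<oplus> c = a \<otimes> p" "b = a \<otimes> q" unfolding dv_def by blast
  show "dv a c"
  proof (cases "q \<preceq> p")
    case True
    then obtain d where "p = q \<oplus> d" by (auto simp: le_iff)
    then have "c = a \<otimes> d" using pq by (simp add: semiring.distrib_left)
    then show ?thesis by simp
  next
    case False
    then obtain d where "q = p \<oplus> d" using order.linear le_iff by blast
    then have "a \<otimes> p \<oplus> (a \<otimes> d \<oplus> c) = a \<otimes> p \<oplus> \<zero>"
      using pq by (simp add: semiring.distrib_left add_assoc)
    then have "c = \<zero>" by (simp only: add_cancel_left add_eq_zero)
    then show ?thesis using dv_mul1[of a \<zero>] by simp
  qed
qed

subsection \<open>Codes of finite sets\<close>

definition triple :: "'a \<Rightarrow> bool" where "triple c \<longleftrightarrow> (\<exists>k m n. c = pr k (pr m n))"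

definition elm :: "'a \<Rightarrow> 'a \<Rightarrow> bool" where
  "elm i c \<longleftrightarrow> (\<exists>k m n. c = pr k (pr m n) \<and> i \<prec> k \<and> dv (m \<otimes> (i \<oplus> \<one>) \<oplus> \<one>) n)"

definition setc :: "'a \<Rightarrow> bool" where
  "setc c \<longleftrightarrow> triple c \<and> (\<forall>d. d \<prec> c \<and> triple d \<longrightarrow> \<not> (\<forall>i. elm i d \<longleftrightarrow> elm i c))"

lemma triple_bounds: "k \<preceq> pr k (pr m n)" "m \<preceq> pr k (pr m n)" "n \<preceq> pr k (pr m n)"
  by (simp, (meson le_pr1 le_pr2 order.order_trans)+)

text \<open>The quantifiers of the official definitions are unbounded. Components and elements do
  not exceed their code, so the code itself can serve as bound here and in the similar lemmas
  below.\<close>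

lemma triple_bounded: "triple c \<longleftrightarrow> (\<exists>k. k \<prec> c \<oplus> \<one> \<and> (\<exists>m. m \<prec> c \<oplus> \<one> \<and> (\<exists>n. n \<prec> c \<oplus> \<one> \<and>
    c = pr k (pr m n))))"
  unfolding triple_def less_suc_le using triple_bounds by blast

lemma elm_bounded: "elm i c \<longleftrightarrow> (\<exists>k. k \<prec> c \<oplus> \<one> \<and> (\<exists>m. m \<prec> c \<oplus> \<one> \<and> (\<exists>n. n \<prec> c \<oplus> \<one> \<and>
    c = pr k (pr m n) \<and> i \<prec> k \<and> dv (m \<otimes> (i \<oplus> \<one>) \<oplus> \<one>) n)))"
  unfolding elm_def less_suc_le using triple_bounds by blast

lemma elm_triple: "elm i (pr k (pr m n)) \<longleftrightarrow> i \<prec> k \<and> dv (m \<otimes> (i \<oplus> \<one>) \<oplus> \<one>) n"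
  by (auto simp: elm_def)

lemma elm_less: "elm i c \<Longrightarrow> i \<prec> c"
  unfolding elm_def using le_pr1 order.less_le_trans by blast

lemma D0_triple: "Tm f \<Longrightarrow> D0 (\<lambda>e. triple (f e))"
proof (rule D0_subst1[where Q = triple])
  show "D0 (\<lambda>e. triple (e 0))"
    unfolding triple_bounded by (intro D0_intros Tm_pr)
qed

lemma D0_elm: "Tm f \<Longrightarrow> Tm g \<Longrightarrow> D0 (\<lambda>e. elm (f e) (g e))"
proof (rule D0_subst2[where Q = elm])
  show "D0 (\<lambda>e. elm (e 0) (e (Suc 0)))"
    unfolding elm_bounded by (intro D0_intros D0_dv Tm_pr)
qed

lemma setc_bounded:
  "setc c \<longleftrightarrow> triple c \<and> (\<forall>d. d \<prec> c \<longrightarrow> triple d \<longrightarrow> \<not> (\<forall>i. i \<prec> c \<longrightarrow> (elm i d \<longleftrightarrow> elm i c)))"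
proof -
  have "(\<forall>i. i \<prec> c \<longrightarrow> (elm i d \<longleftrightarrow> elm i c)) \<longleftrightarrow> (\<forall>i. elm i d \<longleftrightarrow> elm i c)" if "d \<prec> c" for d
    using that elm_less order.less_trans by blast
  then show ?thesis unfolding setc_def by blast
qed

lemma D0_setc: "Tm f \<Longrightarrow> D0 (\<lambda>e. setc (f e))"
proof (rule D0_subst1[where Q = setc])
  show "D0 (\<lambda>e. setc (e 0))"
    unfolding setc_bounded by (intro D0_intros D0_triple D0_elm)
qed

lemma setc_ext: "setc c \<Longrightarrow> setc d \<Longrightarrow> (\<And>i. elm i c \<longleftrightarrow> elm i d) \<Longrightarrow> c = d"
  unfolding setc_def by (metis less_linear)

text \<open>The least triple with the same elements is taken. Elements are smaller than their code,
  so comparing elements below \<open>c\<close> suffices and keeps the search bounded.\<close>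

lemma setc_ex_le:
  assumes "triple c"
  obtains d where "setc d" "d \<preceq> c" "\<And>i. elm i d \<longleftrightarrow> elm i c"
proof -
  let ?P = "\<lambda>d. d \<preceq> c \<and> triple d \<and> (\<forall>i. i \<prec> c \<longrightarrow> (elm i d \<longleftrightarrow> elm i c))"
  have D: "D0 (\<lambda>e. ?P (e 0))" by (intro D0_intros D0_triple D0_elm D0_le)
  have "?P c" using assms by simp
  with D obtain d where d: "?P d" and "d \<preceq> c" and least: "\<And>z. z \<prec> d \<Longrightarrow> \<not> ?P z"
    by (rule D0_least[where P = ?P]) (rule that)
  have ext: "elm i d \<longleftrightarrow> elm i c" for i
    using d elm_less order.less_le_trans by blast
  have "setc d"
    unfolding setc_def
  proof (intro conjI allI impI notI)
    fix z assume z: "z \<prec> d \<and> triple z" "\<forall>i. elm i z \<longleftrightarrow> elm i d"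
    then have "z \<preceq> c" using d by (meson order.less_imp_le order.order_trans)
    then show False using least[of z] z ext by blast
  qed (use d in blast)
  then show ?thesis using that d ext by blast
qed

lemma common_multiple:
  assumes "Tm (\<lambda>e. f (e 0))" "\<And>i. f i \<noteq> \<zero>"
  shows "\<exists>P. P \<noteq> \<zero> \<and> (\<forall>i. i \<prec> K \<longrightarrow> dv (f i) P)"
proof (rule S1_induct[where P = "\<lambda>K P. P \<noteq> \<zero> \<and> (\<forall>i. i \<prec> K \<longrightarrow> dv (f i) P)"])
  show "D0 (\<lambda>e. e (Suc 0) \<noteq> \<zero> \<and> (\<forall>i. i \<prec> e 0 \<longrightarrow> dv (f i) (e (Suc 0))))"
    by (intro D0_intros D0_dv assms(1))
  show "\<exists>P. P \<noteq> \<zero> \<and> (\<forall>i. i \<prec> \<zero> \<longrightarrow> dv (f i) P)" by (intro exI[of _ \<one>]) simp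
  fix K P assume "P \<noteq> \<zero> \<and> (\<forall>i. i \<prec> K \<longrightarrow> dv (f i) P)"
  then show "\<exists>P. P \<noteq> \<zero> \<and> (\<forall>i. i \<prec> K \<oplus> \<one> \<longrightarrow> dv (f i) P)"
    using assms(2) by (intro exI[of _ "f K \<otimes> P"]) (auto simp: less_suc intro: dv_mul2)
qed

text \<open>The moduli $M(i+1)+1$ for $i<K$ are pairwise coprime when $M$ is divisible by $1,\dots,K$;
  coprimality is used in the form of Euclid's lemma.\<close>

lemma modulus_cancel:
  assumes M: "\<And>i. i \<prec> K \<Longrightarrow> dv (i \<oplus> \<one>) M" and ij: "i \<prec> K" "j \<prec> K" "i \<noteq> j"
    and dv: "dv (M \<otimes> (j \<oplus> \<one>) \<oplus> \<one>) ((M \<otimes> (i \<oplus> \<one>) \<oplus> \<one>) \<otimes> n)"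
  shows "dv (M \<otimes> (j \<oplus> \<one>) \<oplus> \<one>) n"
proof -
  let ?q = "\<lambda>i. M \<otimes> (i \<oplus> \<one>) \<oplus> \<one>"
  \<comment> \<open>\<open>M\<close> is invertible modulo \<open>?q j\<close>: the product
    \<open>(j \<oplus> \<one>) \<otimes> M\<close> is one less than the modulus.\<close>
  have drop_M: "dv (?q j) x" if "dv (?q j) (M \<otimes> x)" for x
  proof (rule dv_add_cancel[of _ "(j \<oplus> \<one>) \<otimes> (M \<otimes> x)"])
    have "(j \<oplus> \<one>) \<otimes> (M \<otimes> x) \<oplus> x = ?q j \<otimes> x" by (simp add: ring_simps)
    then show "dv (?q j) ((j \<oplus> \<one>) \<otimes> (M \<otimes> x) \<oplus> x)" by simp
  qed (rule dv_mul2[OF that])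
  \<comment> \<open>The moduli differ by \<open>M\<close> times the distance
    \<open>d \<oplus> \<one>\<close> of \<open>i\<close> and \<open>j\<close>. This distance divides
    \<open>M\<close>, so it can be completed to a factor \<open>M\<close>, and \<open>drop_M\<close>
    then applies a second time.\<close>
  have "\<exists>d. dv (d \<oplus> \<one>) M \<and> dv (?q j) (M \<otimes> ((d \<oplus> \<one>) \<otimes> n))"
  proof -
    consider "i \<prec> j" | "j \<prec> i" using ij(3) less_linear by blast
    then show ?thesis
    proof cases
      case 1
      then obtain d where d: "j = i \<oplus> d \<oplus> \<one>" using less_imp_ex by blast
      have "?q i \<otimes> n \<oplus> M \<otimes> ((d \<oplus> \<one>) \<otimes> n) = ?q j \<otimes> n" by (simp only: d ring_simps one_mul semiring.mult_1_right)
      then have "dv (?q j) (?q i \<otimes> n \<oplus> M \<otimes> ((d \<oplus> \<one>) \<otimes> n))" by simp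
      then have "dv (?q j) (M \<otimes> ((d \<oplus> \<one>) \<otimes> n))" using dv by (rule dv_add_cancel)
      moreover have "d \<prec> j" unfolding d using less_add_suc[of d i] by (simp add: ring_simps)
      ultimately show ?thesis using M ij order.less_trans by blast
    next
      case 2
      then obtain d where d: "i = j \<oplus> d \<oplus> \<one>" using less_imp_ex by blast
      have "?q i \<otimes> n = ?q j \<otimes> n \<oplus> M \<otimes> ((d \<oplus> \<one>) \<otimes> n)" by (simp only: d ring_simps one_mul semiring.mult_1_right)
      then have "dv (?q j) (M \<otimes> ((d \<oplus> \<one>) \<otimes> n))" using dv by (metis dv_add_cancel dv_mul1)
      moreover have "d \<prec> i" unfolding d using less_add_suc[of d j] by (simp add: ring_simps)
      ultimately show ?thesis using M ij order.less_trans by blast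
    qed
  qed
  then obtain d where d: "dv (d \<oplus> \<one>) M" "dv (?q j) (M \<otimes> ((d \<oplus> \<one>) \<otimes> n))" by blast
  then obtain c where "M = (d \<oplus> \<one>) \<otimes> c" unfolding dv_def by blast
  then have "M \<otimes> n = c \<otimes> ((d \<oplus> \<one>) \<otimes> n)" by (simp only: ring_simps)
  then have "dv (?q j) (M \<otimes> n)" using drop_M[OF d(2)] dv_mul2 by metis
  then show ?thesis by (rule drop_M)
qed

text \<open>One bound for the codes of all sets below \<open>K\<close>, as in Goedel's beta
  function: \<open>M\<close> makes the moduli pairwise coprime and \<open>P\<close> is a common
  multiple of them. Keeping \<open>M\<close> and \<open>P\<close> below \<open>B\<close> makes the
  notion itself bounded, so it may occur in searches over codes.\<close>

definition code_bound :: "'a \<Rightarrow> 'a \<Rightarrow> bool" where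
  "code_bound K B \<longleftrightarrow> (\<exists>M. M \<prec> B \<and> M \<noteq> \<zero> \<and> (\<exists>P. P \<prec> B \<and> P \<noteq> \<zero> \<and> (\<forall>i. i \<prec> K \<longrightarrow> dv (i \<oplus> \<one>) M) \<and>
    (\<forall>i. i \<prec> K \<longrightarrow> dv (M \<otimes> (i \<oplus> \<one>) \<oplus> \<one>) P) \<and> pr K (pr M P) \<prec> B))"

lemma D0_code_bound: "Tm f \<Longrightarrow> Tm g \<Longrightarrow> D0 (\<lambda>e. code_bound (f e) (g e))"
proof (rule D0_subst2[where Q = code_bound])
  show "D0 (\<lambda>e. code_bound (e 0) (e (Suc 0)))"
    unfolding code_bound_def by (intro D0_intros D0_dv Tm_pr)
qed

lemma code_bound_ex: "\<exists>B. code_bound K B"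
proof -
  obtain M where M: "M \<noteq> \<zero>" "\<forall>i. i \<prec> K \<longrightarrow> dv (i \<oplus> \<one>) M"
    using common_multiple[of "\<lambda>i. i \<oplus> \<one>" K] Tm_add[OF Tm_var Tm_const] by auto
  have "Tm (\<lambda>e. M \<otimes> (e 0 \<oplus> \<one>) \<oplus> \<one>)" by (intro Tm.intros)
  then obtain P where P: "P \<noteq> \<zero>" "\<forall>i. i \<prec> K \<longrightarrow> dv (M \<otimes> (i \<oplus> \<one>) \<oplus> \<one>) P"
    using common_multiple[of "\<lambda>i. M \<otimes> (i \<oplus> \<one>) \<oplus> \<one>" K] by auto
  show ?thesis
    unfolding code_bound_def
    by (intro exI[of _ "pr K (pr M P) \<oplus> \<one>"] exI[of _ M] conjI exI[of _ P])
      (use M P triple_bounds in \<open>auto simp: less_suc_le\<close>)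
qed

text \<open>The least nonzero common multiple \<open>n\<close> of the moduli belonging to
  \<open>X\<close> encodes exactly \<open>X\<close>: if a foreign modulus divided \<open>n\<close>,
  cancelling it would leave a smaller common multiple by \<open>modulus_cancel\<close>. As
  \<open>n \<preceq> P\<close>, the code stays below \<open>B\<close>.\<close>

lemma set_code_ex:
  assumes X: "X \<in> Sets" "\<And>x. x \<in> X \<Longrightarrow> x \<prec> K" and B: "code_bound K B"
  obtains c where "c \<prec> B" "setc c" "\<And>i. elm i c \<longleftrightarrow> i \<in> X"
proof -
  obtain M P where M: "M \<noteq> \<zero>" "\<And>i. i \<prec> K \<Longrightarrow> dv (i \<oplus> \<one>) M"
    and P: "P \<noteq> \<zero>" "\<And>i. i \<prec> K \<Longrightarrow> dv (M \<otimes> (i \<oplus> \<one>) \<oplus> \<one>) P"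
    and B: "pr K (pr M P) \<prec> B"
    using B unfolding code_bound_def by blast
  let ?q = "\<lambda>i. M \<otimes> (i \<oplus> \<one>) \<oplus> \<one>"
  let ?P = "\<lambda>n. n \<noteq> \<zero> \<and> (\<forall>i. i \<prec> K \<longrightarrow> i \<in> X \<longrightarrow> dv (?q i) n)"
  have D: "D0 (\<lambda>e. ?P (e 0))" by (intro D0_intros D0_dv X)
  have "?P P" using P by blast
  with D obtain n where n: "?P n" "n \<preceq> P" and least: "\<And>z. z \<prec> n \<Longrightarrow> \<not> ?P z"
    by (rule D0_least[where P = ?P]) (rule that)
  have "i \<in> X" if i: "i \<prec> K" "dv (?q i) n" for i
  proof (rule ccontr)
    assume iX: "i \<notin> X"
    obtain r where r: "n = ?q i \<otimes> r" using i(2) unfolding dv_def by blast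
    then have "r \<noteq> \<zero>" using n by auto
    have "dv (?q j) r" if "j \<prec> K" "j \<in> X" for j
      using modulus_cancel[of K M i j r] M i that iX n r by blast
    then have "\<not> r \<prec> n" using least[of r] \<open>r \<noteq> \<zero>\<close> by blast
    moreover have "r \<prec> n"
    proof -
      have "n = r \<oplus> M \<otimes> (i \<oplus> \<one>) \<otimes> r" unfolding r by (simp add: ring_simps)
      then have "r \<preceq> n" "r \<noteq> n" using M(1) \<open>r \<noteq> \<zero>\<close> by (auto simp: le_iff)
      then show ?thesis by (simp add: le_def)
    qed
    ultimately show False by blast
  qed
  then have elm: "elm i (pr K (pr M n)) \<longleftrightarrow> i \<in> X" for i
    unfolding elm_triple using n X(2) by blast
  obtain c where c: "setc c" "c \<preceq> pr K (pr M n)" "\<And>i. elm i c \<longleftrightarrow> elm i (pr K (pr M n))"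
    using setc_ex_le[of "pr K (pr M n)"] by (auto simp: triple_def)
  have "pr K (pr M n) \<preceq> pr K (pr M P)" using n by (intro pr_mono) auto
  then have "c \<prec> B" using c(2) B by (meson order.le_less_trans order.order_trans)
  then show ?thesis using that c elm by blast
qed

subsection \<open>Finite sequences\<close>

definition haslen :: "'a \<Rightarrow> 'a \<Rightarrow> bool" where
  "haslen s l \<longleftrightarrow> (\<forall>i. i \<prec> l \<longleftrightarrow> (\<exists>j. elm (pr i j) s))"

definition sq :: "'a \<Rightarrow> bool" where
  "sq s \<longleftrightarrow> setc s \<and> (\<forall>p. elm p s \<longrightarrow> (\<exists>i j. p = pr i j)) \<and>
     (\<forall>i j j'. elm (pr i j) s \<and> elm (pr i j') s \<longrightarrow> j = j') \<and> (\<exists>l. haslen s l)"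

definition bsq :: "'a \<Rightarrow> bool" where
  "bsq s \<longleftrightarrow> sq s \<and> (\<forall>i j. elm (pr i j) s \<longrightarrow> j = \<zero> \<or> j = \<one>)"

definition initseg :: "'a \<Rightarrow> 'a \<Rightarrow> bool" where
  "initseg t s \<longleftrightarrow> (\<forall>i j. elm (pr i j) t \<longrightarrow> elm (pr i j) s)"

lemma elm_pr_less: "elm (pr i j) s \<Longrightarrow> i \<prec> s" "elm (pr i j) s \<Longrightarrow> j \<prec> s"
  using elm_less pr_bound by blast+

lemma haslen_le: "haslen s l \<Longrightarrow> l \<preceq> s"
  unfolding haslen_def using elm_pr_less(1) order.not_less order.less_irrefl by blast

lemma haslen_bounded: "haslen s l \<longleftrightarrow> l \<prec> s \<oplus> \<one> \<and>
  (\<forall>i. i \<prec> s \<longrightarrow> (i \<prec> l \<longleftrightarrow> (\<exists>j. j \<prec> s \<and> elm (pr i j) s)))"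
proof
  assume "haslen s l"
  then show "l \<prec> s \<oplus> \<one> \<and> (\<forall>i. i \<prec> s \<longrightarrow> (i \<prec> l \<longleftrightarrow> (\<exists>j. j \<prec> s \<and> elm (pr i j) s)))"
    using haslen_le elm_pr_less(2) unfolding haslen_def less_suc_le by blast
next
  assume "l \<prec> s \<oplus> \<one> \<and> (\<forall>i. i \<prec> s \<longrightarrow> (i \<prec> l \<longleftrightarrow> (\<exists>j. j \<prec> s \<and> elm (pr i j) s)))"
  then show "haslen s l"
    using elm_pr_less order.less_le_trans unfolding haslen_def less_suc_le by blast
qed

lemma D0_haslen: "Tm f \<Longrightarrow> Tm g \<Longrightarrow> D0 (\<lambda>e. haslen (f e) (g e))"
proof (rule D0_subst2[where Q = haslen])
  show "D0 (\<lambda>e. haslen (e 0) (e (Suc 0)))"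
    unfolding haslen_bounded by (intro D0_intros D0_elm Tm_pr)
qed

lemma bsq_bounded: "bsq s \<longleftrightarrow> setc s \<and>
  (\<forall>p. p \<prec> s \<longrightarrow> elm p s \<longrightarrow> (\<exists>i. i \<prec> s \<and> (\<exists>j. j \<prec> s \<and> p = pr i j))) \<and>
  (\<forall>i. i \<prec> s \<longrightarrow> (\<forall>j. j \<prec> s \<longrightarrow> (\<forall>j'. j' \<prec> s \<longrightarrow> elm (pr i j) s \<and> elm (pr i j') s \<longrightarrow> j = j'))) \<and>
  (\<exists>l. l \<prec> s \<oplus> \<one> \<and> haslen s l) \<and>
  (\<forall>i. i \<prec> s \<longrightarrow> (\<forall>j. j \<prec> s \<longrightarrow> elm (pr i j) s \<longrightarrow> j = \<zero> \<or> j = \<one>))"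
proof -
  have "(\<forall>p. elm p s \<longrightarrow> (\<exists>i j. p = pr i j)) \<longleftrightarrow>
      (\<forall>p. p \<prec> s \<longrightarrow> elm p s \<longrightarrow> (\<exists>i. i \<prec> s \<and> (\<exists>j. j \<prec> s \<and> p = pr i j)))"
    using elm_less pr_bound by blast
  moreover have "(\<exists>l. haslen s l) \<longleftrightarrow> (\<exists>l. l \<prec> s \<oplus> \<one> \<and> haslen s l)"
    unfolding less_suc_le using haslen_le by blast
  moreover have "(\<forall>i j j'. elm (pr i j) s \<and> elm (pr i j') s \<longrightarrow> j = j') \<longleftrightarrow>
      (\<forall>i. i \<prec> s \<longrightarrow> (\<forall>j. j \<prec> s \<longrightarrow> (\<forall>j'. j' \<prec> s \<longrightarrow> elm (pr i j) s \<and> elm (pr i j') s \<longrightarrow> j = j')))"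
    using elm_pr_less by blast
  moreover have "(\<forall>i j. elm (pr i j) s \<longrightarrow> j = \<zero> \<or> j = \<one>) \<longleftrightarrow>
      (\<forall>i. i \<prec> s \<longrightarrow> (\<forall>j. j \<prec> s \<longrightarrow> elm (pr i j) s \<longrightarrow> j = \<zero> \<or> j = \<one>))"
    using elm_pr_less by blast
  ultimately show ?thesis unfolding bsq_def sq_def by blast
qed

lemma D0_bsq: "Tm f \<Longrightarrow> D0 (\<lambda>e. bsq (f e))"
proof (rule D0_subst1[where Q = bsq])
  show "D0 (\<lambda>e. bsq (e 0))"
    unfolding bsq_bounded by (intro D0_intros D0_elm D0_setc D0_haslen Tm_pr)
qed

lemma initseg_bounded: "initseg t s \<longleftrightarrow>
  (\<forall>i. i \<prec> t \<longrightarrow> (\<forall>j. j \<prec> t \<longrightarrow> elm (pr i j) t \<longrightarrow> elm (pr i j) s))"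
  unfolding initseg_def using elm_pr_less by blast

lemma D0_initseg: "Tm f \<Longrightarrow> Tm g \<Longrightarrow> D0 (\<lambda>e. initseg (f e) (g e))"
proof (rule D0_subst2[where Q = initseg])
  show "D0 (\<lambda>e. initseg (e 0) (e (Suc 0)))"
    unfolding initseg_bounded by (intro D0_intros D0_elm Tm_pr)
qed

section \<open>Binary sequences as restrictions of characteristic functions\<close>

definition charf :: "'a set \<Rightarrow> 'a \<Rightarrow> 'a" where "charf X i = (if i \<in> X then \<one> else \<zero>)"

text \<open>Sequences are handled through sets of the model. Only the part of \<open>X\<close> below
  \<open>l\<close> matters, so one \<open>X\<close> describes a sequence together with all its
  initial segments.\<close>

definition codes :: "'a \<Rightarrow> 'a set \<Rightarrow> 'a \<Rightarrow> bool" where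
  "codes s X l \<longleftrightarrow> setc s \<and> (\<forall>p. elm p s \<longleftrightarrow> (\<exists>i. i \<prec> l \<and> p = pr i (charf X i)))"

lemma charf_eq [simp]: "charf X i = \<one> \<longleftrightarrow> i \<in> X" "charf X i = \<zero> \<longleftrightarrow> i \<notin> X"
  "\<one> = charf X i \<longleftrightarrow> i \<in> X" "\<zero> = charf X i \<longleftrightarrow> i \<notin> X"
  by (auto simp: charf_def zero_neq_one)

lemma charf_le [simp]: "charf X i \<preceq> \<one>"
  by (simp add: charf_def)

lemma codes_elm: "codes s X l \<Longrightarrow> elm (pr i j) s \<longleftrightarrow> i \<prec> l \<and> j = charf X i"
  by (auto simp: codes_def)

lemma codes_haslen: "codes s X l \<Longrightarrow> haslen s m \<longleftrightarrow> m = l"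
proof -
  assume c: "codes s X l"
  have "haslen s m \<longleftrightarrow> (\<forall>i. i \<prec> m \<longleftrightarrow> i \<prec> l)"
    unfolding haslen_def codes_elm[OF c] by simp
  also have "\<dots> \<longleftrightarrow> m = l" using less_linear order.less_irrefl by metis
  finally show ?thesis .
qed

lemma codes_bsq: "codes s X l \<Longrightarrow> bsq s"
proof -
  assume c: "codes s X l"
  then have "haslen s l" by (simp add: codes_haslen)
  then show ?thesis
    using c unfolding bsq_def sq_def by (auto simp: codes_elm[OF c] charf_def) (auto simp: codes_def)
qed

lemma bsq_codes:
  assumes "bsq s" "haslen s l"
  shows "codes s {i. elm (pr i \<one>) s} l"
  unfolding codes_def
proof (intro conjI allI)
  fix p
  show "elm p s \<longleftrightarrow> (\<exists>i. i \<prec> l \<and> p = pr i (charf {i. elm (pr i \<one>) s} i))"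
  proof
    assume p: "elm p s"
    then obtain i j where ij: "p = pr i j" using assms by (auto simp: bsq_def sq_def)
    then have "i \<prec> l" "j = \<zero> \<or> j = \<one>" "elm (pr i \<one>) s \<longrightarrow> j = \<one>"
      using p assms unfolding bsq_def sq_def haslen_def by blast+
    then show "\<exists>i. i \<prec> l \<and> p = pr i (charf {i. elm (pr i \<one>) s} i)"
      using p ij by (auto simp: charf_def)
  next
    assume "\<exists>i. i \<prec> l \<and> p = pr i (charf {i. elm (pr i \<one>) s} i)"
    then obtain i where i: "i \<prec> l" "p = pr i (charf {i. elm (pr i \<one>) s} i)" by blast
    then obtain j where "elm (pr i j) s" using assms(2) unfolding haslen_def by blast
    moreover have "j = \<zero> \<or> j = \<one>" using calculation assms(1) unfolding bsq_def by blast
    ultimately show "elm p s" using i by (auto simp: charf_def)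
  qed
qed (use assms in \<open>simp add: bsq_def sq_def\<close>)

lemma elm_one_Sets: "{i. elm (pr i \<one>) s} \<in> Sets"
  by (intro D0_comprehension D0_elm Tm_pr Tm.intros)

lemma bsq_codes_ex: "bsq s \<Longrightarrow> \<exists>X l. X \<in> Sets \<and> codes s X l"
  using bsq_codes elm_one_Sets unfolding bsq_def sq_def by blast

lemma codes_unique:
  assumes "codes s X l" "codes t Z l" "\<And>i. i \<prec> l \<Longrightarrow> i \<in> X \<longleftrightarrow> i \<in> Z"
  shows "s = t"
proof (rule setc_ext)
  have "charf X i = charf Z i" if "i \<prec> l" for i using assms(3)[OF that] by (simp add: charf_def)
  then show "elm p s \<longleftrightarrow> elm p t" for p using assms(1,2) unfolding codes_def by metis
qed (use assms in \<open>auto simp: codes_def\<close>)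

lemma codes_initseg:
  assumes "codes s X l" "codes t Z m"
  shows "initseg t s \<longleftrightarrow> m \<preceq> l \<and> (\<forall>i. i \<prec> m \<longrightarrow> (i \<in> Z \<longleftrightarrow> i \<in> X))"
proof -
  have "initseg t s \<longleftrightarrow> (\<forall>i. i \<prec> m \<longrightarrow> i \<prec> l \<and> charf Z i = charf X i)"
    unfolding initseg_def codes_elm[OF assms(1)] codes_elm[OF assms(2)] by blast
  also have "(\<forall>i. i \<prec> m \<longrightarrow> i \<prec> l) \<longleftrightarrow> m \<preceq> l"
    using order.not_less order.less_le_trans order.less_irrefl by metis
  then have "(\<forall>i. i \<prec> m \<longrightarrow> i \<prec> l \<and> charf Z i = charf X i) \<longleftrightarrow> m \<preceq> l \<and> (\<forall>i. i \<prec> m \<longrightarrow> (i \<in> Z \<longleftrightarrow> i \<in> X))"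
    by (auto simp: charf_def split: if_splits)
  finally show ?thesis .
qed

lemma pr_less_one: "i \<prec> l \<Longrightarrow> b \<preceq> \<one> \<Longrightarrow> pr i b \<prec> pr l \<one>"
proof (rule pr_less_aux)
  assume "i \<prec> l" "b \<preceq> \<one>"
  then have "i \<oplus> b \<preceq> i \<oplus> \<one>" by (intro add_mono) auto
  also have "i \<oplus> \<one> \<prec> l \<oplus> \<one>" using \<open>i \<prec> l\<close> by simp
  finally show "i \<oplus> b \<prec> l \<oplus> \<one>" .
qed

lemma pr_less_zero: "i \<prec> l \<Longrightarrow> b \<preceq> \<one> \<Longrightarrow> pr i b \<prec> pr l \<zero>"
proof -
  assume i: "i \<prec> l" and b: "b \<preceq> \<one>"
  have "i \<oplus> b \<preceq> i \<oplus> \<one>" using b by (intro add_mono) auto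
  also have "i \<oplus> \<one> \<preceq> l" using i by (simp add: suc_le_iff)
  finally have "i \<oplus> b \<preceq> l \<oplus> \<zero>" by simp
  then consider "i \<oplus> b \<prec> l \<oplus> \<zero>" | "i \<oplus> b = l \<oplus> \<zero>" unfolding le_def by blast
  then show ?thesis
  proof cases
    \<comment> \<open>Equality of the sums occurs for \<open>b = \<one>\<close> and
      \<open>l = i \<oplus> \<one>\<close>; then the first component decides.\<close>
    case 2
    then show ?thesis using i unfolding pr_def by simp
  qed (rule pr_less_aux)
qed

lemma codes_ex:
  assumes "X \<in> Sets" "code_bound (pr l \<one>) B"
  obtains s where "s \<prec> B" "codes s X l"
proof -
  let ?A = "{p. \<exists>i. i \<prec> l \<and> (i \<in> X \<and> p = pr i \<one> \<or> i \<notin> X \<and> p = pr i \<zero>)}"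
  have A: "?A \<in> Sets" using assms(1) by (intro D0_comprehension D0_intros Tm_pr)
  have eq: "p \<in> ?A \<longleftrightarrow> (\<exists>i. i \<prec> l \<and> p = pr i (charf X i))" for p
    by (auto simp: charf_def)
  have below: "p \<prec> pr l \<one>" if "p \<in> ?A" for p
    using that unfolding eq by (auto intro: pr_less_one)
  obtain s where "s \<prec> B" "setc s" "\<And>p. elm p s \<longleftrightarrow> p \<in> ?A"
    by (rule set_code_ex[OF A below assms(2)]) (assumption, rule that)
  then show ?thesis using that unfolding codes_def eq by blast
qed

lemma codes_ex': "X \<in> Sets \<Longrightarrow> \<exists>s. codes s X l"
  using code_bound_ex codes_ex by metis

lemma codes_bound:
  assumes "bsq s" "haslen s l" "code_bound (pr l \<one>) B"
  shows "s \<prec> B"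
  using codes_ex[OF elm_one_Sets assms(3)] bsq_codes[OF assms(1,2)] codes_unique by metis

text \<open>Truncating the triple that codes \<open>s\<close> in its first component gives a triple coding the
  initial segment, because \<open>pr i \<zero>\<close> bounds exactly the pairs with first component below \<open>i\<close>.\<close>

lemma codes_truncate_le:
  assumes s: "codes s X l" and r: "codes r X i" and "i \<preceq> l"
  shows "r \<preceq> s"
proof -
  obtain k m n where kmn: "s = pr k (pr m n)"
    using s unfolding codes_def setc_def triple_def by blast
  define k' where "k' = (if k \<preceq> pr i \<zero> then k else pr i \<zero>)"
  have k': "p \<prec> k' \<longleftrightarrow> p \<prec> k \<and> p \<prec> pr i \<zero>" for p
  proof (cases "k \<preceq> pr i \<zero>")
    case True
    then show ?thesis using order.less_le_trans[of p k "pr i \<zero>"] by (auto simp: k'_def)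
  next
    case False
    then have "pr i \<zero> \<prec> k" by (simp add: order.not_le)
    then show ?thesis using False order.less_trans[of p "pr i \<zero>" k] by (auto simp: k'_def)
  qed
  have "pr j (charf X j) \<prec> pr i \<zero> \<longleftrightarrow> j \<prec> i" for j
  proof
    assume "pr j (charf X j) \<prec> pr i \<zero>"
    then have "\<not> i \<preceq> j" using pr_mono[of i j \<zero> "charf X j"] order.not_less by auto
    then show "j \<prec> i" by (simp add: order.not_le)
  qed (simp add: pr_less_zero)
  then have "elm p (pr k' (pr m n)) \<longleftrightarrow> elm p r" for p
    using s r \<open>i \<preceq> l\<close> order.less_le_trans
    unfolding codes_def kmn elm_triple k' by metis
  moreover have "triple (pr k' (pr m n))" by (auto simp: triple_def)
  ultimately have "\<not> pr k' (pr m n) \<prec> r" using r unfolding codes_def setc_def by blast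
  then have "r \<preceq> pr k' (pr m n)" by (simp add: order.not_less)
  also have "pr k' (pr m n) \<preceq> s" unfolding kmn by (intro pr_mono) (auto simp: k'_def)
  finally show ?thesis .
qed

subsection \<open>The meaning of the sentences in a model\<close>

primrec nu :: "nat \<Rightarrow> 'a" where
  "nu 0 = \<zero>"
| "nu (Suc n) = nu n \<oplus> \<one>"

lemma nu_mono: "m \<le> n \<Longrightarrow> nu m \<preceq> nu n"
  by (induction rule: dec_induct) (auto intro: order.order_trans)

lemma nu_pos: "n > 0 \<Longrightarrow> nu n \<noteq> \<zero>"
  by (cases n) auto

lemma tval_numeral_trm [simp]: "tval e (numeral_trm n) = nu n"
  by (induction n) auto

definition fin :: "'a set \<Rightarrow> bool" where
  "fin X \<longleftrightarrow> (\<exists>b. \<forall>x. x \<in> X \<longrightarrow> x \<prec> b)"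

definition fun_on :: "('a \<Rightarrow> bool) \<Rightarrow> 'a \<Rightarrow> 'a set \<Rightarrow> bool" where
  "fun_on D k F \<longleftrightarrow> (\<forall>p. p \<in> F \<longrightarrow> (\<exists>x c. p = pr x c \<and> D x \<and> c \<prec> k)) \<and>
     (\<forall>x. D x \<longrightarrow> (\<exists>c. pr x c \<in> F \<and> (\<forall>d. pr x d \<in> F \<longrightarrow> d = c)))"

definition btree :: "'a set \<Rightarrow> bool" where
  "btree T \<longleftrightarrow> (\<forall>s. s \<in> T \<longrightarrow> bsq s \<and> (\<forall>t. sq t \<and> initseg t s \<longrightarrow> t \<in> T))"

definition path :: "'a set \<Rightarrow> 'a set \<Rightarrow> bool" where
  "path T F \<longleftrightarrow> fun_on (\<lambda>x. True) (nu 2) F \<and>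
     (\<forall>l. \<exists>s. s \<in> T \<and> haslen s l \<and> (\<forall>i j. elm (pr i j) s \<longrightarrow> pr i j \<in> F))"

definition graph :: "'a set \<Rightarrow> 'a set \<Rightarrow> bool" where
  "graph V E \<longleftrightarrow> (\<forall>p. p \<in> E \<longrightarrow> (\<exists>x y. p = pr x y \<and> x \<in> V \<and> y \<in> V \<and> x \<prec> y))"

definition adj :: "'a set \<Rightarrow> 'a \<Rightarrow> 'a \<Rightarrow> bool" where
  "adj E x y \<longleftrightarrow> x \<prec> y \<and> pr x y \<in> E \<or> y \<prec> x \<and> pr y x \<in> E"

definition col :: "'a set \<Rightarrow> 'a set \<Rightarrow> 'a \<Rightarrow> 'a set \<Rightarrow> bool" where
  "col V E k C \<longleftrightarrow> fun_on (\<lambda>x. x \<in> V) k C \<and>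
     (\<forall>x y. adj E x y \<longrightarrow> (\<forall>c d. pr x c \<in> C \<and> pr y d \<in> C \<longrightarrow> c \<noteq> d))"

definition loc_chromatic :: "'a set \<Rightarrow> 'a set \<Rightarrow> 'a \<Rightarrow> bool" where
  "loc_chromatic V E k \<longleftrightarrow> (\<forall>V'\<in>Sets. \<forall>E'\<in>Sets. graph V' E' \<and> V' \<subseteq> V \<and> E' \<subseteq> E \<and> fin V' \<longrightarrow>
     (\<exists>C\<in>Sets. col V' E' k C))"

lemmas coding_defs = binary_tree_def binary_seq_def seq_def set_code_def is_triple_def
  has_length_def initial_segment_def elem_def divides_def pair_def finite_set_def function_on_def
  is_path_def is_graph_def adjacent_def coloring_def chromatic_def subgraph_def
  locally_chromatic_def sentence_def form_defs

text \<open>The HOL predicates copy the syntactic definitions clause by clause, so that unfolding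
  both lists reduces the satisfaction lemmas below to simplification.\<close>

lemmas meaning_defs = btree_def bsq_def sq_def setc_def triple_def haslen_def initseg_def elm_def
  dv_def pr_def path_def fun_on_def fin_def graph_def adj_def col_def loc_chromatic_def

lemma sat_WKL: "sat e S (sentence WKL) \<longleftrightarrow>
  (\<forall>T\<in>Sets. btree T \<and> \<not> fin T \<longrightarrow> (\<exists>F\<in>Sets. path T F))"
  unfolding WKL_def coding_defs meaning_defs
  by (simp del: nu.simps not_less_zero add_eq_zero)

lemma sat_chromatic: "sat e S (sentence (\<^bold>\<forall>\<^sub>SV. \<^bold>\<forall>\<^sub>SE.
    is_graph V E \<^bold>\<and> locally_chromatic V E (numterm k) \<^bold>\<longrightarrow> chromatic V E (numterm l))) \<longleftrightarrow>
  (\<forall>V\<in>Sets. \<forall>E\<in>Sets. graph V E \<and> loc_chromatic V E (nu k) \<longrightarrow> (\<exists>C\<in>Sets. col V E (nu l) C))"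
  unfolding coding_defs meaning_defs subset_iff
  by (simp del: nu.simps not_less_zero add_eq_zero)

subsection \<open>Weak Koenig's lemma yields colorings\<close>

text \<open>A set \<open>X\<close> of pairs (vertex, color) may give a vertex several colors; the coloring read off
  from it will use the least one.\<close>

definition col_approx :: "'a set \<Rightarrow> 'a set \<Rightarrow> 'a \<Rightarrow> 'a set \<Rightarrow> 'a \<Rightarrow> bool" where
  "col_approx V E k X l \<longleftrightarrow>
    (\<forall>x\<in>V. (\<forall>c. c \<prec> k \<longrightarrow> pr x c \<prec> l) \<longrightarrow> (\<exists>c. c \<prec> k \<and> pr x c \<in> X)) \<and>
    (\<forall>x y c. pr x y \<in> E \<and> c \<prec> k \<and> pr x c \<prec> l \<and> pr y c \<prec> l \<longrightarrow> \<not> (pr x c \<in> X \<and> pr y c \<in> X))"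

text \<open>This is \<open>col_approx\<close> read off the code \<open>s\<close>, with bounds that
  allow comprehension. A vertex must have a color only once all its positions \<open>pr x c\<close>
  lie below the length, which keeps the condition closed under initial segments.\<close>

definition col_tree :: "'a set \<Rightarrow> 'a set \<Rightarrow> 'a \<Rightarrow> 'a set" where
  "col_tree V E k = {s. bsq s \<and>
    (\<forall>x. x \<prec> s \<longrightarrow> x \<in> V \<longrightarrow> (\<forall>c. c \<prec> k \<longrightarrow> (\<exists>b. b \<prec> s \<and> elm (pr (pr x c) b) s)) \<longrightarrow>
      (\<exists>c. c \<prec> k \<and> elm (pr (pr x c) \<one>) s)) \<and>
    (\<forall>x. x \<prec> s \<longrightarrow> (\<forall>y. y \<prec> s \<longrightarrow> (\<forall>c. c \<prec> k \<longrightarrow> pr x y \<in> E \<longrightarrow>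
      \<not> (elm (pr (pr x c) \<one>) s \<and> elm (pr (pr y c) \<one>) s))))}"

lemma col_tree_Sets: "V \<in> Sets \<Longrightarrow> E \<in> Sets \<Longrightarrow> col_tree V E k \<in> Sets"
  unfolding col_tree_def by (intro D0_comprehension D0_intros D0_bsq D0_elm Tm_pr)

lemma col_approx_mono:
  assumes "col_approx V E k X l" "m \<preceq> l" "\<And>i. i \<prec> m \<Longrightarrow> i \<in> Z \<longleftrightarrow> i \<in> X"
  shows "col_approx V E k Z m"
  using assms order.less_le_trans[OF _ assms(2)] unfolding col_approx_def by blast

lemma pr_less_left: "c \<prec> k \<Longrightarrow> pr x c \<prec> pr x k"
  by (rule pr_less_aux) simp

lemma codes_col_tree:
  assumes s: "codes s X l" and k: "k \<noteq> \<zero>"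
  shows "s \<in> col_tree V E k \<longleftrightarrow> col_approx V E k X l"
proof -
  have "haslen s l" using s by (simp add: codes_haslen)
  have s_elm: "elm (pr i b) s \<longleftrightarrow> i \<prec> l \<and> b = charf X i" for i b using s by (rule codes_elm)
  \<comment> \<open>With \<open>k\<close> nonzero, the positions of a vertex include
    \<open>pr x \<zero>\<close>, and this bounds the vertices that matter by
    \<open>s\<close>.\<close>
  have pos: "\<zero> \<prec> k" using k zero_le le_def by metis
  have below: "i \<prec> l \<Longrightarrow> i \<prec> s" for i
    using haslen_le[OF \<open>haslen s l\<close>] order.less_le_trans by blast
  then have below': "pr x c \<prec> l \<Longrightarrow> x \<prec> s" for x c using pr_bound by blast
  have dom: "(\<exists>b. b \<prec> s \<and> elm (pr i b) s) \<longleftrightarrow> i \<prec> l" for i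
    using elm_pr_less(2) s_elm by blast
  have one: "elm (pr i \<one>) s \<longleftrightarrow> i \<prec> l \<and> i \<in> X" for i by (simp add: s_elm)
  have "bsq s" using s by (rule codes_bsq)
  then show ?thesis
    unfolding col_tree_def col_approx_def mem_Collect_eq dom one
    using below' pos by blast
qed

lemma btree_col_tree:
  assumes k: "k \<noteq> \<zero>"
  shows "btree (col_tree V E k)"
  unfolding btree_def
proof (intro allI impI conjI)
  fix s assume s: "s \<in> col_tree V E k"
  then show bs: "bsq s" by (simp add: col_tree_def)
  fix t assume t: "sq t \<and> initseg t s"
  then have bt: "bsq t" using bs unfolding bsq_def initseg_def by blast
  obtain X l Z m where X: "codes s X l" and Z: "codes t Z m"
    using bsq_codes_ex[OF bs] bsq_codes_ex[OF bt] by blast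
  have "m \<preceq> l \<and> (\<forall>i. i \<prec> m \<longrightarrow> (i \<in> Z \<longleftrightarrow> i \<in> X))"
    using t codes_initseg[OF X Z] by blast
  then show "t \<in> col_tree V E k"
    using s col_approx_mono unfolding codes_col_tree[OF X k] codes_col_tree[OF Z k] by blast
qed

text \<open>A sequence of length \<open>b\<close> has a code of at least \<open>b\<close>. If
  \<open>b\<close> bounded the tree, a coloring of the subgraph on the vertices below
  \<open>b\<close>, written as a sequence of length \<open>b\<close>, would be a node beyond the
  bound.\<close>

lemma col_tree_infinite:
  assumes VE: "V \<in> Sets" "E \<in> Sets" "graph V E" and loc: "loc_chromatic V E k" and k: "k \<noteq> \<zero>"
  shows "\<not> fin (col_tree V E k)"
proof
  assume "fin (col_tree V E k)"
  then obtain b where b: "\<And>s. s \<in> col_tree V E k \<Longrightarrow> s \<prec> b" unfolding fin_def by blast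
  let ?V = "{x. x \<in> V \<and> x \<prec> b}"
  let ?E = "{p. p \<in> E \<and> (\<exists>x. x \<prec> b \<and> (\<exists>y. y \<prec> b \<and> p = pr x y))}"
  have "?V \<in> Sets" by (intro D0_comprehension D0_intros VE)
  moreover have "?E \<in> Sets" by (intro D0_comprehension D0_intros Tm_pr VE)
  moreover have "graph ?V ?E" using VE(3) unfolding graph_def by fastforce
  moreover have "fin ?V" unfolding fin_def by blast
  ultimately obtain C where C: "C \<in> Sets" "col ?V ?E k C"
    using loc unfolding loc_chromatic_def by blast
  have C1: "pr x c \<in> C \<Longrightarrow> x \<in> V \<and> x \<prec> b \<and> c \<prec> k" for x c
    using C(2) unfolding col_def fun_on_def by (metis (no_types, lifting) mem_Collect_eq pr_inject)
  have C2: "x \<in> V \<Longrightarrow> x \<prec> b \<Longrightarrow> \<exists>c. pr x c \<in> C" for x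
    using C(2) unfolding col_def fun_on_def by blast
  have C3: "pr x c \<in> C \<Longrightarrow> pr y c \<in> C \<Longrightarrow> pr x y \<notin> ?E" for x y c
  proof
    assume *: "pr x c \<in> C" "pr y c \<in> C" "pr x y \<in> ?E"
    then have "x \<prec> y" using VE(3) unfolding graph_def by fastforce
    then have "adj ?E x y" using *(3) unfolding adj_def by blast
    then show False using C(2) * unfolding col_def by blast
  qed
  obtain s where s: "codes s C b" using codes_ex'[OF C(1)] by blast
  have "col_approx V E k C b"
    unfolding col_approx_def
  proof (intro conjI ballI allI impI)
    fix x assume x: "x \<in> V" "\<forall>c. c \<prec> k \<longrightarrow> pr x c \<prec> b"
    have "\<zero> \<prec> k" using k zero_le le_def by metis
    then have "x \<prec> b" using x(2) pr_bound by blast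
    then show "\<exists>c. c \<prec> k \<and> pr x c \<in> C" using C1 C2 x(1) by blast
  next
    fix x y c assume *: "pr x y \<in> E \<and> c \<prec> k \<and> pr x c \<prec> b \<and> pr y c \<prec> b"
    then have "pr x y \<in> ?E" using pr_bound by blast
    then show "\<not> (pr x c \<in> C \<and> pr y c \<in> C)" using C3 by blast
  qed
  then have "s \<prec> b" using codes_col_tree[OF s k] b by blast
  moreover have "b \<preceq> s" using haslen_le codes_haslen[OF s] by blast
  ultimately show False using order.not_less by blast
qed

lemma WKL_coloring:
  assumes WKL: "\<And>T. T \<in> Sets \<Longrightarrow> btree T \<Longrightarrow> \<not> fin T \<Longrightarrow> \<exists>F\<in>Sets. path T F"
    and VE: "V \<in> Sets" "E \<in> Sets" "graph V E" and loc: "loc_chromatic V E k"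
    and k: "k \<noteq> \<zero>" "k \<preceq> k'"
  shows "\<exists>C\<in>Sets. col V E k' C"
proof -
  obtain F where F: "F \<in> Sets" "path (col_tree V E k) F"
    using WKL[OF col_tree_Sets btree_col_tree col_tree_infinite] VE loc k(1) by blast
  let ?X = "{i. pr i \<one> \<in> F}"
  have approx: "col_approx V E k ?X l" for l
  proof -
    obtain s where s: "s \<in> col_tree V E k" "haslen s l" "\<And>i j. elm (pr i j) s \<Longrightarrow> pr i j \<in> F"
      using F(2) unfolding path_def by blast
    obtain X where X: "codes s X l"
      using bsq_codes s(1,2) unfolding col_tree_def by blast
    have "i \<in> ?X \<longleftrightarrow> i \<in> X" if "i \<prec> l" for i
    proof -
      have *: "pr i (charf X i) \<in> F" using s(3) codes_elm[OF X] that by blast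
      then have "pr i \<one> \<in> F \<longleftrightarrow> charf X i = \<one>"
        using F(2) unfolding path_def fun_on_def by metis
      then show ?thesis by simp
    qed
    then show ?thesis using codes_col_tree[OF X k(1)] s(1) col_approx_mono by blast
  qed
  let ?c = "\<lambda>x c. x \<in> V \<and> c \<prec> k \<and> pr (pr x c) \<one> \<in> F \<and> (\<forall>d. d \<prec> c \<longrightarrow> pr (pr x d) \<one> \<notin> F)"
  let ?C = "{p. \<exists>x. x \<prec> p \<oplus> \<one> \<and> (\<exists>c. c \<prec> p \<oplus> \<one> \<and> p = pr x c \<and> ?c x c)}"
  have C: "pr x c \<in> ?C \<longleftrightarrow> ?c x c" for x c by (auto simp: less_suc_le)
  have "?C \<in> Sets" using VE(1) F(1) by (intro D0_comprehension D0_intros Tm_pr)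
  moreover have "col V E k' ?C"
    unfolding col_def
  proof (intro conjI allI impI)
    show "fun_on (\<lambda>x. x \<in> V) k' ?C"
      unfolding fun_on_def
    proof (intro conjI allI impI)
      fix p assume "p \<in> ?C"
      then show "\<exists>x c. p = pr x c \<and> x \<in> V \<and> c \<prec> k'"
        using k(2) order.less_le_trans by blast
    next
      fix x assume x: "x \<in> V"
      \<comment> \<open>Length \<open>pr x k\<close> exceeds all positions \<open>pr x c\<close>
        with \<open>c \<prec> k\<close>, so the approximation must already color
        \<open>x\<close>.\<close>
      then obtain c where "c \<prec> k" "pr (pr x c) \<one> \<in> F"
        using approx[of "pr x k"] pr_less_left unfolding col_approx_def by blast
      moreover have "D0 (\<lambda>e. pr (pr x (e 0)) \<one> \<in> F)" using F(1) by (intro D0_intros Tm_pr)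
      ultimately obtain d where "pr (pr x d) \<one> \<in> F" "d \<preceq> c"
        "\<And>z. z \<prec> d \<Longrightarrow> pr (pr x z) \<one> \<notin> F"
        using D0_least[of "\<lambda>c. pr (pr x c) \<one> \<in> F" c] by blast
      then have d: "?c x d" using x \<open>c \<prec> k\<close> order.le_less_trans by blast
      have "d' = d" if "?c x d'" for d' using that d less_linear by blast
      then show "\<exists>c. pr x c \<in> ?C \<and> (\<forall>d. pr x d \<in> ?C \<longrightarrow> d = c)"
        unfolding C using d by blast
    qed
  next
    fix x y c d assume *: "adj E x y" "pr x c \<in> ?C \<and> pr y d \<in> ?C"
    show "c \<noteq> d"
    proof
      assume "c = d"
      then have c: "c \<prec> k" "pr x c \<in> ?X" "pr y c \<in> ?X" using *(2) unfolding C by auto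
      have "pr x c \<prec> pr x c \<oplus> pr y c \<oplus> \<one>" "pr y c \<prec> pr x c \<oplus> pr y c \<oplus> \<one>"
        by (simp_all add: less_suc_le)
      then show False using approx[of "pr x c \<oplus> pr y c \<oplus> \<one>"] c *(1)
        unfolding col_approx_def adj_def by blast
    qed
  qed
  ultimately show ?thesis by blast
qed

end

section \<open>From colorings to separation\<close>

text \<open>Below a standard numeral even a nonstandard model has only standardly many elements, so
  pigeonhole arguments on colors can be carried out in HOL.\<close>

lemma (in rca) finite_below_nu: "finite {c. c \<prec> nu m} \<and> card {c. c \<prec> nu m} = m"
proof (induction m)
  case (Suc m)
  have "{c. c \<prec> nu (Suc m)} = insert (nu m) {c. c \<prec> nu m}" by (auto simp: less_suc)
  then show ?case using Suc by simp
qed simp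

lemma (in rca) finite_bounded: "finite A \<Longrightarrow> \<exists>B. \<forall>a\<in>A. a \<preceq> B"
proof (induction rule: finite_induct)
  case (insert a A)
  then obtain B where "\<forall>a\<in>A. a \<preceq> B" by blast
  then show ?case using order.order_trans[OF _ le_add1] by (intro exI[of _ "B \<oplus> a"]) auto
qed simp

text \<open>The vertices are \<open>pr \<zero> (pr i t)\<close> and \<open>pr \<one> (pr j n)\<close> for \<open>i, j < k\<close>. The former
  make up a complete \<open>k\<close>-partite graph with classes indexed by \<open>i\<close>, the latter a complete graph
  on \<open>k\<close> vertices for each \<open>n\<close>. Once \<open>\<theta>\<^sub>0\<close> (resp. \<open>\<theta>\<^sub>1\<close>) is witnessed at \<open>n\<close>, the \<open>j\<close>-th vertex
  of the \<open>n\<close>-th complete graph is joined to all later vertices outside class \<open>j\<close> (resp. outside class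
  \<open>j + 1\<close> modulo \<open>k\<close>).\<close>

locale separation = rca +
  fixes k :: nat and \<theta>0 \<theta>1 :: "'a \<Rightarrow> 'a \<Rightarrow> bool"
  assumes k: "k \<ge> 2"
    and \<theta>0: "D0 (\<lambda>e. \<theta>0 (e 0) (e (Suc 0)))" and \<theta>1: "D0 (\<lambda>e. \<theta>1 (e 0) (e (Suc 0)))"
    and disjoint: "\<theta>0 w n \<Longrightarrow> \<theta>1 w' n \<Longrightarrow> False"
begin

abbreviation K :: 'a where "K \<equiv> nu k"

text \<open>The cyclic shift, used as a permutation of the colors below \<open>K\<close> without
  fixed points. Injectivity keeps recolored complete graphs proper; the absence of fixed points,
  which needs \<open>k \<ge> 2\<close>, lets the two kinds of matching exclude each other.\<close>

definition rot :: "'a \<Rightarrow> 'a \<Rightarrow> bool" where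
  "rot j i \<longleftrightarrow> j \<oplus> \<one> = K \<and> i = \<zero> \<or> j \<oplus> \<one> \<noteq> K \<and> i = j \<oplus> \<one>"

text \<open>Witnesses are sought only below \<open>t\<close>, which makes the edge relation bounded.
  Only an initial part of each class is lost, and recurring colors reappear beyond it.\<close>

definition link :: "'a \<Rightarrow> 'a \<Rightarrow> 'a \<Rightarrow> 'a \<Rightarrow> 'a \<Rightarrow> 'a \<Rightarrow> bool" where
  "link a i t b j n \<longleftrightarrow> i \<prec> K \<and> j \<prec> K \<and> (a = \<zero> \<and> b = \<zero> \<and> i \<noteq> j \<or> a = \<one> \<and> b = \<one> \<and> t = n \<and> i \<noteq> j \<or>
    a = \<zero> \<and> b = \<one> \<and> ((\<exists>w. w \<prec> t \<and> \<theta>0 w n) \<and> i \<noteq> j \<or> (\<exists>w. w \<prec> t \<and> \<theta>1 w n) \<and> \<not> rot j i))"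

definition edge_code :: "'a \<Rightarrow> 'a \<Rightarrow> 'a \<Rightarrow> 'a \<Rightarrow> 'a \<Rightarrow> 'a \<Rightarrow> 'a \<Rightarrow> bool" where
  "edge_code p a i t b j n \<longleftrightarrow> link a i t b j n \<and>
    (pr a (pr i t) \<prec> pr b (pr j n) \<and> p = pr (pr a (pr i t)) (pr b (pr j n)) \<or>
     pr b (pr j n) \<prec> pr a (pr i t) \<and> p = pr (pr b (pr j n)) (pr a (pr i t)))"

definition edges :: "'a set" where
  "edges = {p. \<exists>a i t b j n. edge_code p a i t b j n}"

lemma edge_code_bounds:
  assumes "edge_code p a i t b j n"
  shows "a \<prec> p \<oplus> \<one> \<and> i \<prec> p \<oplus> \<one> \<and> t \<prec> p \<oplus> \<one> \<and> b \<prec> p \<oplus> \<one> \<and> j \<prec> p \<oplus> \<one> \<and> n \<prec> p \<oplus> \<one>"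
proof -
  have "pr a (pr i t) \<prec> p \<oplus> \<one>" "pr b (pr j n) \<prec> p \<oplus> \<one>"
    using assms by (auto simp: edge_code_def less_suc_le)
  then show ?thesis using pr_bound by metis
qed

lemma edges_Sets: "edges \<in> Sets"
proof -
  let ?E = "{p. \<exists>a. a \<prec> p \<oplus> \<one> \<and> (\<exists>i. i \<prec> p \<oplus> \<one> \<and> (\<exists>t. t \<prec> p \<oplus> \<one> \<and> (\<exists>b. b \<prec> p \<oplus> \<one> \<and>
    (\<exists>j. j \<prec> p \<oplus> \<one> \<and> (\<exists>n. n \<prec> p \<oplus> \<one> \<and> edge_code p a i t b j n)))))}"
  have "?E \<in> Sets"
    unfolding edge_code_def link_def rot_def
    by (intro D0_comprehension D0_intros Tm_pr D0_subst2[OF \<theta>0] D0_subst2[OF \<theta>1])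
  moreover have "edges = ?E"
    unfolding edges_def using edge_code_bounds by blast
  ultimately show ?thesis by simp
qed

lemma adj_edges:
  "adj edges x y \<longleftrightarrow> (\<exists>a i t b j n. link a i t b j n \<and>
    (x = pr a (pr i t) \<and> y = pr b (pr j n) \<or> y = pr a (pr i t) \<and> x = pr b (pr j n)))"
proof
  assume "adj edges x y"
  then show "\<exists>a i t b j n. link a i t b j n \<and>
    (x = pr a (pr i t) \<and> y = pr b (pr j n) \<or> y = pr a (pr i t) \<and> x = pr b (pr j n))"
    unfolding adj_def edges_def edge_code_def mem_Collect_eq pr_inject by blast
next
  assume "\<exists>a i t b j n. link a i t b j n \<and>
    (x = pr a (pr i t) \<and> y = pr b (pr j n) \<or> y = pr a (pr i t) \<and> x = pr b (pr j n))"
  then obtain a i t b j n where *: "link a i t b j n"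
    "x = pr a (pr i t) \<and> y = pr b (pr j n) \<or> y = pr a (pr i t) \<and> x = pr b (pr j n)" by blast
  have "pr a (pr i t) \<noteq> pr b (pr j n)"
    using *(1) by (auto simp: link_def zero_neq_one)
  then consider "pr a (pr i t) \<prec> pr b (pr j n)" | "pr b (pr j n) \<prec> pr a (pr i t)"
    using less_linear by blast
  then have "x \<prec> y \<and> pr x y \<in> edges \<or> y \<prec> x \<and> pr y x \<in> edges"
    using * unfolding edges_def edge_code_def mem_Collect_eq by cases blast+
  then show "adj edges x y" unfolding adj_def .
qed

lemma rot_unique: "rot j c \<Longrightarrow> rot j d \<Longrightarrow> c = d"
  by (auto simp: rot_def)

lemma rot_inject: "rot i c \<Longrightarrow> rot j c \<Longrightarrow> i = j"
  unfolding rot_def by (metis suc_inject suc_neq_zero)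

lemma K_pos: "\<zero> \<prec> K"
  using k by (cases k) auto

lemma rot_ex: "j \<prec> K \<Longrightarrow> \<exists>c. c \<prec> K \<and> rot j c"
proof -
  assume "j \<prec> K"
  then have "j \<oplus> \<one> \<preceq> K" by (simp add: suc_le_iff)
  then show ?thesis
    by (cases "j \<oplus> \<one> = K") (auto simp: rot_def le_def K_pos)
qed

lemma not_rot_self: "\<not> rot j j"
proof -
  obtain m where "k = Suc (Suc m)" using k by (metis add_2_eq_Suc le_Suc_ex)
  then have "\<zero> \<oplus> \<one> \<noteq> K" by (simp only: nu.simps suc_inject) simp
  moreover have "j \<noteq> j \<oplus> \<one>" using less_suc_self[of j] order.less_irrefl by metis
  ultimately show ?thesis unfolding rot_def by metis
qed

text \<open>Class \<open>i\<close> gets color \<open>i\<close>. A complete graph is shifted if a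
  witness of \<open>\<theta>1\<close> is visible below \<open>b\<close>; otherwise it keeps the
  identity coloring, which suits the edges caused by \<open>\<theta>0\<close>. All other numbers are
  isolated vertices.\<close>

definition finite_color :: "'a \<Rightarrow> 'a \<Rightarrow> 'a \<Rightarrow> bool" where
  "finite_color b u c \<longleftrightarrow>
    (\<exists>i. i \<prec> u \<oplus> \<one> \<and> (\<exists>t. t \<prec> u \<oplus> \<one> \<and> u = pr \<zero> (pr i t) \<and> i \<prec> K \<and> c = i)) \<or>
    (\<exists>j. j \<prec> u \<oplus> \<one> \<and> (\<exists>n. n \<prec> u \<oplus> \<one> \<and> u = pr \<one> (pr j n) \<and> j \<prec> K \<and>
      ((\<exists>w. w \<prec> b \<and> \<theta>1 w n) \<and> rot j c \<or> \<not> (\<exists>w. w \<prec> b \<and> \<theta>1 w n) \<and> c = j))) \<or>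
    \<not> (\<exists>i. i \<prec> u \<oplus> \<one> \<and> (\<exists>t. t \<prec> u \<oplus> \<one> \<and> u = pr \<zero> (pr i t) \<and> i \<prec> K)) \<and>
    \<not> (\<exists>i. i \<prec> u \<oplus> \<one> \<and> (\<exists>t. t \<prec> u \<oplus> \<one> \<and> u = pr \<one> (pr i t) \<and> i \<prec> K)) \<and> c = \<zero>"

lemma finite_color_v: "i \<prec> K \<Longrightarrow> finite_color b (pr \<zero> (pr i t)) c \<longleftrightarrow> c = i"
  unfolding finite_color_def less_suc_le using triple_bounds[where k = \<zero>]
  by (auto simp: zero_neq_one)

lemma finite_color_x: "j \<prec> K \<Longrightarrow> finite_color b (pr \<one> (pr j n)) c \<longleftrightarrow>
  (\<exists>w. w \<prec> b \<and> \<theta>1 w n) \<and> rot j c \<or> \<not> (\<exists>w. w \<prec> b \<and> \<theta>1 w n) \<and> c = j"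
  unfolding finite_color_def less_suc_le using triple_bounds[where k = \<one>]
  by (auto simp: zero_neq_one)

lemma finite_color_ex1: "\<exists>c. c \<prec> K \<and> finite_color b u c \<and> (\<forall>d. finite_color b u d \<longrightarrow> d = c)"
proof -
  consider i t where "u = pr \<zero> (pr i t)" "i \<prec> K" | j n where "u = pr \<one> (pr j n)" "j \<prec> K"
    | "finite_color b u = (\<lambda>c. c = \<zero>)"
    unfolding finite_color_def by blast
  then show ?thesis
  proof cases
    case 2
    show ?thesis
    proof (cases "\<exists>w. w \<prec> b \<and> \<theta>1 w n")
      case True
      obtain c where "c \<prec> K" "rot j c" using rot_ex[OF 2(2)] by blast
      then show ?thesis unfolding 2(1) finite_color_x[OF 2(2)] using True rot_unique by blast
    next
      case False
      then show ?thesis unfolding 2(1) finite_color_x[OF 2(2)] using 2(2) by blast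
    qed
  qed (use finite_color_v K_pos in auto)
qed

text \<open>For \<open>t \<prec> b\<close> a witness of \<open>\<theta>1\<close> responsible for an
  edge lies below \<open>b\<close>, so the shift has been made; a witness of
  \<open>\<theta>0\<close> excludes the shift by disjointness.\<close>

lemma finite_color_proper:
  assumes link: "link a i t b' j n" and t: "t \<prec> b"
    and c: "finite_color b (pr a (pr i t)) c" "finite_color b (pr b' (pr j n)) d"
  shows "c \<noteq> d"
proof -
  have ij: "i \<prec> K" "j \<prec> K" using link by (auto simp: link_def)
  consider (vv) "a = \<zero>" "b' = \<zero>" "i \<noteq> j" | (xx) "a = \<one>" "b' = \<one>" "t = n" "i \<noteq> j"
    | (0) w where "a = \<zero>" "b' = \<one>" "\<theta>0 w n" "i \<noteq> j"
    | (1) w where "a = \<zero>" "b' = \<one>" "w \<prec> t" "\<theta>1 w n" "\<not> rot j i"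
    using link unfolding link_def by blast
  then show ?thesis
  proof cases
    case vv
    then show ?thesis using c ij by (simp add: finite_color_v)
  next
    case xx
    then show ?thesis using c ij rot_inject by (auto simp: finite_color_x)
  next
    case 0
    then have "d = j" using c(2) ij disjoint by (auto simp: finite_color_x)
    then show ?thesis using 0 c(1) ij by (simp add: finite_color_v)
  next
    case 1
    then have "w \<prec> b" using t order.less_trans by blast
    then have "rot j d" using 1 c(2) ij by (auto simp: finite_color_x)
    then show ?thesis using 1 c(1) ij by (auto simp: finite_color_v)
  qed
qed

lemma loc_chromatic_edges: "loc_chromatic UNIV edges K"
  unfolding loc_chromatic_def
proof (intro ballI impI)
  fix V' E' assume S: "V' \<in> Sets" "E' \<in> Sets"
    and H: "graph V' E' \<and> V' \<subseteq> UNIV \<and> E' \<subseteq> edges \<and> fin V'"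
  obtain b where b: "\<And>x. x \<in> V' \<Longrightarrow> x \<prec> b" using H unfolding fin_def by blast
  let ?C = "{p. \<exists>u. u \<prec> p \<oplus> \<one> \<and> (\<exists>c. c \<prec> p \<oplus> \<one> \<and> p = pr u c \<and> u \<in> V' \<and> finite_color b u c)}"
  have C: "pr u c \<in> ?C \<longleftrightarrow> u \<in> V' \<and> finite_color b u c" for u c
    by (auto simp: less_suc_le)
  have "?C \<in> Sets"
    unfolding finite_color_def rot_def
    by (intro D0_comprehension D0_intros Tm_pr S D0_subst2[OF \<theta>1])
  moreover have "col V' E' K ?C"
    unfolding col_def
  proof (intro conjI allI impI)
    show "fun_on (\<lambda>x. x \<in> V') K ?C"
      unfolding fun_on_def C
    proof (intro conjI allI impI)
      show "\<exists>x c. p = pr x c \<and> x \<in> V' \<and> c \<prec> K" if "p \<in> ?C" for p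
        using that finite_color_ex1 by blast
      show "\<exists>c. (x \<in> V' \<and> finite_color b x c) \<and> (\<forall>d. x \<in> V' \<and> finite_color b x d \<longrightarrow> d = c)"
        if "x \<in> V'" for x
        using that finite_color_ex1 by blast
    qed
  next
    fix x y c d assume xy: "adj E' x y" and "pr x c \<in> ?C \<and> pr y d \<in> ?C"
    then have cd: "finite_color b x c" "finite_color b y d" "x \<in> V'" "y \<in> V'" unfolding C by auto
    have "adj edges x y" using xy H unfolding adj_def by blast
    then obtain a i t b' j n where l: "link a i t b' j n"
      and eq: "x = pr a (pr i t) \<and> y = pr b' (pr j n) \<or> y = pr a (pr i t) \<and> x = pr b' (pr j n)"
      unfolding adj_edges by blast
    then have "pr a (pr i t) \<prec> b" using cd b by blast
    then have "t \<prec> b" using pr_bound by blast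
    then show "c \<noteq> d" using finite_color_proper[OF l \<open>t \<prec> b\<close>] eq cd by metis
  qed
  ultimately show "\<exists>C\<in>Sets. col V' E' K C" by blast
qed

text \<open>Among the \<open>2 k - 1\<close> colors, \<open>k\<close> different ones recur cofinally on the classes of the
  \<open>k\<close>-partite graph, so that each complete graph contains one of them. A vertex joined to
  all late vertices of a class cannot have the color recurring there.\<close>

theorem separating_set:
  assumes coloring: "\<And>V E. V \<in> Sets \<Longrightarrow> E \<in> Sets \<Longrightarrow> graph V E \<Longrightarrow> loc_chromatic V E K \<Longrightarrow>
    \<exists>C\<in>Sets. col V E (nu (2 * k - 1)) C"
  obtains Z where "Z \<in> Sets" "\<And>w n. \<theta>0 w n \<Longrightarrow> n \<in> Z" "\<And>w n. \<theta>1 w n \<Longrightarrow> n \<notin> Z"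
proof -
  have "UNIV \<in> Sets" using D0_comprehension[OF D0_True] by simp
  moreover have "graph UNIV edges" unfolding graph_def edges_def edge_code_def by auto
  ultimately obtain C where C: "C \<in> Sets" "col UNIV edges (nu (2 * k - 1)) C"
    using coloring edges_Sets loc_chromatic_edges by blast
  have "\<forall>u. \<exists>c. pr u c \<in> C \<and> (\<forall>d. pr u d \<in> C \<longrightarrow> d = c)"
    using C(2) unfolding col_def fun_on_def by blast
  then obtain f where f: "\<And>u. pr u (f u) \<in> C" "\<And>u d. pr u d \<in> C \<Longrightarrow> d = f u" by metis
  have f_less: "f u \<prec> nu (2 * k - 1)" for u
    using C(2) f(1)[of u] unfolding col_def fun_on_def by (metis pr_inject)
  have f_link: "f (pr a (pr i t)) \<noteq> f (pr b (pr j n))" if "link a i t b j n" for a i t b j n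
  proof -
    have "adj edges (pr a (pr i t)) (pr b (pr j n))" unfolding adj_edges using that by blast
    then show ?thesis using C(2) f(1) unfolding col_def by blast
  qed
  define I where "I = {i. i \<prec> K}"
  have I: "finite I" "card I = k" using finite_below_nu[of k] unfolding I_def by auto
  \<comment> \<open>Otherwise each color \<open>c\<close> is absent from the class after some
    \<open>s c\<close>. The colors are finitely many in HOL, so a common bound \<open>B\<close>
    exists, and no color is left for position \<open>B \<oplus> \<one>\<close>.\<close>
  have "\<exists>c. \<forall>s. \<exists>t. s \<prec> t \<and> f (pr \<zero> (pr i t)) = c" for i
  proof (rule ccontr)
    assume "\<not> ?thesis"
    then obtain s where s: "\<And>c t. s c \<prec> t \<Longrightarrow> f (pr \<zero> (pr i t)) \<noteq> c" by metis
    obtain B where B: "\<forall>a\<in>s ` {c. c \<prec> nu (2 * k - 1)}. a \<preceq> B"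
      using finite_bounded finite_below_nu by blast
    have "s (f (pr \<zero> (pr i (B \<oplus> \<one>)))) \<preceq> B" using B f_less by blast
    then show False using s less_suc_le by blast
  qed
  then obtain r where r: "\<And>i s. \<exists>t. s \<prec> t \<and> f (pr \<zero> (pr i t)) = r i" by metis
  have r_inj: "inj_on r I"
  proof (rule inj_onI, rule ccontr)
    fix i j assume ij: "i \<in> I" "j \<in> I" "r i = r j" "i \<noteq> j"
    obtain t t' where "f (pr \<zero> (pr i t)) = r i" "f (pr \<zero> (pr j t')) = r j" using r by blast
    moreover have "link \<zero> i t \<zero> j t'" using ij by (simp add: link_def I_def)
    ultimately show False using f_link ij(3) by metis
  qed
  have hit: "\<exists>i\<in>I. \<exists>j\<in>I. f (pr \<one> (pr j n)) = r i" for n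
  proof (rule ccontr)
    assume no: "\<not> ?thesis"
    let ?x = "\<lambda>j. f (pr \<one> (pr j n))"
    have x_inj: "inj_on ?x I"
    proof (rule inj_onI, rule ccontr)
      fix i j assume ij: "i \<in> I" "j \<in> I" "?x i = ?x j" "i \<noteq> j"
      then have "link \<one> i n \<one> j n" by (simp add: link_def I_def)
      then show False using f_link ij(3) by blast
    qed
    \<comment> \<open>The two families of \<open>k\<close> colors would be disjoint, giving one
      color more than the \<open>2 * k - 1\<close> available.\<close>
    have "card (r ` I \<union> ?x ` I) = k + k"
    proof -
      have "r ` I \<inter> ?x ` I = {}" using no by force
      then show ?thesis using I by (simp add: card_Un_disjoint card_image r_inj x_inj)
    qed
    moreover have "r i \<prec> nu (2 * k - 1)" for i using r f_less by metis
    then have "r ` I \<union> ?x ` I \<subseteq> {c. c \<prec> nu (2 * k - 1)}" using f_less by blast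
    then have "card (r ` I \<union> ?x ` I) \<le> 2 * k - 1"
      using finite_below_nu[of "2 * k - 1"] card_mono by metis
    ultimately show False using k by linarith
  qed
  \<comment> \<open>The choice function \<open>r\<close> need not be definable in the model: the
    disjunction over \<open>I\<close> is unrolled, and the \<open>k\<close> values
    \<open>r j\<close> are parameters.\<close>
  let ?Z = "{n. \<exists>j\<in>I. pr (pr \<one> (pr j n)) (r j) \<in> C}"
  have Z: "n \<in> ?Z \<longleftrightarrow> (\<exists>j\<in>I. f (pr \<one> (pr j n)) = r j)" for n
  proof -
    have "pr u c \<in> C \<longleftrightarrow> f u = c" for u c using f by blast
    then show ?thesis by simp
  qed
  show ?thesis
  proof (rule that)
    show "?Z \<in> Sets" by (intro D0_comprehension D0_finite_disj I D0_intros Tm_pr C)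
    show "n \<in> ?Z" if w: "\<theta>0 w n" for w n
    proof -
      obtain i j where ij: "i \<in> I" "j \<in> I" "f (pr \<one> (pr j n)) = r i" using hit by blast
      \<comment> \<open>The recurring color of class \<open>i\<close> is met again after the witness
        \<open>w\<close>, where vertex \<open>j\<close> is already joined to every class other than
        its own.\<close>
      obtain t where t: "w \<prec> t" "f (pr \<zero> (pr i t)) = r i" using r by blast
      have "i = j"
      proof (rule ccontr)
        assume "i \<noteq> j"
        then have "link \<zero> i t \<one> j n" using ij t w unfolding link_def I_def by blast
        then show False using f_link ij t by metis
      qed
      then show ?thesis unfolding Z using ij by blast
    qed
    show "n \<notin> ?Z" if w: "\<theta>1 w n" for w n
    proof
      assume "n \<in> ?Z"
      then obtain j where j: "j \<in> I" "f (pr \<one> (pr j n)) = r j" unfolding Z by blast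
      obtain t where t: "w \<prec> t" "f (pr \<zero> (pr j t)) = r j" using r by blast
      have "link \<zero> j t \<one> j n" using j t w not_rot_self unfolding link_def I_def by blast
      then show False using f_link j t by metis
    qed
  qed
qed

end

section \<open>From separation to weak Koenig's lemma\<close>

lemma (in rca) codes_cong: "codes s X l \<Longrightarrow> (\<And>i. i \<prec> l \<Longrightarrow> i \<in> X \<longleftrightarrow> i \<in> Z) \<Longrightarrow> codes s Z l"
proof -
  assume s: "codes s X l" and eq: "\<And>i. i \<prec> l \<Longrightarrow> i \<in> X \<longleftrightarrow> i \<in> Z"
  have "charf X i = charf Z i" if "i \<prec> l" for i using eq[OF that] by (simp add: charf_def)
  then show "codes s Z l" using s unfolding codes_def by metis
qed

lemma (in rca) code_bound_mono: "code_bound K B \<Longrightarrow> L \<preceq> K \<Longrightarrow> code_bound L B"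
proof -
  assume "code_bound K B" and L: "L \<preceq> K"
  then obtain M P where MP: "M \<prec> B" "M \<noteq> \<zero>" "P \<prec> B" "P \<noteq> \<zero>" "\<forall>i. i \<prec> K \<longrightarrow> dv (i \<oplus> \<one>) M"
    "\<forall>i. i \<prec> K \<longrightarrow> dv (M \<otimes> (i \<oplus> \<one>) \<oplus> \<one>) P" "pr K (pr M P) \<prec> B"
    unfolding code_bound_def by blast
  have "pr L (pr M P) \<preceq> pr K (pr M P)" using L by (intro pr_mono) auto
  then have "pr L (pr M P) \<prec> B" using MP(7) order.le_less_trans by blast
  moreover have "i \<prec> L \<Longrightarrow> i \<prec> K" for i using L order.less_le_trans by blast
  ultimately show ?thesis using MP unfolding code_bound_def by blast
qed

locale infinite_tree = rca +
  fixes T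
  assumes T: "T \<in> Sets" "btree T" "\<not> fin T"
begin

section \<open>Levels of the tree and the subtrees of a node\<close>

lemma T_codes: "t \<in> T \<Longrightarrow> haslen t l \<Longrightarrow> \<exists>X\<in>Sets. codes t X l"
  using T(2) bsq_codes elm_one_Sets unfolding btree_def by blast

lemma T_truncate:
  assumes "t \<in> T" "codes t X l" "codes s X m" "m \<preceq> l"
  shows "s \<in> T"
proof -
  have "initseg s t" using codes_initseg[OF assms(2,3)] assms(4) by blast
  moreover have "sq s" using codes_bsq[OF assms(3)] by (simp add: bsq_def)
  ultimately show ?thesis using T(2) assms(1) unfolding btree_def by blast
qed

text \<open>Infinity of the tree only says that codes are unbounded. Without a node of length
  \<open>l\<close> all nodes would be shorter, and a single \<open>B\<close> would bound their
  codes.\<close>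

lemma T_length_ex: "\<exists>t\<in>T. haslen t l"
proof (rule ccontr)
  assume no: "\<not> ?thesis"
  obtain B where B: "code_bound (pr l \<one>) B" using code_bound_ex by blast
  have "s \<prec> B" if s: "s \<in> T" for s
  proof -
    have "bsq s" using s T(2) unfolding btree_def by blast
    then obtain m where m: "haslen s m" unfolding bsq_def sq_def by blast
    then obtain X where X: "X \<in> Sets" "codes s X m" using T_codes s by blast
    have "\<not> l \<preceq> m"
    proof
      assume "l \<preceq> m"
      obtain t where "codes t X l" using codes_ex' X(1) by blast
      then show False using no T_truncate[OF s X(2) _ \<open>l \<preceq> m\<close>] codes_haslen by blast
    qed
    then have "m \<preceq> l" using order.linear by blast
    then have "pr m \<one> \<preceq> pr l \<one>" by (intro pr_mono) auto
    then show "s \<prec> B" using codes_bound[OF \<open>bsq s\<close> m] code_bound_mono[OF B] by blast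
  qed
  then show False using T(3) unfolding fin_def by blast
qed

text \<open>The child \<open>j\<close> of \<open>s\<close> has a descendant at level
  \<open>b\<close>; reading the entry at position \<open>l\<close> of the descendant avoids forming
  the code of the child.\<close>

definition ext :: "'a \<Rightarrow> 'a \<Rightarrow> 'a \<Rightarrow> bool" where
  "ext j s b \<longleftrightarrow> (\<exists>t\<in>T. haslen t b \<and> initseg s t \<and> (\<exists>l. haslen s l \<and> elm (pr l j) t))"

definition ext_below :: "'a \<Rightarrow> 'a \<Rightarrow> 'a \<Rightarrow> 'a \<Rightarrow> bool" where
  "ext_below j s b u \<longleftrightarrow> (\<exists>t. t \<prec> u \<and> t \<in> T \<and> haslen t b \<and> initseg s t \<and>
    (\<exists>l. l \<prec> s \<oplus> \<one> \<and> haslen s l \<and> elm (pr l j) t))"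

lemma ext_below: "code_bound (pr b \<one>) u \<Longrightarrow> ext_below j s b u \<longleftrightarrow> ext j s b"
proof -
  assume u: "code_bound (pr b \<one>) u"
  have "t \<prec> u" if "t \<in> T" "haslen t b" for t
    using that T(2) codes_bound u unfolding btree_def by blast
  then show ?thesis unfolding ext_below_def ext_def less_suc_le using haslen_le by blast
qed

lemma ext_less: "ext j s b \<Longrightarrow> haslen s l \<Longrightarrow> l \<prec> b"
proof -
  assume "ext j s b" "haslen s l"
  then obtain t l' where "haslen t b" "haslen s l'" "elm (pr l' j) t" unfolding ext_def by blast
  moreover have "l' = l"
    using \<open>haslen s l'\<close> \<open>haslen s l\<close> less_linear order.less_irrefl unfolding haslen_def by metis
  ultimately show ?thesis unfolding haslen_def by blast
qed

lemma ext_mono: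
  assumes ext: "ext j s b'" and b: "b \<preceq> b'" and l: "haslen s l" "l \<prec> b"
  shows "ext j s b"
proof -
  obtain t l' where t: "t \<in> T" "haslen t b'" "initseg s t" "haslen s l'" "elm (pr l' j) t"
    using ext unfolding ext_def by blast
  have "l' = l"
    using \<open>haslen s l'\<close> \<open>haslen s l\<close> less_linear order.less_irrefl unfolding haslen_def by metis
  obtain X where X: "X \<in> Sets" "codes t X b'" using T_codes t by blast
  obtain r where r: "codes r X b" using codes_ex' X(1) by blast
  have "elm (pr i c) s \<Longrightarrow> i \<prec> b" for i c
    using l order.less_trans unfolding haslen_def by blast
  then have "initseg s r" "elm (pr l j) r"
    using t(3,5) l(2) \<open>l' = l\<close> unfolding initseg_def codes_elm[OF r] codes_elm[OF X(2)] by blast+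
  moreover have "r \<in> T" using T_truncate[OF t(1) X(2) r b] .
  ultimately show ?thesis unfolding ext_def using codes_haslen[OF r] l(1) by blast
qed

text \<open>The argument \<open>u\<close> bounds the codes of all binary sequences of length \<open>b\<close>; it makes the search
  for an extension of length \<open>b\<close> a bounded one.\<close>

definition dies_first :: "'a \<Rightarrow> 'a \<Rightarrow> 'a \<Rightarrow> 'a \<Rightarrow> bool" where
  "dies_first i j w s \<longleftrightarrow> (\<exists>b. b \<prec> w \<and> (\<exists>u. u \<prec> w \<and> code_bound (pr b \<one>) u \<and>
    \<not> ext_below i s b u \<and> ext_below j s b u))"

lemma D0_dies_first: "D0 (\<lambda>e. dies_first i j (e 0) (e (Suc 0)))"
  unfolding dies_first_def ext_below_def
  by (intro D0_intros D0_code_bound D0_haslen D0_initseg D0_elm Tm_pr T)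

lemma dies_first_iff: "(\<exists>w. dies_first i j w s) \<longleftrightarrow> (\<exists>b. \<not> ext i s b \<and> ext j s b)"
proof
  assume "\<exists>w. dies_first i j w s"
  then show "\<exists>b. \<not> ext i s b \<and> ext j s b" unfolding dies_first_def using ext_below by blast
next
  assume "\<exists>b. \<not> ext i s b \<and> ext j s b"
  then obtain b where b: "\<not> ext i s b" "ext j s b" by blast
  obtain u where u: "code_bound (pr b \<one>) u" using code_bound_ex by blast
  have "b \<prec> b \<oplus> u \<oplus> \<one>" "u \<prec> b \<oplus> u \<oplus> \<one>" by (simp_all add: less_suc_le)
  then show "\<exists>w. dies_first i j w s"
    unfolding dies_first_def using b u ext_below by blast
qed

text \<open>Survival at a level passes down to lower levels above \<open>s\<close> by
  \<open>ext_mono\<close>, so the two assumptions collide at the lower of their two levels.\<close>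

lemma dies_first_disjoint: "dies_first i j w s \<Longrightarrow> dies_first j i w' s \<Longrightarrow> False"
proof -
  assume "dies_first i j w s" "dies_first j i w' s"
  then obtain b b' where b: "\<not> ext i s b" "ext j s b" and b': "\<not> ext j s b'" "ext i s b'"
    using dies_first_iff by blast
  obtain l where l: "haslen s l" using b(2) unfolding ext_def by blast
  have "l \<prec> b" "l \<prec> b'" using ext_less l b b' by blast+
  then show False using ext_mono[OF b(2) _ l] ext_mono[OF b'(2) _ l] b b' order.linear by blast
qed

text \<open>The recursion "entry \<open>i\<close> is one iff the initial segment of length
  \<open>i\<close> is in \<open>Z\<close>". Initial segments have codes at most \<open>s\<close> by
  \<open>codes_truncate_le\<close>, so the bound on \<open>r\<close> loses nothing.\<close>

definition follows :: "'a set \<Rightarrow> 'a \<Rightarrow> bool" where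
  "follows Z s \<longleftrightarrow> bsq s \<and> (\<forall>i. i \<prec> s \<longrightarrow> (\<forall>r. r \<prec> s \<oplus> \<one> \<longrightarrow>
    haslen r i \<and> bsq r \<and> initseg r s \<and> (\<exists>j. j \<prec> s \<and> elm (pr i j) s) \<longrightarrow> (elm (pr i \<one>) s \<longleftrightarrow> r \<in> Z)))"

lemma D0_follows: "Z \<in> Sets \<Longrightarrow> Tm f \<Longrightarrow> D0 (\<lambda>e. follows Z (f e))"
proof (rule D0_subst1[where Q = "follows Z"])
  show "D0 (\<lambda>e. follows Z (e 0))" if "Z \<in> Sets"
    unfolding follows_def by (intro D0_intros D0_bsq D0_haslen D0_initseg D0_elm Tm_pr that)
qed

lemma follows_codes:
  assumes s: "codes s X l"
  shows "follows Z s \<longleftrightarrow> (\<forall>i r. i \<prec> l \<and> codes r X i \<longrightarrow> (i \<in> X \<longleftrightarrow> r \<in> Z))"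
proof
  assume F: "follows Z s"
  show "\<forall>i r. i \<prec> l \<and> codes r X i \<longrightarrow> (i \<in> X \<longleftrightarrow> r \<in> Z)"
  proof (intro allI impI)
    fix i r assume ir: "i \<prec> l \<and> codes r X i"
    then have "i \<preceq> l" by (simp add: le_def)
    then have "r \<preceq> s" using codes_truncate_le s ir by blast
    moreover have "elm (pr i (charf X i)) s" using codes_elm[OF s] ir by blast
    then have "i \<prec> s" "\<exists>j. j \<prec> s \<and> elm (pr i j) s" using elm_pr_less by blast+
    moreover have "haslen r i" "bsq r" "initseg r s"
      using ir codes_haslen codes_bsq codes_initseg[OF s] \<open>i \<preceq> l\<close> by blast+
    ultimately have "elm (pr i \<one>) s \<longleftrightarrow> r \<in> Z"
      using F unfolding follows_def less_suc_le by blast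
    then show "i \<in> X \<longleftrightarrow> r \<in> Z" using codes_elm[OF s] ir by simp
  qed
next
  assume H: "\<forall>i r. i \<prec> l \<and> codes r X i \<longrightarrow> (i \<in> X \<longleftrightarrow> r \<in> Z)"
  show "follows Z s"
    unfolding follows_def
  proof (intro conjI allI impI)
    show "bsq s" using codes_bsq s .
    fix i r
    assume ir: "haslen r i \<and> bsq r \<and> initseg r s \<and> (\<exists>j. j \<prec> s \<and> elm (pr i j) s)"
    then have "i \<prec> l" using codes_elm[OF s] by blast
    obtain R where R: "codes r R i" using ir bsq_codes by blast
    then have "codes r X i" using codes_cong[OF R] codes_initseg[OF s R] ir by blast
    then show "elm (pr i \<one>) s \<longleftrightarrow> r \<in> Z" using H \<open>i \<prec> l\<close> codes_elm[OF s] by simp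
  qed
qed

text \<open>The sequence need not exist as a set beforehand: induction on the length, with the code
  as existential witness, appends the entry that membership of \<open>s\<close> in \<open>Z\<close>
  dictates.\<close>

lemma follows_ex:
  assumes Z: "Z \<in> Sets"
  shows "\<exists>s. follows Z s \<and> haslen s l"
proof (rule S1_induct[where P = "\<lambda>l s. follows Z s \<and> haslen s l"])
  show "D0 (\<lambda>e. follows Z (e (Suc 0)) \<and> haslen (e (Suc 0)) (e 0))"
    by (intro D0_intros D0_follows D0_haslen Z)
  obtain s where s: "codes s Z \<zero>" using codes_ex' Z by blast
  then have "follows Z s" using follows_codes by simp
  then show "\<exists>s. follows Z s \<and> haslen s \<zero>" using codes_haslen[OF s] by blast
next
  fix l s assume s: "follows Z s \<and> haslen s l"
  define X where "X = {i. elm (pr i \<one>) s}"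
  have X: "codes s X l" using s bsq_codes unfolding X_def follows_def by blast
  have X_Sets: "X \<in> Sets" unfolding X_def by (rule elm_one_Sets)
  let ?X = "{i. i \<prec> l \<and> i \<in> X \<or> i = l \<and> s \<in> Z}"
  have "?X \<in> Sets" using X_Sets Z by (intro D0_comprehension D0_intros)
  then obtain s' where s': "codes s' ?X (l \<oplus> \<one>)" using codes_ex' by blast
  have agree: "i \<in> ?X \<longleftrightarrow> i \<in> X" if "i \<prec> l" for i using that by auto
  have "i \<in> ?X \<longleftrightarrow> r \<in> Z" if "i \<prec> l \<oplus> \<one>" and r: "codes r ?X i" for i r
  proof -
    have "i \<preceq> l" using that(1) by (simp add: less_suc_le)
    have rX: "codes r X i"
      by (rule codes_cong[OF r], rule agree) (rule order.less_le_trans[OF _ \<open>i \<preceq> l\<close>])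
    show ?thesis
    proof (cases "i = l")
      case True
      then have "r = s" using codes_unique X rX by blast
      then show ?thesis using True by simp
    next
      case False
      then have "i \<prec> l" using \<open>i \<preceq> l\<close> by (simp add: le_def)
      then show ?thesis using agree s follows_codes[OF X] rX by blast
    qed
  qed
  then have "follows Z s'" using follows_codes[OF s'] by blast
  then show "\<exists>s. follows Z s \<and> haslen s (l \<oplus> \<one>)" using codes_haslen[OF s'] by blast
qed

lemma follows_agree:
  assumes "follows Z s" "codes s X l" "X \<in> Sets" "follows Z t" "codes t W m" "W \<in> Sets"
  shows "i \<prec> l \<longrightarrow> i \<prec> m \<longrightarrow> (i \<in> X \<longleftrightarrow> i \<in> W)"
proof (induction i rule: D0_less_induct)
  case 1
  show ?case by (intro D0_intros assms)
next
  case (2 i)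
  show ?case
  proof (intro impI)
    assume i: "i \<prec> l" "i \<prec> m"
    obtain r where r: "codes r X i" using codes_ex' assms(3) by blast
    have "codes r W i"
      using codes_cong[OF r, of W] 2 i order.less_trans by blast
    then have "i \<in> W \<longleftrightarrow> r \<in> Z" using follows_codes[OF assms(5)] assms(4) i by blast
    moreover have "i \<in> X \<longleftrightarrow> r \<in> Z" using follows_codes[OF assms(2)] assms(1) i r by blast
    ultimately show "i \<in> X \<longleftrightarrow> i \<in> W" by blast
  qed
qed

text \<open>Membership of \<open>i\<close> means that some following sequence has a one at
  \<open>i\<close>, or equivalently that all following sequences longer than \<open>i\<close> do.
  Existence and agreement of such sequences give the equivalence needed for comprehension.\<close>

lemma follows_path:
  assumes Z: "Z \<in> Sets"
  obtains G where "G \<in> Sets" "\<And>r i. codes r G i \<Longrightarrow> i \<in> G \<longleftrightarrow> r \<in> Z"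
proof -
  define P where "P i s \<longleftrightarrow> follows Z s \<and> elm (pr i \<one>) s" for i s
  define Q where "Q i s \<longleftrightarrow> (follows Z s \<and> (\<exists>l. l \<prec> s \<oplus> \<one> \<and> haslen s l \<and> i \<prec> l) \<longrightarrow> elm (pr i \<one>) s)"
    for i s
  have codes: "\<exists>X\<in>Sets. codes s X l" if "follows Z s" "haslen s l" for s l
    using that bsq_codes elm_one_Sets unfolding follows_def by blast
  have agree: "elm (pr i \<one>) t"
    if st: "follows Z s" "elm (pr i \<one>) s" "follows Z t" "haslen t m" "i \<prec> m" for i s t m
  proof -
    obtain l where l: "haslen s l" using st(1) unfolding follows_def bsq_def sq_def by blast
    obtain X W where XW: "X \<in> Sets" "codes s X l" "W \<in> Sets" "codes t W m"
      using codes[OF st(1) l] codes[OF st(3,4)] by blast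
    then have "i \<prec> l" "i \<in> X" using st(2) codes_elm[OF XW(2)] by auto
    then show ?thesis
      using follows_agree[OF st(1) XW(2,1) st(3) XW(4,3)] st(5) codes_elm[OF XW(4)] by simp
  qed
  define G where "G = {i. \<exists>s. P i s}"
  have "G \<in> Sets"
    unfolding G_def
  proof (rule D1_comprehension)
    show "D0 (\<lambda>e. P (e 0) (e (Suc 0)))"
      unfolding P_def by (intro D0_intros D0_follows D0_elm Tm_pr Z)
    show "D0 (\<lambda>e. Q (e 0) (e (Suc 0)))"
      unfolding Q_def by (intro D0_intros D0_follows D0_elm D0_haslen Tm_pr Z)
    show "(\<exists>s. P i s) \<longleftrightarrow> (\<forall>s. Q i s)" for i
    proof
      show "\<forall>s. Q i s" if "\<exists>s. P i s" using that agree unfolding P_def Q_def by blast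
      assume all: "\<forall>s. Q i s"
      obtain s where s: "follows Z s" "haslen s (i \<oplus> \<one>)" using follows_ex[OF Z] by blast
      then have "i \<oplus> \<one> \<prec> s \<oplus> \<one>" using haslen_le less_suc_le by blast
      then show "\<exists>s. P i s" using all s less_suc_self unfolding P_def Q_def by blast
    qed
  qed
  moreover have "i \<in> G \<longleftrightarrow> r \<in> Z" if r: "codes r G i" for r i
  proof -
    obtain s where s: "follows Z s" "haslen s (i \<oplus> \<one>)" using follows_ex[OF Z] by blast
    obtain X where X: "codes s X (i \<oplus> \<one>)" using codes s by blast
    have eq: "j \<in> X \<longleftrightarrow> j \<in> G" if "j \<prec> i \<oplus> \<one>" for j
      using agree[OF _ _ s] that s(1) codes_elm[OF X] unfolding G_def P_def by auto
    have "codes r X i"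
      using codes_cong[OF r] eq less_suc by blast
    then show ?thesis using follows_codes[OF X] s(1) eq less_suc_self by blast
  qed
  ultimately show ?thesis using that by blast
qed

theorem path_ex:
  assumes Z: "Z \<in> Sets" "\<And>w s. dies_first \<zero> \<one> w s \<Longrightarrow> s \<in> Z" "\<And>w s. dies_first \<one> \<zero> w s \<Longrightarrow> s \<notin> Z"
  shows "\<exists>F\<in>Sets. path T F"
proof -
  obtain G where G: "G \<in> Sets" "\<And>r i. codes r G i \<Longrightarrow> i \<in> G \<longleftrightarrow> r \<in> Z"
    by (rule follows_path[OF Z(1)]) (rule that)
  have on_T: "s \<in> T" if s: "codes s G l" for s l
  proof -
    obtain u where u: "code_bound (pr l \<one>) u" using code_bound_ex by blast
    have below: "t \<prec> u" if "t \<in> T" "haslen t l" for t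
      using that T(2) codes_bound u unfolding btree_def by blast
    \<comment> \<open>Only descendants at the fixed level \<open>l\<close> are followed; their codes
      are below \<open>u\<close>, so the invariant is bounded and ordinary induction on
      \<open>i\<close> applies.\<close>
    have "i \<preceq> l \<longrightarrow> (\<exists>t. t \<prec> u \<and> t \<in> T \<and> haslen t l \<and> (\<forall>j. j \<prec> i \<longrightarrow> (elm (pr j \<one>) t \<longleftrightarrow> j \<in> G)))" for i
    proof (induction i rule: D0_induct)
      case D0
      show ?case by (intro D0_intros D0_le D0_haslen D0_elm Tm_pr G T)
    next
      case zero
      then show ?case using T_length_ex below by auto
    next
      case (suc i)
      show ?case
      proof
        assume "i \<oplus> \<one> \<preceq> l"
        then have i: "i \<prec> l" by (simp add: suc_le_iff)
        then obtain t where t: "t \<in> T" "haslen t l" "\<And>j. j \<prec> i \<Longrightarrow> elm (pr j \<one>) t \<longleftrightarrow> j \<in> G"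
          using suc le_def by blast
        obtain X where X: "codes t X l" using T_codes t by blast
        have agree: "j \<in> X \<longleftrightarrow> j \<in> G" if "j \<prec> i" for j
          using t(3)[OF that] codes_elm[OF X] that i order.less_trans by auto
        obtain r where r: "codes r G i" using codes_ex' G(1) by blast
        have ext: "ext (charf W i) r l" if "codes t' W l" "t' \<in> T" "\<And>j. j \<prec> i \<Longrightarrow> j \<in> W \<longleftrightarrow> j \<in> G" for t' W
        proof -
          have "initseg r t'" using codes_initseg[OF that(1) r] that(3) i le_def by blast
          moreover have "elm (pr i (charf W i)) t'" using codes_elm[OF that(1)] i by blast
          ultimately show ?thesis
            unfolding ext_def using that(2) codes_haslen[OF r] codes_haslen[OF that(1)] by blast
        qed
        \<comment> \<open>Some child of \<open>r\<close> reaches level \<open>l\<close>. If the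
          child chosen by \<open>G\<close> did not, it would have died first, and \<open>Z\<close>
          would have selected the other one.\<close>
        have "ext (charf G i) r l"
        proof (rule ccontr)
          assume no: "\<not> ext (charf G i) r l"
          have yes: "ext (charf X i) r l" using ext[OF X t(1) agree] .
          then have "charf X i \<noteq> charf G i" using no by metis
          then consider "i \<in> G" "charf G i = \<one>" "charf X i = \<zero>" | "i \<notin> G" "charf G i = \<zero>" "charf X i = \<one>"
            by (auto simp: charf_def split: if_splits)
          then show False
          proof cases
            case 1
            then have "\<exists>w. dies_first \<one> \<zero> w r" using no yes dies_first_iff by metis
            then show False using Z(3) G(2)[OF r] 1 by blast
          next
            case 2
            then have "\<exists>w. dies_first \<zero> \<one> w r" using no yes dies_first_iff by metis
            then show False using Z(2) G(2)[OF r] 2 by blast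
          qed
        qed
        then obtain t' where t': "t' \<in> T" "haslen t' l" "initseg r t'" "elm (pr i (charf G i)) t'"
          unfolding ext_def codes_haslen[OF r] by blast
        obtain W where W: "codes t' W l" using T_codes t' by blast
        have "\<forall>j. j \<prec> i \<longrightarrow> (j \<in> G \<longleftrightarrow> j \<in> W)" using codes_initseg[OF W r] t'(3) by blast
        moreover have "charf G i = charf W i" using t'(4) codes_elm[OF W] by blast
        then have "i \<in> G \<longleftrightarrow> i \<in> W" using charf_eq by metis
        ultimately have "elm (pr j \<one>) t' \<longleftrightarrow> j \<in> G" if "j \<prec> i \<oplus> \<one>" for j
          using that i order.less_trans codes_elm[OF W] unfolding less_suc by auto
        then show "\<exists>t. t \<prec> u \<and> t \<in> T \<and> haslen t l \<and> (\<forall>j. j \<prec> i \<oplus> \<one> \<longrightarrow> (elm (pr j \<one>) t \<longleftrightarrow> j \<in> G))"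
          using t'(1,2) below by blast
      qed
    qed
    then obtain t where t: "t \<in> T" "haslen t l" "\<And>j. j \<prec> l \<Longrightarrow> elm (pr j \<one>) t \<longleftrightarrow> j \<in> G"
      using le_def by blast
    obtain X where X: "codes t X l" using T_codes t by blast
    have "t = s" using codes_unique[OF X s] t(3) codes_elm[OF X] by auto
    then show ?thesis using t by blast
  qed
  let ?F = "{p. \<exists>i. i \<prec> p \<oplus> \<one> \<and> (i \<in> G \<and> p = pr i \<one> \<or> i \<notin> G \<and> p = pr i \<zero>)}"
  have F: "p \<in> ?F \<longleftrightarrow> (\<exists>i. p = pr i (charf G i))" for p
    by (auto simp: charf_def less_suc_le)
  have "?F \<in> Sets" by (intro D0_comprehension D0_intros Tm_pr G)
  moreover have "path T ?F"
    unfolding path_def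
  proof (intro conjI allI)
    have "nu 2 = \<one> \<oplus> \<one>" by (simp only: numeral_2_eq_2 nu.simps zero_add)
    then have "charf G i \<prec> nu 2" for i by (simp only: less_suc_le charf_le)
    then show "fun_on (\<lambda>x. True) (nu 2) ?F" unfolding fun_on_def F by auto
    fix l
    obtain s where s: "codes s G l" using codes_ex' G(1) by blast
    have "\<forall>i j. elm (pr i j) s \<longrightarrow> pr i j \<in> ?F" unfolding F codes_elm[OF s] by blast
    then show "\<exists>s. s \<in> T \<and> haslen s l \<and> (\<forall>i j. elm (pr i j) s \<longrightarrow> pr i j \<in> ?F)"
      using on_T[OF s] codes_haslen[OF s, of l] by blast
  qed
  ultimately show ?thesis by blast
qed

end

theorem theorem7:
  fixes k :: nat
  assumes "k \<ge> 2"
  shows "RCA0 \<turnstile> sentence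
    (WKL \<^bold>\<longleftrightarrow>
     (\<^bold>\<forall>\<^sub>SV. \<^bold>\<forall>\<^sub>SE. is_graph V E \<^bold>\<and> locally_chromatic V E (numterm k) \<^bold>\<longrightarrow>
        chromatic V E (numterm (2 * k - 1))))"
proof (rule ccontr)
  let ?chromatic = "\<^bold>\<forall>\<^sub>SV. \<^bold>\<forall>\<^sub>SE. is_graph V E \<^bold>\<and> locally_chromatic V E (numterm k) \<^bold>\<longrightarrow>
    chromatic V E (numterm (2 * k - 1))"
  assume no: "\<not> RCA0 \<turnstile> sentence (WKL \<^bold>\<longleftrightarrow> ?chromatic)"
  have successor: "sentence (\<^bold>\<forall>x. \<^bold>\<not> x \<^bold>+ \<^bold>1 \<^bold>= \<^bold>0) \<in> RCA0"
    "sentence (\<^bold>\<forall>x. \<^bold>\<forall>y. x \<^bold>+ \<^bold>1 \<^bold>= y \<^bold>+ \<^bold>1 \<^bold>\<longrightarrow> x \<^bold>= y) \<in> RCA0"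
    unfolding RCA0_def basic_axioms_def by blast+
  obtain zero one :: nat and add mul less and Y :: "nat \<Rightarrow> nat set" and e S
    where model: "\<And>p e S. p \<in> RCA0 \<Longrightarrow> range S \<subseteq> range Y \<Longrightarrow>
        model.sat zero one add mul less (range Y) e S p"
      and fails: "\<not> model.sat zero one add mul less (range Y) e S (sentence (WKL \<^bold>\<longleftrightarrow> ?chromatic))"
    by (rule completeness[OF subst_closed_RCA0 successor no]) (rule that)
  \<comment> \<open>The carrier is the type \<open>nat\<close>, so the identity enumerates it; the
    operations are those of the model and not the usual ones.\<close>
  interpret rca zero one add mul less "range Y" "\<lambda>n. n" Y
    by unfold_locales (simp_all add: model surj_def)
  have "sentence (WKL \<^bold>\<longleftrightarrow> ?chromatic) = Iff (sentence WKL) (sentence ?chromatic)"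
    by (simp add: sentence_def bIff_def)
  then have "\<not> (sat e S (sentence WKL) \<longleftrightarrow> sat e S (sentence ?chromatic))"
    using fails by simp
  moreover have "sat e S (sentence ?chromatic)" if "sat e S (sentence WKL)"
    unfolding sat_chromatic
  proof (intro ballI impI)
    fix V E assume VE: "V \<in> range Y" "E \<in> range Y" "graph V E \<and> loc_chromatic V E (nu k)"
    show "\<exists>C\<in>range Y. col V E (nu (2 * k - 1)) C"
    proof (rule WKL_coloring)
      show "nu k \<noteq> zero" "le (nu k) (nu (2 * k - 1))" using nu_pos nu_mono assms by simp_all
    qed (use VE that[unfolded sat_WKL] in blast)+
  qed
  moreover have "sat e S (sentence WKL)" if col: "sat e S (sentence ?chromatic)"
    unfolding sat_WKL
  proof (intro ballI impI)
    fix T assume "T \<in> range Y" "btree T \<and> \<not> fin T"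
    then interpret infinite_tree zero one add mul less "range Y" "\<lambda>n. n" Y T
      by unfold_locales simp_all
    \<comment> \<open>The separated elements are codes of nodes. \<open>Z\<close> contains those
      whose left subtree dies first, that is, where the path must turn right.\<close>
    interpret separation zero one add mul less "range Y" "\<lambda>n. n" Y k
      "dies_first zero one" "dies_first one zero"
      by unfold_locales (use assms D0_dies_first dies_first_disjoint in auto)
    obtain Z where "Z \<in> range Y" "\<And>w n. dies_first zero one w n \<Longrightarrow> n \<in> Z"
      "\<And>w n. dies_first one zero w n \<Longrightarrow> n \<notin> Z"
      by (rule separating_set) (use col[unfolded sat_chromatic] in blast)+
    then show "\<exists>F\<in>range Y. path T F" by (rule path_ex)
  qed
  ultimately show False by blast
qed

end
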